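(* Fix $X\in\mathbb{G}_\infty$ and $K\in\{1,2,\dots\}$. Then $M^{(X)}_K(Y)=0$ for every $Y\in\mathbb{G}_K$ that does not satisfy $I(Y)\subseteq I(X)$, and $$\sum_{Y\in\mathbb{G}_K,\ I(Y)\subseteq I(X)}M^{(X)}_K(Y)\,\widetilde S_{\nu|K}(Y)=\widetilde S_\nu(X)\qquad\text{for every partition }\nu\in\mathbb{Y}(K).$$ Moreover, $M^{(X)}_K$ is the only probability distribution on $\mathbb{G}_K$ with these two properties.
   Context: Fix $q\in(0,1)$, $\zeta_-<0$, $\zeta_+>0$, and let $\mathfrak{L}=\{\zeta_-q^m:m\in\mathbb{Z}\}\sqcup\{\zeta_+q^n:n\in\mathbb{Z}\}\subset\mathbb{R}\setminus\{0\}$. A configuration is a subset of $\mathfrak{L}$; $\mathbb{G}_N$ ($N\ge1$) is the set of $N$-element configurations $X=(x_1<\dots<x_N)$. A configuration is bounded if it is contained in a bounded segment of $\mathbb{R}$; $\mathbb{G}_\infty$ is the set of all infinite bounded configurations. For a nonempty bounded configuration $X$, $I(X)$ denotes the minimal closed segment $[a,b]\subset\mathbb{R}$ containing $X$. Interlacing. For $a<b$ in $\mathfrak{L}$ put $I(a,b)=[a,b)\cap\mathfrak{L}$ if $a<b<0$; $I(a,b)=[a,b]\cap\mathfrak{L}$ if $a<0<b$; $I(a,b)=(a,b]\cap\mathfrak{L}$ if $0<a<b$. For $X\in\mathbb{G}_{N+1}$, $Y\in\mathbb{G}_N$ write $Y\prec X$ if $y_i\in I(x_i,x_{i+1})$ for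 $i=1,\dots,N$. $q$-links. $\Lambda^{N+1}_N$ is the stochastic matrix of format $\mathbb{G}_{N+1}\times\mathbb{G}_N$ with $$\Lambda^{N+1}_N(X,Y)=\prod_{i=1}^N|y_i|\cdot(1-q)\cdots(1-q^N)\cdot\frac{\prod_{1\le i<j\le N}(y_j-y_i)}{\prod_{1\le i<j\le N+1}(x_j-x_i)}$$ if $Y\prec X$, and $0$ otherwise. For $N>K$, $\Lambda^N_K=\Lambda^N_{N-1}\cdots\Lambda^{K+1}_K$. The measures $M^{(X)}_K$. For a bounded configuration $X$, its variational series $(x_{(1)},x_{(2)},\dots)$ lists its elements in decreasing order of absolute value (positive element first in case of a tie), completed by $0$'s if $X$ is finite. A sequence $\{X(N)\in\mathbb{G}_N\}$ stabilizes to $X\in\mathbb{G}_\infty$ if for each $k$ the $k$-th term of the variational series of $X(N)$ equals $x_{(k)}$ for all large $N$. For $X\in\mathbb{G}_\infty$, $M^{(X)}_K$ is the probability measure on $\mathbb{G}_K$ given by $M^{(X)}_K=\lim_{N\to\infty}\Lambda^N_K(X(N),\cdot)$ (weak limit), where $\{X(N)\}$ is any sequence stabilizing to $X$, e.g. $X(N)=\{x_{(1)},\dots,x_{(N)}\}$; this limit exists and does not depend on the choice of the sequence. Schur functions. $\mathbb{Y}(K)$ is the set of partitions with at most $K$ nonzero parts. For $\nu\in\mathbb{Y}(K)$, $S_{\nu|K}(u_1,\dots,u_K)=\det[u_j^{\nu_i+K-i}]_{i,j=1}^K/\prod_{i<j}(u_i-u_j)$ is the Schur polynomial in $K$ variables;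 for $Y=(y_1<\dots<y_K)\in\mathbb{G}_K$, $\widetilde S_{\nu|K}(Y)=S_{\nu|K}(y_1,\dots,y_K)/S_{\nu|K}(1,q,\dots,q^{K-1})$. $S_\nu$ is the Schur symmetric function in infinitely many variables; $S_\nu(X)$ is its value at the collection $\{x:x\in X\}$ (well defined since $\sum_{x\in X}|x|^k<\infty$ for all $k\ge1$), and $\widetilde S_\nu(X)=S_\nu(X)/S_\nu(1,q,q^2,\dots)$. *)

theory Defs
  imports "HOL-Probability.Probability" "Jordan_Normal_Form.Determinant"
begin

text \<open>All indices start at 0: \<open>x\<^sub>i\<close> in the usual notation is \<open>elt X (i - 1)\<close>,
  \<open>x\<^sub>(\<^sub>k\<^sub>)\<close> is \<open>var_series X (k - 1)\<close>, and the part \<open>\<nu>\<^sub>i\<close> of a partition is \<open>\<nu> (i - 1)\<close>.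
  The parameters \<open>zm < 0 < zp\<close> stand for \<open>\<zeta>\<^sub>-\<close> and \<open>\<zeta>\<^sub>+\<close>.\<close>

subsection \<open>Configurations\<close>

definition qlat :: "real \<Rightarrow> real \<Rightarrow> real \<Rightarrow> real set" where
  "qlat q zm zp = range (\<lambda>m::int. zm * q powi m) \<union> range (\<lambda>n::int. zp * q powi n)"

definition configs :: "real \<Rightarrow> real \<Rightarrow> real \<Rightarrow> nat \<Rightarrow> real set set" where
  "configs q zm zp N = {X. X \<subseteq> qlat q zm zp \<and> finite X \<and> card X = N}"

definition configs_inf :: "real \<Rightarrow> real \<Rightarrow> real \<Rightarrow> real set set" where
  "configs_inf q zm zp = {X. X \<subseteq> qlat q zm zp \<and> infinite X \<and> bounded X}"

text \<open>The minimal closed segment containing \<open>X\<close>, meaningful for nonempty bounded \<open>X\<close>. The infimum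
  or supremum of an infinite configuration may be \<open>0\<close>, which is not a lattice point.\<close>

definition segment_of :: "real set \<Rightarrow> real set" where
  "segment_of X = {Inf X..Sup X}"

definition elt :: "real set \<Rightarrow> nat \<Rightarrow> real" where
  "elt X i = sorted_list_of_set X ! i"


subsection \<open>The q-links\<close>

definition lat_interval :: "real \<Rightarrow> real \<Rightarrow> real \<Rightarrow> real \<Rightarrow> real \<Rightarrow> real set" where
  "lat_interval q zm zp a b =
     (if b < 0 then {a..<b} else if a < 0 then {a..b} else {a<..b}) \<inter> qlat q zm zp"

definition interlaces :: "real \<Rightarrow> real \<Rightarrow> real \<Rightarrow> nat \<Rightarrow> real set \<Rightarrow> real set \<Rightarrow> bool" where
  "interlaces q zm zp N Y X \<longleftrightarrow>
     X \<in> configs q zm zp (Suc N) \<and> Y \<in> configs q zm zp N \<and>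
     (\<forall>i<N. elt Y i \<in> lat_interval q zm zp (elt X i) (elt X (Suc i)))"

definition link :: "real \<Rightarrow> real \<Rightarrow> real \<Rightarrow> nat \<Rightarrow> real set \<Rightarrow> real set \<Rightarrow> real" where
  "link q zm zp N X Y =
     (if interlaces q zm zp N Y X
      then (\<Prod>i<N. \<bar>elt Y i\<bar>) * (\<Prod>i=1..N. 1 - q ^ i) *
           ((\<Prod>j<N. \<Prod>i<j. elt Y j - elt Y i) / (\<Prod>j<Suc N. \<Prod>i<j. elt X j - elt X i))
      else 0)"

text \<open>The matrix product of \<open>d\<close> consecutive links, from level \<open>K + d\<close> down to level \<open>K\<close>. The sum
  over the intermediate level is in general infinite, with nonnegative terms.\<close>

primrec link_prod ::
    "real \<Rightarrow> real \<Rightarrow> real \<Rightarrow> nat \<Rightarrow> nat \<Rightarrow> real set \<Rightarrow> real set \<Rightarrow> real" where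
  "link_prod q zm zp K 0 X Z = of_bool (X = Z)"
| "link_prod q zm zp K (Suc d) X Z =
     (\<Sum>\<^sub>\<infinity>Y\<in>configs q zm zp (K + d). link q zm zp (K + d) X Y * link_prod q zm zp K d Y Z)"

definition Link :: "real \<Rightarrow> real \<Rightarrow> real \<Rightarrow> nat \<Rightarrow> nat \<Rightarrow> real set \<Rightarrow> real set \<Rightarrow> real" where
  "Link q zm zp N K = link_prod q zm zp K (N - K)"


subsection \<open>Stabilizing sequences and the measures on the finite levels\<close>

definition precedes :: "real \<Rightarrow> real \<Rightarrow> bool" where
  "precedes x y \<longleftrightarrow> \<bar>x\<bar> > \<bar>y\<bar> \<or> \<bar>x\<bar> = \<bar>y\<bar> \<and> x > y"

text \<open>The element of \<open>X\<close> with exactly \<open>k\<close> predecessors. In a bounded configuration every element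
  has only finitely many predecessors, because \<open>0\<close> is the only accumulation point of the
  lattice.\<close>

definition var_series :: "real set \<Rightarrow> nat \<Rightarrow> real" where
  "var_series X k =
     (if \<exists>x\<in>X. card {x'\<in>X. precedes x' x} = k
      then THE x. x \<in> X \<and> card {x'\<in>X. precedes x' x} = k else 0)"

definition stabilizes :: "real \<Rightarrow> real \<Rightarrow> real \<Rightarrow> (nat \<Rightarrow> real set) \<Rightarrow> real set \<Rightarrow> bool" where
  "stabilizes q zm zp Xs X \<longleftrightarrow>
     (\<forall>N\<ge>1. Xs N \<in> configs q zm zp N) \<and>
     (\<forall>k. \<forall>\<^sub>F N in sequentially. var_series (Xs N) k = var_series X k)"

text \<open>Weak convergence of a sequence of weight functions on a (countable, discrete) set \<open>S\<close> to a
  probability distribution on \<open>S\<close>: every bounded function on \<open>S\<close> is a continuous test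
  function.\<close>

definition weak_limit :: "'a set \<Rightarrow> (nat \<Rightarrow> 'a \<Rightarrow> real) \<Rightarrow> 'a pmf \<Rightarrow> bool" where
  "weak_limit S w M \<longleftrightarrow> set_pmf M \<subseteq> S \<and>
     (\<forall>f :: 'a \<Rightarrow> real. bounded (range f) \<longrightarrow>
        (\<lambda>N. \<Sum>\<^sub>\<infinity>y\<in>S. w N y * f y) \<longlonglongrightarrow> measure_pmf.expectation M f)"

definition Meas :: "real \<Rightarrow> real \<Rightarrow> real \<Rightarrow> real set \<Rightarrow> nat \<Rightarrow> real set pmf" where
  "Meas q zm zp X K =
     (THE M. \<forall>Xs. stabilizes q zm zp Xs X \<longrightarrow>
        weak_limit (configs q zm zp K) (\<lambda>N. Link q zm zp N K (Xs N)) M)"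


subsection \<open>Schur functions\<close>

definition partitions_le :: "nat \<Rightarrow> (nat \<Rightarrow> nat) set" where
  "partitions_le K = {\<nu>. antimono \<nu> \<and> (\<forall>i\<ge>K. \<nu> i = 0)}"

text \<open>The value of the Schur polynomial in \<open>K\<close> variables at pairwise distinct
  \<open>u 0, \<dots>, u (K - 1)\<close>; with 0-based \<open>i\<close> the exponent \<open>\<nu>\<^sub>i + K - i\<close> becomes
  \<open>\<nu> i + (K - Suc i)\<close>.\<close>

definition schur_poly :: "(nat \<Rightarrow> nat) \<Rightarrow> nat \<Rightarrow> (nat \<Rightarrow> real) \<Rightarrow> real" where
  "schur_poly \<nu> K u =
     Determinant.det (Matrix.mat K K (\<lambda>(i, j). u j ^ (\<nu> i + (K - Suc i)))) /
     (\<Prod>j<K. \<Prod>i<j. u i - u j)"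

text \<open>The value of the Schur symmetric function at a sequence \<open>u\<close> of pairwise distinct numbers with
  \<open>\<Sum>\<^sub>i \<bar>u i\<bar> < \<infinity>\<close>. The symmetric function is the stable (projective) limit of the
  Schur polynomials, so its value is the limit of their values at the truncations of \<open>u\<close>; by
  absolute convergence and symmetry the order of the sequence does not matter.\<close>

definition schur_fun :: "(nat \<Rightarrow> nat) \<Rightarrow> (nat \<Rightarrow> real) \<Rightarrow> real" where
  "schur_fun \<nu> u = lim (\<lambda>N. schur_poly \<nu> N u)"

definition schur_poly_norm :: "real \<Rightarrow> (nat \<Rightarrow> nat) \<Rightarrow> nat \<Rightarrow> real set \<Rightarrow> real" where
  "schur_poly_norm q \<nu> K Y = schur_poly \<nu> K (elt Y) / schur_poly \<nu> K (\<lambda>i. q ^ i)"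

definition schur_fun_norm :: "real \<Rightarrow> (nat \<Rightarrow> nat) \<Rightarrow> real set \<Rightarrow> real" where
  "schur_fun_norm q \<nu> X = schur_fun \<nu> (var_series X) / schur_fun \<nu> (\<lambda>i. q ^ i)"

end

theory Submission
  imports Defs
begin

text \<open>
  The theorem is a moment problem on a space that is almost compact. Configurations of \<open>K\<close> lattice
  points inside the segment of \<open>X\<close> fail to form a compact space only because points may escape to \<open>0\<close>,
  the one accumulation point of the lattice. So three things have to be shown: the moments along a
  stabilizing sequence converge to the stated values, the moments determine a law, and no mass
  escapes to \<open>0\<close>.

  \<^emph>\<open>Moments.\<close> Write \<open>R(f\<^sub>1, \<dots>, f\<^sub>N)(Y) = det [f\<^sub>i(y\<^sub>j)] / V(Y)\<close> with the Vandermonde determinant \<open>V\<close>. The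
  Vandermonde factor of the link cancels the denominator, and the interlacing configurations form a
  product of intervals. Hence a link turns \<open>R(f\<^sub>1, \<dots>, f\<^sub>N)\<close> into a multiple of \<open>R(I f\<^sub>1, \<dots>, I f\<^sub>N, 1)\<close>, where
  \<open>I\<close> is Jackson's q-integral from \<open>0\<close> (\<open>has_sum_link_alternant\<close>). For monomials this says that the
  normalized Schur polynomials form a coherent family (\<open>has_sum_link_schur\<close>), so the moments of
  \<open>\<Lambda>\<^sup>N\<^sub>K(X(N), \<cdot>)\<close> are the values of the normalized Schur polynomials at \<open>X(N)\<close>. A variant of the
  Jacobi-Trudi identity (\<open>schur_poly_eq_entries\<close>) expresses those through the elementary symmetric
  functions of \<open>X(N)\<close>, which converge since the points of \<open>X(N)\<close> near \<open>0\<close> have a small absolute sum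
  (\<open>schur_norm_stabilizes\<close>).

  \<^emph>\<open>Determinacy.\<close> All lattice points are isolated, so Weierstrass' theorem gives a
  polynomial \<open>p\<close> in one variable that is close to the indicator function of a given \<open>Y\<^sub>0\<close> on all lattice
  points of a bounded segment. Two \<open>K\<close>-point configurations one of which contains the other are equal,
  so the product of \<open>p(y)\<close> over \<open>y\<close> in \<open>Y\<close> is close to \<open>1\<close> if \<open>Y = Y\<^sub>0\<close> and to \<open>0\<close> otherwise. The product is a linear
  combination of Schur polynomials. Thus the weight of \<open>Y\<^sub>0\<close> is determined by the moments, uniformly
  in the law (\<open>schur_law_approx\<close>). This yields uniqueness as well as pointwise convergence.

  \<^emph>\<open>Tightness.\<close> The number of points of \<open>Y\<close> in a set \<open>D\<close> is a trace: it is the sum over \<open>i\<close> of \<open>R\<close>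
  applied to the Vandermonde rows with row \<open>i\<close> multiplied by the indicator function of \<open>D\<close>. The links
  lift each summand explicitly, and Cramer's rule turns it into a coefficient of an interpolation
  polynomial on \<open>X(N)\<close>. For \<open>D = {-\<delta><..<\<delta>}\<close> a bound on these coefficients shows that the expected number of
  points in \<open>D\<close> is at most \<open>C \<cdot> \<delta>\<close>, uniformly in \<open>N\<close> (\<open>lp_tight\<close>). The constant
  comes from \<open>K + 2\<close> points of \<open>X\<close>, which all \<open>X(N)\<close> with large \<open>N\<close> contain.

  Together these give a weak limit for every stabilizing sequence; all of them solve the same moment
  problem, so they agree.
\<close>

section \<open>Determinants of functions of two indices\<close>

definition fdet :: "nat \<Rightarrow> (nat \<Rightarrow> nat \<Rightarrow> real) \<Rightarrow> real" where
  "fdet n F = Determinant.det (Matrix.mat n n (\<lambda>(i, j). F i j))"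

definition vdm :: "nat \<Rightarrow> (nat \<Rightarrow> real) \<Rightarrow> real" where
  "vdm n u = (\<Prod>j<n. \<Prod>i<j. u i - u j)"

lemma fdet_row: "fdet n F = (\<Sum>p | p permutes {..<n}. signof p * (\<Prod>i<n. F i (p i)))"
proof -
  have "fdet n F = (\<Sum>p | p permutes {0..<n}. signof p * (\<Prod>i = 0..<n. Matrix.mat n n (\<lambda>(i, j). F i j) $$ (i, p i)))"
    unfolding fdet_def by (rule det_def') simp
  also have "\<dots> = (\<Sum>p | p permutes {..<n}. signof p * (\<Prod>i<n. F i (p i)))"
    unfolding lessThan_atLeast0
    by (intro sum.cong refl arg_cong2[of _ _ _ _ "(*)"] prod.cong) (auto dest: permutes_in_image)
  finally show ?thesis .
qed

lemma fdet_col: "fdet n F = (\<Sum>p | p permutes {..<n}. signof p * (\<Prod>j<n. F (p j) j))"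
proof -
  have "fdet n F = (\<Sum>p | p permutes {0..<n}. signof p * (\<Prod>i<n. Matrix.mat n n (\<lambda>(i, j). F i j) $$ (p i, i)))"
    unfolding fdet_def by (rule det_col) simp
  also have "\<dots> = (\<Sum>p | p permutes {..<n}. signof p * (\<Prod>j<n. F (p j) j))"
    unfolding lessThan_atLeast0
    by (intro sum.cong refl arg_cong2[of _ _ _ _ "(*)"] prod.cong) (auto dest: permutes_in_image)
  finally show ?thesis .
qed

lemma fdet_cong:
  assumes "\<And>i j. i < n \<Longrightarrow> j < n \<Longrightarrow> F i j = G i j"
  shows "fdet n F = fdet n G"
  unfolding fdet_def by (rule arg_cong[of _ _ Determinant.det], rule eq_matI) (use assms in auto)

lemma fdet_scale_rows: "fdet n (\<lambda>i j. c i * F i j) = (\<Prod>i<n. c i) * fdet n F"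
  unfolding fdet_row by (simp add: prod.distrib sum_distrib_left algebra_simps)

lemma fdet_scale_cols: "fdet n (\<lambda>i j. c j * F i j) = (\<Prod>j<n. c j) * fdet n F"
  unfolding fdet_col by (simp add: prod.distrib sum_distrib_left algebra_simps)

lemma fdet_sum_rows:
  assumes "\<And>i. i < n \<Longrightarrow> finite (S i)"
  shows "fdet n (\<lambda>i j. \<Sum>a\<in>S i. G i a j) = (\<Sum>\<alpha>\<in>PiE {..<n} S. fdet n (\<lambda>i j. G i (\<alpha> i) j))"
proof -
  have "fdet n (\<lambda>i j. \<Sum>a\<in>S i. G i a j) =
     (\<Sum>p | p permutes {..<n}. signof p * (\<Sum>\<alpha>\<in>PiE {..<n} S. \<Prod>i<n. G i (\<alpha> i) (p i)))"
    unfolding fdet_row by (intro sum.cong refl arg_cong2[of _ _ _ _ "(*)"] prod_sum_PiE) (use assms in auto)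
  also have "\<dots> = (\<Sum>\<alpha>\<in>PiE {..<n} S. fdet n (\<lambda>i j. G i (\<alpha> i) j))"
    unfolding fdet_row sum_distrib_left by (rule sum.swap)
  finally show ?thesis .
qed

lemma fdet_mult:
  "fdet n (\<lambda>i j. \<Sum>k<n. A i k * B k j) = fdet n A * fdet n B"
proof -
  have "Matrix.mat n n (\<lambda>(i, j). \<Sum>k<n. A i k * B k j) =
      Matrix.mat n n (\<lambda>(i, j). A i j) * Matrix.mat n n (\<lambda>(i, j). B i j)"
    by (rule eq_matI) (auto simp: scalar_prod_def lessThan_atLeast0 intro!: sum.cong)
  thus ?thesis unfolding fdet_def by (simp add: det_mult[of _ n])
qed

lemma fdet_upper_triangular:
  assumes "\<And>i j. j < i \<Longrightarrow> i < n \<Longrightarrow> F i j = 0"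
  shows "fdet n F = (\<Prod>i<n. F i i)"
proof -
  have "fdet n F = prod_list (diag_mat (Matrix.mat n n (\<lambda>(i, j). F i j)))"
    unfolding fdet_def by (rule det_upper_triangular[of _ n]) (use assms in auto)
  also have "\<dots> = (\<Prod>i<n. F i i)"
    by (auto simp: diag_mat_def prod.list_conv_set_nth lessThan_atLeast0 intro!: prod.cong)
  finally show ?thesis .
qed

lemma fdet_identical_rows:
  assumes "i < n" "k < n" "i \<noteq> k" "\<And>j. j < n \<Longrightarrow> F i j = F k j"
  shows "fdet n F = 0"
  unfolding fdet_def
proof (rule det_identical_rows[OF _ assms(3,1,2)])
  show "Matrix.row (Matrix.mat n n (\<lambda>(i, j). F i j)) i = Matrix.row (Matrix.mat n n (\<lambda>(i, j). F i j)) k"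
    by (rule eq_vecI) (simp_all add: assms(1,2,4))
qed simp

lemma fdet_permute_rows:
  assumes "p permutes {..<n}"
  shows "fdet n (\<lambda>i j. F (p i) j) = signof p * fdet n F"
proof -
  have p: "p i < n" if "i < n" for i
    using permutes_in_image[OF assms, of i] that by simp
  have "Determinant.det (Matrix.mat n n (\<lambda>(i, j). F (p i) j)) =
     Determinant.det (Matrix.mat n n (\<lambda>(i, j). Matrix.mat n n (\<lambda>(i, j). F i j) $$ (p i, j)))"
    by (rule arg_cong[of _ _ Determinant.det], rule eq_matI) (simp_all add: p)
  also have "\<dots> = signof p * fdet n F"
    unfolding fdet_def by (rule det_permute_rows) (use assms[unfolded lessThan_atLeast0] in simp_all)
  finally show ?thesis unfolding fdet_def .
qed

lemma fdet_last_row: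
  assumes "\<And>j. j \<le> n \<Longrightarrow> j \<noteq> k \<Longrightarrow> F n j = 0" "k \<le> n"
  shows "fdet (Suc n) F = F n k * (-1) ^ (n + k) * fdet n (\<lambda>i j. F i (if j < k then j else Suc j))"
proof -
  let ?M = "Matrix.mat (Suc n) (Suc n) (\<lambda>(i, j). F i j)"
  have "fdet (Suc n) F = (\<Sum>j<Suc n. ?M $$ (n, j) * cofactor ?M n j)"
    unfolding fdet_def by (rule laplace_expansion_row) auto
  also have "\<dots> = (\<Sum>j<Suc n. if j = k then F n k * cofactor ?M n k else 0)"
    by (intro sum.cong) (use assms in auto)
  also have "\<dots> = F n k * cofactor ?M n k" using assms(2) by simp
  also have "cofactor ?M n k = (-1) ^ (n + k) * fdet n (\<lambda>i j. F i (if j < k then j else Suc j))"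
    unfolding cofactor_def fdet_def mat_delete_def
    by (intro arg_cong2[of _ _ _ _ "(*)"] refl arg_cong[of _ _ Determinant.det] eq_matI) auto
  finally show ?thesis by simp
qed

lemma fdet_last_col:
  assumes "\<And>i. i < n \<Longrightarrow> F i n = 0"
  shows "fdet (Suc n) F = F n n * fdet n F"
proof -
  have T: "fdet m G = fdet m (\<lambda>i j. G j i)" for m G
    by (simp add: fdet_row[of m G] fdet_col[of m "\<lambda>i j. G j i"])
  have "fdet (Suc n) F = fdet (Suc n) (\<lambda>i j. F j i)" by (rule T)
  also have "\<dots> = F n n * (-1) ^ (n + n) * fdet n (\<lambda>i j. F (if j < n then j else Suc j) i)"
    by (rule fdet_last_row) (use assms in auto)
  also have "fdet n (\<lambda>i j. F (if j < n then j else Suc j) i) = fdet n (\<lambda>i j. F j i)"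
    by (rule fdet_cong) auto
  also have "\<dots> = fdet n F" by (rule T[symmetric])
  finally show ?thesis by (simp flip: mult_2)
qed

lemma fdet_unit_tail:
  assumes "k \<le> n" "\<And>i j. k \<le> i \<Longrightarrow> i < n \<Longrightarrow> j < n \<Longrightarrow> F i j = of_bool (i = j)"
  shows "fdet n F = fdet k F"
  using assms
proof (induction n)
  case (Suc n)
  show ?case
  proof (cases "k = Suc n")
    case False
    have "fdet (Suc n) F = F n n * (-1) ^ (n + n) * fdet n (\<lambda>i j. F i (if j < n then j else Suc j))"
      by (rule fdet_last_row) (use Suc.prems False in auto)
    also have "\<dots> = fdet n F"
    proof -
      have "fdet n (\<lambda>i j. F i (if j < n then j else Suc j)) = fdet n F" by (rule fdet_cong) auto
      thus ?thesis using Suc.prems False by (simp flip: mult_2)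
    qed
    also have "\<dots> = fdet k F" using Suc.prems False by (intro Suc.IH) auto
    finally show ?thesis .
  qed auto
qed auto

text \<open>Subtracting from every column its left neighbour turns the last row into a unit vector.\<close>

lemma fdet_column_differences:
  "fdet (Suc n) (\<lambda>i j. if i < n then h i j else 1) = (-1) ^ n * fdet n (\<lambda>i j. h i (Suc j) - h i j)"
proof -
  let ?F = "\<lambda>i j. if i < n then h i j else 1"
  let ?B = "\<lambda>k j. (if k = j then 1 else if Suc k = j then - 1 else 0 :: real)"
  have B: "fdet (Suc n) ?B = 1"
    by (subst fdet_upper_triangular) auto
  have prod: "(\<Sum>k<Suc n. ?F i k * ?B k j) = (case j of 0 \<Rightarrow> ?F i 0 | Suc j' \<Rightarrow> ?F i j - ?F i j')" if "j < Suc n" for i j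
  proof -
    have "(\<Sum>k<Suc n. ?F i k * ?B k j) = (\<Sum>k<Suc n. (if k = j then ?F i k else 0) - (if Suc k = j then ?F i k else 0))"
      by (intro sum.cong) auto
    also have "\<dots> = ?F i j - (\<Sum>k<Suc n. if Suc k = j then ?F i k else 0)"
      unfolding sum_subtractf using that by (subst sum.delta) auto
    also have "\<dots> = (case j of 0 \<Rightarrow> ?F i 0 | Suc j' \<Rightarrow> ?F i j - ?F i j')"
      using that by (cases j) (simp_all add: sum.delta)
    finally show ?thesis .
  qed
  have "fdet (Suc n) ?F = fdet (Suc n) ?F * fdet (Suc n) ?B" by (simp only: B mult_1_right)
  also have "\<dots> = fdet (Suc n) (\<lambda>i j. \<Sum>k<Suc n. ?F i k * ?B k j)" by (rule fdet_mult[symmetric])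
  also have "\<dots> = fdet (Suc n) (\<lambda>i j. case j of 0 \<Rightarrow> ?F i 0 | Suc j' \<Rightarrow> ?F i j - ?F i j')"
    by (rule fdet_cong) (rule prod)
  also have "\<dots> = (-1) ^ n * fdet n (\<lambda>i j. ?F i (Suc j) - ?F i j)"
    by (subst fdet_last_row[where k = 0]) (auto split: nat.splits intro: fdet_cong)
  also have "fdet n (\<lambda>i j. ?F i (Suc j) - ?F i j) = fdet n (\<lambda>i j. h i (Suc j) - h i j)"
    by (rule fdet_cong) auto
  finally show ?thesis .
qed

text \<open>Subtracting from each row \<open>u\<^sub>n\<close> times the next one clears the last column.\<close>

lemma vandermonde_det: "fdet n (\<lambda>i j. u j ^ (n - Suc i)) = vdm n u"
proof (induction n)
  case 0
  show ?case by (simp add: fdet_row vdm_def)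
next
  case (Suc n)
  let ?V = "\<lambda>i j. u j ^ (Suc n - Suc i)"
  let ?A = "\<lambda>i k. (if k = i then 1 else if k = Suc i then - u n else 0 :: real)"
  have A: "fdet (Suc n) ?A = 1"
    by (subst fdet_upper_triangular) auto
  have prod: "(\<Sum>k<Suc n. ?A i k * ?V k j) = (if i < n then u j ^ (n - Suc i) * (u j - u n) else 1)"
    if "i < Suc n" for i j
  proof -
    have "(\<Sum>k<Suc n. ?A i k * ?V k j) = (\<Sum>k<Suc n. (if k = i then ?V k j else 0) - (if k = Suc i then u n * ?V k j else 0))"
      by (intro sum.cong) auto
    also have "\<dots> = ?V i j - (if Suc i < Suc n then u n * ?V (Suc i) j else 0)"
      unfolding sum_subtractf using that by (subst (1 2) sum.delta) auto
    also have "\<dots> = (if i < n then u j ^ (n - Suc i) * (u j - u n) else 1)"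
    proof (cases "i < n")
      case True
      hence "Suc n - Suc i = Suc (n - Suc i)" by simp
      thus ?thesis using True by (simp add: algebra_simps)
    qed (use that in auto)
    finally show ?thesis .
  qed
  have "fdet (Suc n) ?V = fdet (Suc n) ?A * fdet (Suc n) ?V" by (simp only: A mult_1_left)
  also have "\<dots> = fdet (Suc n) (\<lambda>i j. \<Sum>k<Suc n. ?A i k * ?V k j)" by (rule fdet_mult[symmetric])
  also have "\<dots> = fdet (Suc n) (\<lambda>i j. if i < n then u j ^ (n - Suc i) * (u j - u n) else 1)"
    by (rule fdet_cong) (rule prod)
  also have "\<dots> = fdet n (\<lambda>i j. if i < n then u j ^ (n - Suc i) * (u j - u n) else 1)"
    by (subst fdet_last_col) auto
  also have "\<dots> = fdet n (\<lambda>i j. (u j - u n) * u j ^ (n - Suc i))"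
    by (rule fdet_cong) auto
  also have "\<dots> = (\<Prod>j<n. u j - u n) * vdm n u" unfolding fdet_scale_cols Suc.IH ..
  finally show ?case by (simp add: vdm_def)
qed

lemma vdm_nonzero:
  assumes "inj_on u {..<n}" shows "vdm n u \<noteq> 0"
  unfolding vdm_def by (auto simp: prod_zero_iff dest: inj_onD[OF assms])

lemma schur_poly_fdet: "schur_poly \<nu> n u = fdet n (\<lambda>i j. u j ^ (\<nu> i + (n - Suc i))) / vdm n u"
  by (simp add: schur_poly_def fdet_def vdm_def)

section \<open>Principal specializations\<close>

text \<open>At the points \<open>1, q, q\<^sup>2, \<dots>\<close> the difference of consecutive columns factors into a row factor, a
  column factor and the same determinant with one row and one column less.\<close>

lemma fdet_qpow_step:
  "fdet (Suc n) (\<lambda>i j. (q ^ j) ^ (if i < n then Suc (b i) else 0)) =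
     (\<Prod>i<n. 1 - q ^ Suc (b i)) * (\<Prod>j<n. q ^ j) * fdet n (\<lambda>i j. (q ^ j) ^ b i)"
proof -
  have "fdet (Suc n) (\<lambda>i j. (q ^ j) ^ (if i < n then Suc (b i) else 0)) =
    fdet (Suc n) (\<lambda>i j. if i < n then (q ^ j) ^ Suc (b i) else 1)"
    by (rule fdet_cong) auto
  also have "\<dots> = (-1) ^ n * fdet n (\<lambda>i j. (q ^ Suc j) ^ Suc (b i) - (q ^ j) ^ Suc (b i))"
    by (rule fdet_column_differences)
  also have "\<dots> = (-1) ^ n * fdet n (\<lambda>i j. (- (1 - q ^ Suc (b i))) * (q ^ j * (q ^ j) ^ b i))"
    by (rule arg_cong2[of _ _ _ _ "(*)"], simp, rule fdet_cong)
       (simp add: algebra_simps power_mult_distrib)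
  also have "\<dots> = (-1) ^ n * ((\<Prod>i<n. - (1 - q ^ Suc (b i))) * ((\<Prod>j<n. q ^ j) * fdet n (\<lambda>i j. (q ^ j) ^ b i)))"
    by (simp only: fdet_scale_rows fdet_scale_cols)
  also have "(\<Prod>i<n. - (1 - q ^ Suc (b i))) = (-1) ^ n * (\<Prod>i<n. 1 - q ^ Suc (b i))"
    by (subst prod_uminus) simp
  finally show ?thesis by (simp add: mult.assoc flip: power_add mult_2)
qed

lemma fdet_qpow_pos:
  assumes "0 < q" "q < 1" "\<And>i j. i < j \<Longrightarrow> j < n \<Longrightarrow> b j < b i"
  shows "0 < fdet n (\<lambda>i j. (q ^ j) ^ b i)"
  using assms(3)
proof (induction n arbitrary: b)
  case 0
  show ?case by (simp add: fdet_row)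
next
  case (Suc n)
  define c where "c i = b i - b n - 1" for i
  have b: "b i = b n + Suc (c i)" if "i < n" for i
    using Suc.prems[of i n] that by (simp add: c_def)
  have "fdet (Suc n) (\<lambda>i j. (q ^ j) ^ b i) =
      fdet (Suc n) (\<lambda>i j. (q ^ j) ^ b n * (q ^ j) ^ (if i < n then Suc (c i) else 0))"
    by (rule fdet_cong) (use b in \<open>auto simp: power_add less_Suc_eq\<close>)
  also have "\<dots> = (\<Prod>j<Suc n. (q ^ j) ^ b n) *
      ((\<Prod>i<n. 1 - q ^ Suc (c i)) * (\<Prod>j<n. q ^ j) * fdet n (\<lambda>i j. (q ^ j) ^ c i))"
    by (simp only: fdet_scale_cols fdet_qpow_step)
  also have "\<dots> > 0"
  proof -
    have "0 < fdet n (\<lambda>i j. (q ^ j) ^ c i)"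
    proof (rule Suc.IH)
      fix i j assume ij: "i < j" "j < n"
      thus "c j < c i" using b[of i] b[of j] Suc.prems[of i j] by simp
    qed
    moreover have "0 < (\<Prod>i<n. 1 - q ^ Suc (c i))"
      using assms(1,2) by (intro prod_pos) (auto simp: power_Suc_less_one simp del: power_Suc)
    moreover have "0 < (\<Prod>j<Suc n. (q ^ j) ^ b n)" "0 < (\<Prod>j<n. q ^ j)"
      using assms(1) by (intro prod_pos; simp)+
    ultimately show ?thesis by (intro mult_pos_pos)
  qed
  finally show ?case .
qed

lemma vdm_qpow_pos:
  assumes "0 < q" "q < 1" shows "0 < vdm n (\<lambda>i. q ^ i)"
  unfolding vandermonde_det[symmetric] by (rule fdet_qpow_pos) (use assms in auto)

lemma schur_qpow_pos:
  assumes "0 < q" "q < 1" "\<nu> \<in> partitions_le K"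
  shows "0 < schur_poly \<nu> n (\<lambda>i. q ^ i)"
proof -
  have "0 < fdet n (\<lambda>i j. (q ^ j) ^ (\<nu> i + (n - Suc i)))"
  proof (rule fdet_qpow_pos)
    fix i j assume "i < j" "j < n"
    moreover have "\<nu> j \<le> \<nu> i" using assms(3) \<open>i < j\<close> by (auto simp: partitions_le_def intro: antimonoD[of \<nu>])
    ultimately show "\<nu> j + (n - Suc j) < \<nu> i + (n - Suc i)" by simp
  qed (use assms in auto)
  thus ?thesis unfolding schur_poly_fdet using vdm_qpow_pos[OF assms(1,2)] by simp
qed

lemma schur_qpow_step:
  assumes "0 < q" "q < 1" "\<nu> n = 0"
  shows "schur_poly \<nu> (Suc n) (\<lambda>i. q ^ i) =
    schur_poly \<nu> n (\<lambda>i. q ^ i) * (\<Prod>i<n. (1 - q ^ (\<nu> i + (n - i))) / (1 - q ^ (n - i)))"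
proof -
  have e1: "\<nu> i + (Suc n - Suc i) = (if i < n then Suc (\<nu> i + (n - Suc i)) else 0)" if "i < Suc n" for i
    using that assms(3) by (auto simp: less_Suc_eq)
  have e2: "Suc n - Suc i = (if i < n then Suc (n - Suc i) else 0)" if "i < Suc n" for i
    using that by auto
  have 1: "fdet (Suc n) (\<lambda>i j. (q ^ j) ^ (\<nu> i + (Suc n - Suc i))) =
     (\<Prod>i<n. 1 - q ^ Suc (\<nu> i + (n - Suc i))) * (\<Prod>j<n. q ^ j) * fdet n (\<lambda>i j. (q ^ j) ^ (\<nu> i + (n - Suc i)))"
    unfolding fdet_qpow_step[symmetric] by (rule fdet_cong) (simp only: e1)
  have 2: "vdm (Suc n) (\<lambda>i. q ^ i) =
     (\<Prod>i<n. 1 - q ^ Suc (n - Suc i)) * (\<Prod>j<n. q ^ j) * vdm n (\<lambda>i. q ^ i)"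
    unfolding vandermonde_det[symmetric] fdet_qpow_step[symmetric] by (rule fdet_cong) (simp only: e2)
  have 3: "(\<Prod>i<n. 1 - q ^ Suc (\<nu> i + (n - Suc i))) = (\<Prod>i<n. 1 - q ^ (\<nu> i + (n - i)))"
    "(\<Prod>i<n. 1 - q ^ Suc (n - Suc i)) = (\<Prod>i<n. 1 - q ^ (n - i))"
    by (intro prod.cong refl, simp add: Suc_diff_Suc flip: power_Suc add_Suc_right)+
  have "(\<Prod>j<n. q ^ j) \<noteq> 0" using assms by simp
  moreover have "a * p * b / (c * p * d) = b / d * (a / c)" if "p \<noteq> 0" for a b c d p :: real
    using that by (simp add: field_simps)
  ultimately have "a * (\<Prod>j<n. q ^ j) * b / (c * (\<Prod>j<n. q ^ j) * d) = b / d * (a / c)" for a b c d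
    by blast
  thus ?thesis unfolding schur_poly_fdet 1 2 unfolding 3 prod_dividef .
qed

text \<open>A lower bound that does not depend on \<open>n\<close>; it keeps the normalizing constants away from \<open>0\<close> in
  the limit.\<close>

lemma schur_qpow_mono:
  assumes "0 < q" "q < 1" "\<nu> \<in> partitions_le K" "K \<le> n"
  shows "schur_poly \<nu> K (\<lambda>i. q ^ i) \<le> schur_poly \<nu> n (\<lambda>i. q ^ i)"
  using assms(4)
proof (induction n rule: dec_induct)
  case (step n)
  have "\<nu> n = 0" using assms(3) step by (auto simp: partitions_le_def)
  have "1 \<le> (\<Prod>i<n. (1 - q ^ (\<nu> i + (n - i))) / (1 - q ^ (n - i)))"
  proof (intro prod_ge_1)
    fix i assume "i \<in> {..<n}"
    hence "q ^ (n - i) < 1" using assms by (simp add: power_less_one_iff)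
    moreover have "q ^ (\<nu> i + (n - i)) \<le> q ^ (n - i)" using assms by (intro power_decreasing) auto
    ultimately show "1 \<le> (1 - q ^ (\<nu> i + (n - i))) / (1 - q ^ (n - i))" by simp
  qed
  hence "schur_poly \<nu> n (\<lambda>i. q ^ i) * 1 \<le> schur_poly \<nu> (Suc n) (\<lambda>i. q ^ i)"
    unfolding schur_qpow_step[where \<nu> = \<nu> and n = n, OF assms(1,2) \<open>\<nu> n = 0\<close>]
    using schur_qpow_pos[OF assms(1-3), of n] by (intro mult_left_mono) auto
  with step show ?case by simp
qed simp


section \<open>Elementary symmetric functions and interpolation\<close>

text \<open>The generating polynomial of the elementary symmetric functions of \<open>A\<close> with alternating signs.\<close>

definition root_poly :: "real set \<Rightarrow> real poly" where
  "root_poly A = (\<Prod>x\<in>A. [:1, - x:])"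

definition ecoeff :: "real set \<Rightarrow> nat \<Rightarrow> real" where
  "ecoeff A j = coeff (root_poly A) j"

lemma ecoeff_empty: "ecoeff {} j = of_bool (j = 0)"
  by (simp add: ecoeff_def root_poly_def)

lemma ecoeff_insert:
  assumes "finite A" "x \<notin> A"
  shows "ecoeff (insert x A) j = ecoeff A j - x * (case j of 0 \<Rightarrow> 0 | Suc j' \<Rightarrow> ecoeff A j')"
  using assms by (simp add: ecoeff_def root_poly_def coeff_pCons split: nat.split)

lemma ecoeff_0 [simp]: "ecoeff A 0 = 1"
proof (induction A rule: infinite_finite_induct)
  case (insert x F)
  thus ?case by (simp add: ecoeff_insert)
qed (simp_all add: ecoeff_def root_poly_def)

lemma ecoeff_eq_0:
  assumes "finite A" "card A < j" shows "ecoeff A j = 0"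
  using assms by (induction A arbitrary: j) (auto simp: ecoeff_empty ecoeff_insert split: nat.split)

lemma abs_ecoeff_le:
  assumes "finite A" shows "\<bar>ecoeff A j\<bar> \<le> exp (\<Sum>x\<in>A. \<bar>x\<bar>)"
  using assms
proof (induction A arbitrary: j)
  case (insert x A)
  let ?E = "exp (\<Sum>x\<in>A. \<bar>x\<bar>)"
  have "\<bar>x * (case j of 0 \<Rightarrow> 0 | Suc j' \<Rightarrow> ecoeff A j')\<bar> \<le> \<bar>x\<bar> * ?E"
    using insert.IH by (auto simp: abs_mult intro!: mult_left_mono split: nat.split)
  hence "\<bar>ecoeff (insert x A) j\<bar> \<le> ?E + \<bar>x\<bar> * ?E"
    using insert.IH[of j] by (simp add: ecoeff_insert[OF insert.hyps])
  also have "\<dots> \<le> exp \<bar>x\<bar> * ?E"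
    using mult_right_mono[OF exp_ge_add_one_self[of "\<bar>x\<bar>"], of ?E] by (simp add: algebra_simps)
  finally show ?case using insert.hyps by (simp add: exp_add)
qed (simp add: ecoeff_empty)

text \<open>Adding a point \<open>x\<close> changes a coefficient by \<open>x\<close> times another coefficient.\<close>

lemma abs_ecoeff_diff_le:
  assumes "finite A" "B \<subseteq> A"
  shows "\<bar>ecoeff A j - ecoeff B j\<bar> \<le> exp (\<Sum>x\<in>A. \<bar>x\<bar>) * (\<Sum>x\<in>A - B. \<bar>x\<bar>)"
proof -
  have fB: "finite B" using assms finite_subset by blast
  have "\<bar>ecoeff (B \<union> C) j - ecoeff B j\<bar> \<le> exp (\<Sum>x\<in>B \<union> C. \<bar>x\<bar>) * (\<Sum>x\<in>C. \<bar>x\<bar>)"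
    if "finite C" "C \<inter> B = {}" for C
    using that
  proof (induction C)
    case (insert x C)
    let ?D = "B \<union> C" let ?s = "\<Sum>x\<in>?D. \<bar>x\<bar>"
    have fD: "finite ?D" "x \<notin> ?D" using insert fB by auto
    have "\<bar>x * (case j of 0 \<Rightarrow> 0 | Suc j' \<Rightarrow> ecoeff ?D j')\<bar> \<le> \<bar>x\<bar> * exp ?s"
      using abs_ecoeff_le[OF fD(1)] by (auto simp: abs_mult intro!: mult_left_mono split: nat.split)
    hence "\<bar>ecoeff (insert x ?D) j - ecoeff B j\<bar> \<le> exp ?s * (\<Sum>x\<in>C. \<bar>x\<bar>) + \<bar>x\<bar> * exp ?s"
      using insert.IH insert.prems unfolding ecoeff_insert[OF fD] by force
    also have "\<dots> = exp ?s * (\<Sum>x\<in>insert x C. \<bar>x\<bar>)" using insert.hyps by (simp add: algebra_simps)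
    also have "\<dots> \<le> exp (\<Sum>x\<in>insert x ?D. \<bar>x\<bar>) * (\<Sum>x\<in>insert x C. \<bar>x\<bar>)"
      using fD by (intro mult_right_mono) (auto intro!: sum_nonneg)
    finally show ?case by simp
  qed simp
  moreover have "(A - B) \<inter> B = {}" by blast
  ultimately show ?thesis using assms by (metis Diff_partition finite_Diff)
qed

text \<open>The reciprocal polynomial of \<open>root_poly A\<close> is the monic polynomial with root set \<open>A\<close>.\<close>

lemma sum_ecoeff_power:
  assumes "finite A"
  shows "(\<Sum>j\<le>card A. ecoeff A j * z ^ (card A - j)) = (\<Prod>x\<in>A. z - x)"
  using assms
proof (induction A)
  case (insert x A)
  let ?N = "card A"
  have "(\<Sum>j\<le>Suc ?N. ecoeff (insert x A) j * z ^ (Suc ?N - j)) =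
      (\<Sum>j\<le>Suc ?N. ecoeff A j * z ^ (Suc ?N - j)) -
      (\<Sum>j\<le>Suc ?N. x * (case j of 0 \<Rightarrow> 0 | Suc j' \<Rightarrow> ecoeff A j') * z ^ (Suc ?N - j))"
    unfolding ecoeff_insert[OF insert.hyps] by (simp add: algebra_simps sum_subtractf del: sum.atMost_Suc)
  also have "(\<Sum>j\<le>Suc ?N. ecoeff A j * z ^ (Suc ?N - j)) = (\<Sum>j\<le>?N. z * (ecoeff A j * z ^ (?N - j)))"
    using insert.hyps by (auto simp: ecoeff_eq_0 Suc_diff_le intro!: sum.cong)
  also have "(\<Sum>j\<le>Suc ?N. x * (case j of 0 \<Rightarrow> 0 | Suc j' \<Rightarrow> ecoeff A j') * z ^ (Suc ?N - j)) =
      (\<Sum>j\<le>?N. x * (ecoeff A j * z ^ (?N - j)))"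
    unfolding sum.atMost_Suc_shift by (simp add: mult.assoc)
  finally show ?case
    using insert by (simp add: algebra_simps flip: sum_distrib_left)
qed (simp add: ecoeff_empty)

text \<open>The coefficient of \<open>z ^ (card A - 1 - i)\<close> in the polynomial that interpolates \<open>g\<close> on \<open>A\<close>,
  in Lagrange's form.\<close>

definition interp_coeff :: "real set \<Rightarrow> (real \<Rightarrow> real) \<Rightarrow> nat \<Rightarrow> real" where
  "interp_coeff A g i = (\<Sum>x\<in>A. g x * ecoeff (A - {x}) i / (\<Prod>m\<in>A - {x}. x - m))"

lemma sum_interp_coeff:
  assumes "finite A" "z \<in> A"
  shows "(\<Sum>i<card A. interp_coeff A g i * z ^ (card A - Suc i)) = g z"
proof -
  have N: "{..<card A} = {..card (A - {x})}" "card A - Suc i = card (A - {x}) - i" if "x \<in> A" for x i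
    using assms that card_gt_0_iff[of A] by (auto simp: card_Diff_singleton)
  have "(\<Sum>i<card A. interp_coeff A g i * z ^ (card A - Suc i)) =
     (\<Sum>i<card A. \<Sum>x\<in>A. g x / (\<Prod>m\<in>A - {x}. x - m) * (ecoeff (A - {x}) i * z ^ (card A - Suc i)))"
    unfolding interp_coeff_def sum_distrib_right by (intro sum.cong) auto
  also have "\<dots> = (\<Sum>x\<in>A. g x / (\<Prod>m\<in>A - {x}. x - m) *
      (\<Sum>i<card A. ecoeff (A - {x}) i * z ^ (card A - Suc i)))"
    unfolding sum_distrib_left by (rule sum.swap)
  also have "\<dots> = (\<Sum>x\<in>A. g x / (\<Prod>m\<in>A - {x}. x - m) * (\<Prod>m\<in>A - {x}. z - m))"
  proof (rule sum.cong[OF refl])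
    fix x assume x: "x \<in> A"
    have "(\<Sum>i<card A. ecoeff (A - {x}) i * z ^ (card A - Suc i)) = (\<Prod>m\<in>A - {x}. z - m)"
      using assms x by (simp only: N[OF x] sum_ecoeff_power finite_Diff)
    thus "g x / (\<Prod>m\<in>A - {x}. x - m) * (\<Sum>i<card A. ecoeff (A - {x}) i * z ^ (card A - Suc i)) =
      g x / (\<Prod>m\<in>A - {x}. x - m) * (\<Prod>m\<in>A - {x}. z - m)" by simp
  qed
  also have "\<dots> = (\<Sum>x\<in>A. if x = z then g z else 0)"
    using assms by (intro sum.cong) (auto simp: prod_zero_iff)
  finally show ?thesis using assms by simp
qed

text \<open>The trace of the operator that multiplies by \<open>f\<close> and interpolates is the sum of the values
  of \<open>f\<close>: multiplication by \<open>f\<close> on the functions on \<open>A\<close> is diagonal.\<close>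

lemma sum_interp_coeff_diagonal:
  assumes "finite A"
  shows "(\<Sum>i<card A. interp_coeff A (\<lambda>x. f x * x ^ (card A - Suc i)) i) = (\<Sum>x\<in>A. f x)"
proof -
  have "(\<Sum>i<card A. interp_coeff A (\<lambda>x. f x * x ^ (card A - Suc i)) i) =
     (\<Sum>x\<in>A. f x / (\<Prod>m\<in>A - {x}. x - m) * (\<Sum>i<card A. ecoeff (A - {x}) i * x ^ (card A - Suc i)))"
    unfolding interp_coeff_def sum_distrib_left by (subst sum.swap) (simp add: mult_ac)
  also have "\<dots> = (\<Sum>x\<in>A. f x)"
  proof (rule sum.cong[OF refl])
    fix x assume x: "x \<in> A"
    have N: "{..<card A} = {..card (A - {x})}" "card A - Suc i = card (A - {x}) - i" for i
      using assms x card_gt_0_iff[of A] by (auto simp: card_Diff_singleton)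
    have "(\<Sum>i<card A. ecoeff (A - {x}) i * x ^ (card A - Suc i)) = (\<Prod>m\<in>A - {x}. x - m)"
      using assms x by (simp only: N sum_ecoeff_power finite_Diff)
    thus "f x / (\<Prod>m\<in>A - {x}. x - m) * (\<Sum>i<card A. ecoeff (A - {x}) i * x ^ (card A - Suc i)) = f x"
      using assms by (auto simp: prod_zero_iff)
  qed
  finally show ?thesis .
qed

lemma fdet_row_linear:
  assumes "i < n"
  shows "fdet n (\<lambda>k j. if k = i then \<Sum>l\<in>S. c l * G l j else F k j) =
    (\<Sum>l\<in>S. c l * fdet n (\<lambda>k j. if k = i then G l j else F k j))"
proof -
  have split: "(\<Prod>k<n. if k = i then h (p k) else F k (p k)) = h (p i) * (\<Prod>k\<in>{..<n} - {i}. F k (p k))"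
    for h :: "nat \<Rightarrow> real" and p
    using assms by (subst prod.remove[of _ i]) (auto intro!: prod.cong)
  have "fdet n (\<lambda>k j. if k = i then \<Sum>l\<in>S. c l * G l j else F k j) =
     (\<Sum>p | p permutes {..<n}. \<Sum>l\<in>S. c l * (signof p * (G l (p i) * (\<Prod>k\<in>{..<n} - {i}. F k (p k)))))"
    unfolding fdet_row split[of "\<lambda>j. \<Sum>l\<in>S. c l * G l j"]
    by (simp add: sum_distrib_left sum_distrib_right mult_ac)
  also have "\<dots> = (\<Sum>l\<in>S. c l * fdet n (\<lambda>k j. if k = i then G l j else F k j))"
    unfolding fdet_row split[of "G _"] sum_distrib_left by (rule sum.swap)
  finally show ?thesis .
qed

text \<open>Cramer's rule for the Vandermonde matrix.\<close>

lemma fdet_vandermonde_replace_row: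
  assumes "inj_on u {..<n}" "i < n"
  shows "fdet n (\<lambda>k j. if k = i then g (u j) else u j ^ (n - Suc k)) =
     interp_coeff (u ` {..<n}) g i * vdm n u"
proof -
  let ?A = "u ` {..<n}"
  have card: "card ?A = n" using assms by (simp add: card_image)
  have "fdet n (\<lambda>k j. if k = i then g (u j) else u j ^ (n - Suc k)) =
     fdet n (\<lambda>k j. if k = i then \<Sum>l<n. interp_coeff ?A g l * u j ^ (n - Suc l) else u j ^ (n - Suc k))"
  proof (rule fdet_cong)
    fix k j assume "k < n" "j < n"
    thus "(if k = i then g (u j) else u j ^ (n - Suc k)) =
      (if k = i then \<Sum>l<n. interp_coeff ?A g l * u j ^ (n - Suc l) else u j ^ (n - Suc k))"
      using sum_interp_coeff[of ?A "u j" g] by (simp add: card)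
  qed
  also have "\<dots> = (\<Sum>l<n. interp_coeff ?A g l * fdet n (\<lambda>k j. if k = i then u j ^ (n - Suc l) else u j ^ (n - Suc k)))"
    by (rule fdet_row_linear[OF assms(2)])
  also have "\<dots> = (\<Sum>l<n. if l = i then interp_coeff ?A g i * vdm n u else 0)"
  proof (rule sum.cong[OF refl])
    fix l assume l: "l \<in> {..<n}"
    have "fdet n (\<lambda>k j. if k = i then u j ^ (n - Suc l) else u j ^ (n - Suc k)) = (if l = i then vdm n u else 0)"
    proof (cases "l = i")
      case True
      thus ?thesis unfolding vandermonde_det[symmetric] by (auto intro: fdet_cong)
    next
      case False
      thus ?thesis using l assms by (simp add: fdet_identical_rows[of i n l])
    qed
    thus "interp_coeff ?A g l * fdet n (\<lambda>k j. if k = i then u j ^ (n - Suc l) else u j ^ (n - Suc k)) =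
       (if l = i then interp_coeff ?A g i * vdm n u else 0)" by simp
  qed
  also have "\<dots> = interp_coeff ?A g i * vdm n u" using assms by simp
  finally show ?thesis .
qed

section \<open>Schur polynomials in terms of elementary symmetric functions\<close>

text \<open>For \<open>e = ecoeff A\<close> and \<open>N = card A\<close>, the number \<open>power_rem e m j\<close> is the coefficient of
  \<open>z ^ (N - 1 - j)\<close> in the remainder of \<open>z ^ (N + m)\<close> modulo the monic polynomial with root set \<open>A\<close>.
  The point is that it depends on \<open>A\<close> only through \<open>e\<close>, and not on \<open>N\<close>.\<close>

fun power_rem :: "(nat \<Rightarrow> real) \<Rightarrow> nat \<Rightarrow> nat \<Rightarrow> real" where
  "power_rem e 0 j = - e (Suc j)"
| "power_rem e (Suc m) j = power_rem e m (Suc j) + power_rem e m 0 * power_rem e 0 j"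

lemma power_rem_eq_0:
  assumes "finite A" "card A \<le> j" shows "power_rem (ecoeff A) m j = 0"
  using assms(2) by (induction m arbitrary: j) (auto simp: ecoeff_eq_0 assms(1))

lemma power_eq_sum_power_rem:
  assumes "finite A" "z \<in> A"
  shows "z ^ (card A + m) = (\<Sum>j<card A. power_rem (ecoeff A) m j * z ^ (card A - Suc j))"
proof -
  have "(\<Sum>j\<le>card A. ecoeff A j * z ^ (card A - j)) = 0"
    unfolding sum_ecoeff_power[OF assms(1)] using assms by (simp add: prod_zero_iff)
  hence "z ^ card A + (\<Sum>j<card A. ecoeff A (Suc j) * z ^ (card A - Suc j)) = 0"
    by (simp add: sum.atMost_shift)
  hence base: "z ^ card A = (\<Sum>j<card A. power_rem (ecoeff A) 0 j * z ^ (card A - Suc j))"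
    by (simp add: sum_negf)
  show ?thesis
  proof (induction m)
    case 0
    show ?case using base by simp
  next
    case (Suc m)
    let ?N = "card A" and ?r = "power_rem (ecoeff A)"
    obtain N where N: "?N = Suc N" using assms card_gt_0_iff[of A] by (cases ?N) auto
    have z0: "z ^ ?N = (\<Sum>j<?N. ?r 0 j * z ^ (?N - Suc j))" using base by simp
    have "z ^ (?N + Suc m) = (\<Sum>j<Suc N. ?r m j * z ^ (Suc N - j))"
    proof -
      have "z ^ (?N + Suc m) = (\<Sum>j<Suc N. ?r m j * (z * z ^ (N - j)))"
        using Suc.IH by (simp add: N sum_distrib_left mult.left_commute del: sum.lessThan_Suc)
      also have "\<dots> = (\<Sum>j<Suc N. ?r m j * z ^ (Suc N - j))"
        by (intro sum.cong refl) (simp add: Suc_diff_le)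
      finally show ?thesis .
    qed
    also have "\<dots> = ?r m 0 * z ^ ?N + (\<Sum>j<N. ?r m (Suc j) * z ^ (N - j))"
      unfolding sum.lessThan_Suc_shift by (simp add: N)
    also have "(\<Sum>j<N. ?r m (Suc j) * z ^ (N - j)) = (\<Sum>j<Suc N. ?r m (Suc j) * z ^ (N - j))"
      using assms(1) by (simp add: power_rem_eq_0 N)
    also have "\<dots> = (\<Sum>j<?N. ?r m (Suc j) * z ^ (?N - Suc j))" by (simp add: N)
    also have "?r m 0 * z ^ ?N = (\<Sum>j<?N. ?r m 0 * ?r 0 j * z ^ (?N - Suc j))"
      unfolding z0 sum_distrib_left by (simp add: mult.assoc)
    finally show ?case by (simp add: algebra_simps sum.distrib sum_negf sum_subtractf)
  qed
qed

definition schur_entry :: "(nat \<Rightarrow> real) \<Rightarrow> (nat \<Rightarrow> nat) \<Rightarrow> nat \<Rightarrow> nat \<Rightarrow> real" where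
  "schur_entry e \<nu> i j = (if i < \<nu> i then power_rem e (\<nu> i - Suc i) j else of_bool (i = \<nu> i + j))"

text \<open>A variant of the Jacobi-Trudi identity: reducing the exponents modulo the polynomial
  with root set \<open>A\<close> exhibits the alternant as a \<open>K \<times> K\<close> determinant times the Vandermonde
  determinant. The \<open>K \<times> K\<close> determinant does not depend on the order of the variables, and the
  number of variables enters only through their elementary symmetric functions.\<close>

lemma schur_poly_eq_entries:
  assumes "\<nu> \<in> partitions_le K" "K \<le> n" "inj_on u {..<n}"
  shows "schur_poly \<nu> n u = fdet K (schur_entry (ecoeff (u ` {..<n})) \<nu>)"
proof -
  let ?A = "u ` {..<n}" let ?s = "schur_entry (ecoeff ?A) \<nu>"
  have card: "card ?A = n" using assms by (simp add: card_image)
  have "fdet n (\<lambda>i j. u j ^ (\<nu> i + (n - Suc i))) = fdet n (\<lambda>i j. \<Sum>k<n. ?s i k * u j ^ (n - Suc k))"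
  proof (rule fdet_cong)
    fix i j assume ij: "i < n" "j < n"
    show "u j ^ (\<nu> i + (n - Suc i)) = (\<Sum>k<n. ?s i k * u j ^ (n - Suc k))"
    proof (cases "i < \<nu> i")
      case True
      hence "\<nu> i + (n - Suc i) = n + (\<nu> i - Suc i)" using ij by simp
      thus ?thesis using power_eq_sum_power_rem[of ?A "u j" "\<nu> i - Suc i"] ij True
        by (simp add: card schur_entry_def)
    next
      case False
      have "(\<Sum>k<n. ?s i k * u j ^ (n - Suc k)) = (\<Sum>k<n. if k = i - \<nu> i then u j ^ (n - Suc k) else 0)"
        using False by (intro sum.cong) (auto simp: schur_entry_def)
      also have "\<dots> = u j ^ (n - Suc (i - \<nu> i))" using ij by simp
      also have "n - Suc (i - \<nu> i) = \<nu> i + (n - Suc i)" using ij False by simp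
      finally show ?thesis by simp
    qed
  qed
  also have "\<dots> = fdet n ?s * vdm n u" unfolding fdet_mult vandermonde_det ..
  also have "fdet n ?s = fdet K ?s"
    using assms(1,2) by (intro fdet_unit_tail) (auto simp: schur_entry_def partitions_le_def)
  finally show ?thesis unfolding schur_poly_fdet using vdm_nonzero[OF assms(3)] by simp
qed

lemma schur_poly_convergent:
  assumes "\<nu> \<in> partitions_le K" "\<And>N. inj_on (u N) {..<N}"
    and "\<And>j. (\<lambda>N. ecoeff (u N ` {..<N}) j) \<longlonglongrightarrow> e j"
  shows "(\<lambda>N. schur_poly \<nu> N (u N)) \<longlonglongrightarrow> fdet K (schur_entry e \<nu>)"
proof -
  have rem: "(\<lambda>N. power_rem (ecoeff (u N ` {..<N})) m j) \<longlonglongrightarrow> power_rem e m j" for m j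
    by (induction m arbitrary: j) (auto intro!: tendsto_intros assms(3))
  have entry: "(\<lambda>N. schur_entry (ecoeff (u N ` {..<N})) \<nu> i j) \<longlonglongrightarrow> schur_entry e \<nu> i j" for i j
    by (auto simp: schur_entry_def intro: rem)
  have "(\<lambda>N. fdet K (schur_entry (ecoeff (u N ` {..<N})) \<nu>)) \<longlonglongrightarrow> fdet K (schur_entry e \<nu>)"
    unfolding fdet_row by (intro tendsto_intros entry)
  thus ?thesis
  proof (rule Lim_transform_eventually)
    show "\<forall>\<^sub>F N in sequentially. fdet K (schur_entry (ecoeff (u N ` {..<N})) \<nu>) = schur_poly \<nu> N (u N)"
      using eventually_ge_at_top[of K] by eventually_elim (use assms in \<open>simp add: schur_poly_eq_entries\<close>)
  qed
qed


section \<open>The lattice and the q-integral\<close>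

text \<open>Local boundedness makes the q-integral below converge absolutely, and is inherited by it.\<close>

definition loc_bdd :: "(real \<Rightarrow> real) \<Rightarrow> bool" where
  "loc_bdd g \<longleftrightarrow> (\<forall>R. \<exists>C. \<forall>x. \<bar>x\<bar> \<le> R \<longrightarrow> \<bar>g x\<bar> \<le> C)"

lemma loc_bddD:
  assumes "loc_bdd g"
  obtains C where "0 \<le> C" "\<And>x. \<bar>x\<bar> \<le> R \<Longrightarrow> \<bar>g x\<bar> \<le> C"
proof -
  obtain C where C: "\<And>x. \<bar>x\<bar> \<le> R \<Longrightarrow> \<bar>g x\<bar> \<le> C" using assms unfolding loc_bdd_def by blast
  show ?thesis by (rule that[of "max C 0"]) (use C in \<open>auto intro: max.coboundedI1\<close>)
qed

lemma loc_bdd_power: "loc_bdd (\<lambda>x. x ^ n)"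
  unfolding loc_bdd_def
proof
  fix R show "\<exists>C. \<forall>x::real. \<bar>x\<bar> \<le> R \<longrightarrow> \<bar>x ^ n\<bar> \<le> C"
    by (rule exI[of _ "R ^ n"]) (auto simp: power_abs intro: power_mono)
qed

lemma loc_bdd_of_bool_mult:
  assumes "loc_bdd g" shows "loc_bdd (\<lambda>x. of_bool (P x) * g x)"
  unfolding loc_bdd_def
proof
  fix R
  obtain C where "0 \<le> C" "\<And>x. \<bar>x\<bar> \<le> R \<Longrightarrow> \<bar>g x\<bar> \<le> C" using loc_bddD[OF assms] by blast
  thus "\<exists>C. \<forall>x. \<bar>x\<bar> \<le> R \<longrightarrow> \<bar>of_bool (P x) * g x\<bar> \<le> C"
    by (intro exI[of _ C]) (auto simp: of_bool_def)
qed

lemma loc_bdd_cmult: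
  assumes "loc_bdd g" shows "loc_bdd (\<lambda>x. c * g x)"
  unfolding loc_bdd_def
proof
  fix R
  obtain C where "0 \<le> C" "\<And>x. \<bar>x\<bar> \<le> R \<Longrightarrow> \<bar>g x\<bar> \<le> C" using loc_bddD[OF assms] by blast
  thus "\<exists>C. \<forall>x. \<bar>x\<bar> \<le> R \<longrightarrow> \<bar>c * g x\<bar> \<le> C"
    by (intro exI[of _ "\<bar>c\<bar> * C"]) (auto simp: abs_mult intro!: mult_left_mono)
qed

locale qlattice =
  fixes q zm zp :: real
  assumes q_pos: "0 < q" and q_less_1: "q < 1" and zm_neg: "zm < 0" and zp_pos: "0 < zp"
begin

abbreviation "L \<equiv> qlat q zm zp"
abbreviation "ivl \<equiv> lat_interval q zm zp"
abbreviation "lk \<equiv> link q zm zp"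

lemma L_nonzero: "x \<in> L \<Longrightarrow> x \<noteq> 0"
  using q_pos zm_neg zp_pos by (auto simp: qlat_def)

lemma countable_L: "countable L"
  by (simp add: qlat_def)

lemma L_shift:
  assumes "x \<in> L" shows "x * q powi k \<in> L"
proof -
  obtain a m where a: "a = zm \<or> a = zp" "x = a * q powi m" using assms by (auto simp: qlat_def)
  have "x * q powi k = a * q powi (m + k)"
    using q_pos by (simp add: a(2) power_int_add)
  thus ?thesis using a(1) unfolding qlat_def by auto
qed

lemma L_same_sign:
  assumes "x \<in> L" "y \<in> L" "0 < x * y"
  obtains r :: int where "y = x * q powi r"
proof -
  have *: "a * q powi n = a * q powi m * q powi (n - m)" for a and m n :: int
    using q_pos by (simp flip: power_int_add)
  have p: "0 < q powi m" for m :: int using q_pos by simp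
  have "\<exists>r::int. y = x * q powi r"
    using assms * unfolding qlat_def
    using zm_neg zp_pos p by (auto simp: zero_less_mult_iff mult_less_0_iff) (metis less_asym)+
  thus ?thesis using that by blast
qed

lemma L_below:
  assumes "x \<in> L" "y \<in> L" "0 < x * y" "\<bar>y\<bar> \<le> \<bar>x\<bar>"
  obtains k :: nat where "y = x * q ^ k"
proof -
  obtain r :: int where r: "y = x * q powi r" using L_same_sign assms by blast
  have "q powi r \<le> 1" using assms(4) L_nonzero[OF assms(1)] q_pos by (simp add: r abs_mult)
  have "0 \<le> r"
  proof (rule ccontr)
    assume "\<not> 0 \<le> r"
    hence "1 < inverse q powi (- r)"
      using q_pos q_less_1 by (intro one_less_power_int) (auto simp: one_less_inverse)
    hence "1 < q powi r" using q_pos by (simp add: power_int_minus power_int_inverse)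
    with \<open>q powi r \<le> 1\<close> show False by simp
  qed
  hence "y = x * q ^ nat r" using r by (simp add: power_int_def)
  thus ?thesis by (rule that)
qed

definition orbit :: "real \<Rightarrow> real set" where
  "orbit x = range (\<lambda>k::nat. x * q ^ k)"

lemma orbit_eq:
  assumes "x \<in> L" shows "orbit x = {y \<in> L. 0 < x * y \<and> \<bar>y\<bar> \<le> \<bar>x\<bar>}"
proof (intro equalityI subsetI)
  fix y assume "y \<in> orbit x"
  then obtain k where k: "y = x * q ^ k" by (auto simp: orbit_def)
  have "y \<in> L" using L_shift[OF assms, of "int k"] by (simp add: k)
  moreover have "\<bar>y\<bar> \<le> \<bar>x\<bar>" using q_pos q_less_1
    by (simp add: k abs_mult mult_left_le power_le_one)
  moreover have "0 < x * y"
  proof -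
    have "x * y = x ^ 2 * q ^ k" by (simp add: k power2_eq_square)
    thus ?thesis using L_nonzero[OF assms] q_pos by simp
  qed
  ultimately show "y \<in> {y \<in> L. 0 < x * y \<and> \<bar>y\<bar> \<le> \<bar>x\<bar>}" by blast
next
  fix y assume "y \<in> {y \<in> L. 0 < x * y \<and> \<bar>y\<bar> \<le> \<bar>x\<bar>}"
  hence "y \<in> L" "0 < x * y" "\<bar>y\<bar> \<le> \<bar>x\<bar>" by auto
  then obtain k where "y = x * q ^ k" by (rule L_below[OF assms])
  thus "y \<in> orbit x" unfolding orbit_def by (rule range_eqI)
qed

text \<open>Up to the factor \<open>1 - q\<close>, this is Jackson's integral of \<open>g\<close> from \<open>0\<close> to \<open>x\<close>.\<close>

definition qint :: "(real \<Rightarrow> real) \<Rightarrow> real \<Rightarrow> real" where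
  "qint g x = (\<Sum>k. x * q ^ k * g (x * q ^ k))"

lemma qint_terms_bound:
  assumes "\<And>k. \<bar>g (x * q ^ k)\<bar> \<le> D * \<bar>x * q ^ k\<bar> ^ n"
  shows "summable (\<lambda>k. norm (x * q ^ k * g (x * q ^ k)))"
    and "\<bar>qint g x\<bar> \<le> D * \<bar>x\<bar> ^ Suc n / (1 - q ^ Suc n)"
proof -
  have qn: "0 < q ^ Suc n" "q ^ Suc n < 1"
    using q_pos q_less_1 by (simp_all add: power_Suc_less_one del: power_Suc)
  have s: "(\<lambda>k. D * \<bar>x\<bar> ^ Suc n * (q ^ Suc n) ^ k) sums (D * \<bar>x\<bar> ^ Suc n * (1 / (1 - q ^ Suc n)))"
    using qn by (intro sums_mult geometric_sums) (simp del: power_Suc)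
  have le: "norm (x * q ^ k * g (x * q ^ k)) \<le> D * \<bar>x\<bar> ^ Suc n * (q ^ Suc n) ^ k" for k
  proof -
    have "norm (x * q ^ k * g (x * q ^ k)) \<le> \<bar>x\<bar> * q ^ k * (D * \<bar>x * q ^ k\<bar> ^ n)"
      using mult_left_mono[OF assms[of k], of "\<bar>x\<bar> * q ^ k"] q_pos by (simp add: abs_mult)
    also have "\<dots> = D * \<bar>x\<bar> ^ Suc n * (q ^ Suc n) ^ k"
      using q_pos by (simp add: abs_mult power_mult_distrib mult_ac flip: power_mult)
    finally show ?thesis .
  qed
  show sm: "summable (\<lambda>k. norm (x * q ^ k * g (x * q ^ k)))"
    by (rule summable_comparison_test'[OF sums_summable[OF s]]) (use le in simp)
  have "\<bar>qint g x\<bar> \<le> (\<Sum>k. norm (x * q ^ k * g (x * q ^ k)))"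
    unfolding qint_def using summable_norm[OF sm] by simp
  also have "\<dots> \<le> (\<Sum>k. D * \<bar>x\<bar> ^ Suc n * (q ^ Suc n) ^ k)"
    by (intro suminf_le sm sums_summable[OF s] le)
  also have "\<dots> = D * \<bar>x\<bar> ^ Suc n / (1 - q ^ Suc n)" using s by (simp only: sums_iff) simp
  finally show "\<bar>qint g x\<bar> \<le> D * \<bar>x\<bar> ^ Suc n / (1 - q ^ Suc n)" .
qed

lemma abs_orbit_le: "\<bar>x * q ^ k\<bar> \<le> \<bar>x\<bar>"
  using q_pos q_less_1 by (simp add: abs_mult mult_left_le power_le_one)

lemma qint_summable:
  assumes "loc_bdd g" shows "summable (\<lambda>k. norm (x * q ^ k * g (x * q ^ k)))"
proof -
  obtain C where "0 \<le> C" and C: "\<And>y. \<bar>y\<bar> \<le> \<bar>x\<bar> \<Longrightarrow> \<bar>g y\<bar> \<le> C" using loc_bddD[OF assms] by blast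
  hence "\<bar>g (x * q ^ k)\<bar> \<le> C * \<bar>x * q ^ k\<bar> ^ 0" for k using abs_orbit_le[of x k] by simp
  thus ?thesis by (rule qint_terms_bound(1))
qed

lemma loc_bdd_qint:
  assumes "loc_bdd g" shows "loc_bdd (qint g)"
  unfolding loc_bdd_def
proof
  fix R
  obtain C where "0 \<le> C" and C: "\<And>y. \<bar>y\<bar> \<le> R \<Longrightarrow> \<bar>g y\<bar> \<le> C" using loc_bddD[OF assms] by blast
  have "\<bar>qint g x\<bar> \<le> R * C / (1 - q)" if x: "\<bar>x\<bar> \<le> R" for x
  proof -
    have "\<bar>g (x * q ^ k)\<bar> \<le> C" for k using abs_orbit_le[of x k] x by (intro C) linarith
    hence "\<bar>qint g x\<bar> \<le> \<bar>x\<bar> * C / (1 - q)" using qint_terms_bound(2)[of g x C 0] by (simp add: mult.commute)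
    also have "\<dots> \<le> R * C / (1 - q)"
      using x \<open>0 \<le> C\<close> q_less_1 by (intro divide_right_mono mult_right_mono) auto
    finally show ?thesis .
  qed
  thus "\<exists>C. \<forall>x. \<bar>x\<bar> \<le> R \<longrightarrow> \<bar>qint g x\<bar> \<le> C" by blast
qed

lemma qint_power: "qint (\<lambda>x. x ^ n) x = x ^ Suc n / (1 - q ^ Suc n)"
proof -
  have "q ^ Suc n < 1" using q_pos q_less_1 by (simp add: power_Suc_less_one del: power_Suc)
  hence "(\<lambda>k. x ^ Suc n * (q ^ Suc n) ^ k) sums (x ^ Suc n * (1 / (1 - q ^ Suc n)))"
    using q_pos by (intro sums_mult geometric_sums) (simp del: power_Suc)
  moreover have "x ^ Suc n * (q ^ Suc n) ^ k = x * q ^ k * (x * q ^ k) ^ n" for k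
    by (simp add: power_mult_distrib mult_ac flip: power_mult power_add)
  ultimately show ?thesis unfolding qint_def by (simp only: sums_iff) simp
qed

lemma has_sum_orbit:
  assumes "loc_bdd g" "x \<noteq> 0"
  shows "((\<lambda>y. y * g y) has_sum qint g x) (orbit x)"
proof -
  have inj: "inj (\<lambda>k::nat. x * q ^ k)"
    using assms(2) q_pos q_less_1 by (auto intro!: injI dest: power_inject_exp'[THEN iffD1, rotated -1])
  have "((\<lambda>k. x * q ^ k * g (x * q ^ k)) has_sum qint g x) UNIV"
    unfolding qint_def
    by (intro norm_summable_imp_has_sum summable_sums qint_summable[OF assms(1)]
        summable_norm_cancel[OF qint_summable[OF assms(1)]])
  thus ?thesis unfolding orbit_def has_sum_reindex[OF inj] by (simp add: o_def)
qed

text \<open>On each of the three kinds of intervals, the endpoints are included or excluded in such a way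
  that the fundamental theorem of calculus takes this form.\<close>

lemma has_sum_lat_interval:
  assumes "loc_bdd g" "a \<in> L" "b \<in> L" "a < b"
  shows "((\<lambda>y. \<bar>y\<bar> * g y) has_sum (qint g b - qint g a)) (ivl a b)"
proof -
  note nz = L_nonzero[OF assms(2)] L_nonzero[OF assms(3)]
  note oa = has_sum_orbit[OF assms(1) nz(1)] and ob = has_sum_orbit[OF assms(1) nz(2)]
  note [simp] = orbit_eq[OF assms(2)] orbit_eq[OF assms(3)]
 have sgn: "0 < y \<or> y < 0" if "y \<in> L" for y using L_nonzero[OF that] by linarith
  consider "b < 0" | "a < 0" "0 < b" | "0 < a" using nz by linarith
  thus ?thesis
  proof cases
    case 1
    have I: "ivl a b = orbit a - orbit b" and sub: "orbit b \<subseteq> orbit a"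
      using 1 assms(4) by (auto simp: lat_interval_def zero_less_mult_iff)
    have "((\<lambda>y. y * g y) has_sum (qint g a - qint g b)) (orbit a - orbit b)"
      by (rule has_sum_Diff[OF oa ob sub])
    hence "((\<lambda>y. - (y * g y)) has_sum (qint g b - qint g a)) (orbit a - orbit b)"
      by (simp add: has_sum_uminus)
    moreover have "- (y * g y) = \<bar>y\<bar> * g y" if "y \<in> orbit a - orbit b" for y
      using that 1 assms(4) by (auto simp: zero_less_mult_iff)
    ultimately show ?thesis unfolding I by (rule has_sum_cong[THEN iffD1, rotated])
  next
    case 2
    have I: "ivl a b = orbit a \<union> orbit b" and disj: "orbit a \<inter> orbit b = {}"
      using 2 by (auto simp: lat_interval_def zero_less_mult_iff dest: sgn)
    have "((\<lambda>y. - (y * g y)) has_sum (- qint g a)) (orbit a)" using oa by (simp add: has_sum_uminus)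
    moreover have "- (y * g y) = \<bar>y\<bar> * g y" if "y \<in> orbit a" for y
      using that 2 by (auto simp: zero_less_mult_iff)
    ultimately have a: "((\<lambda>y. \<bar>y\<bar> * g y) has_sum (- qint g a)) (orbit a)"
      by (rule has_sum_cong[THEN iffD1, rotated])
    have "y * g y = \<bar>y\<bar> * g y" if "y \<in> orbit b" for y
      using that 2 by (auto simp: zero_less_mult_iff)
    hence b: "((\<lambda>y. \<bar>y\<bar> * g y) has_sum (qint g b)) (orbit b)"
      using ob by (rule has_sum_cong[THEN iffD1])
    show ?thesis unfolding I using has_sum_Un_disjoint[OF a b disj] by simp
  next
    case 3
    have I: "ivl a b = orbit b - orbit a" and sub: "orbit a \<subseteq> orbit b"
      using 3 assms(4) by (auto simp: lat_interval_def zero_less_mult_iff)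
    have "y * g y = \<bar>y\<bar> * g y" if "y \<in> orbit b - orbit a" for y
      using that 3 assms(4) by (auto simp: zero_less_mult_iff)
    moreover have "((\<lambda>y. y * g y) has_sum (qint g b - qint g a)) (orbit b - orbit a)"
      by (rule has_sum_Diff[OF ob oa sub])
    ultimately show ?thesis unfolding I by (rule has_sum_cong[THEN iffD1])
  qed
qed

end

section \<open>Enumerations of finite configurations\<close>

lemma elt_props:
  assumes "finite X" "card X = N"
  shows elt_image: "elt X ` {..<N} = X" and elt_less: "\<And>i j. i < j \<Longrightarrow> j < N \<Longrightarrow> elt X i < elt X j"
    and elt_inj: "inj_on (elt X) {..<N}" and elt_mem: "\<And>i. i < N \<Longrightarrow> elt X i \<in> X"
proof -
  let ?xs = "sorted_list_of_set X"
  have xs: "set ?xs = X" "length ?xs = N" "sorted_wrt (<) ?xs"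
    using assms by auto
  show "elt X ` {..<N} = X" using xs nth_image[of N ?xs] by (auto simp: elt_def lessThan_atLeast0)
  show l: "elt X i < elt X j" if "i < j" "j < N" for i j
    using xs that by (auto simp: elt_def sorted_wrt_iff_nth_less)
  show "inj_on (elt X) {..<N}"
  proof (rule inj_onI)
    fix i j assume "i \<in> {..<N}" "j \<in> {..<N}" "elt X i = elt X j"
    thus "i = j" using l[of i j] l[of j i] by (cases i j rule: linorder_cases) auto
  qed
  show "elt X i \<in> X" if "i < N" for i using xs that nth_mem[of i ?xs] by (simp add: elt_def)
qed

lemma elt_of_image:
  assumes "\<And>i j. i < j \<Longrightarrow> j < N \<Longrightarrow> y i < (y j :: real)" "i < N"
  shows "elt (y ` {..<N}) i = y i"
proof -
  have "sorted_wrt (<) (map y [0..<N])"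
    using assms(1) by (auto simp: sorted_wrt_iff_nth_less)
  moreover have "set (map y [0..<N]) = y ` {..<N}" by (auto simp: lessThan_atLeast0)
  ultimately have "sorted_list_of_set (y ` {..<N}) = map y [0..<N]"
    by (metis sorted_list_of_set.idem_if_sorted_distinct strict_sorted_iff)
  thus ?thesis using assms(2) by (simp add: elt_def)
qed

lemma has_sum_finite_sum:
  fixes f :: "'i \<Rightarrow> 'b \<Rightarrow> real"
  assumes "\<And>i. i \<in> I \<Longrightarrow> (f i has_sum s i) A" "finite I"
  shows "((\<lambda>x. \<Sum>i\<in>I. f i x) has_sum (\<Sum>i\<in>I. s i)) A"
  using assms(2,1) by (induction I) (auto intro: has_sum_add)

lemma abs_summable_real_iff:
  "Infinite_Set_Sum.abs_summable_on f A \<longleftrightarrow> f summable_on A" for f :: "'a \<Rightarrow> real"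
  by (metis abs_summable_equivalent summable_on_iff_abs_summable_on_real)

lemma has_sum_prod_PiE:
  fixes f :: "'a \<Rightarrow> 'b \<Rightarrow> real"
  assumes "finite A" "\<And>x. x \<in> A \<Longrightarrow> countable (B x)" "\<And>x. x \<in> A \<Longrightarrow> (f x has_sum s x) (B x)"
  shows "((\<lambda>g. \<Prod>x\<in>A. f x (g x)) has_sum (\<Prod>x\<in>A. s x)) (PiE A B)"
proof -
  have sm: "f x summable_on B x" if "x \<in> A" for x using assms(3)[OF that] by (auto simp: summable_on_def)
  have abs: "Infinite_Set_Sum.abs_summable_on (f x) (B x)" if "x \<in> A" for x
    using sm[OF that] by (simp only: abs_summable_real_iff)
  have "Infinite_Set_Sum.abs_summable_on (\<lambda>g. \<Prod>x\<in>A. f x (g x)) (PiE A B)"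
    by (rule abs_summable_on_prod_PiE) (use assms(1,2) abs in auto)
  hence "(\<lambda>g. \<Prod>x\<in>A. f x (g x)) summable_on (PiE A B)"
    by (simp only: abs_summable_real_iff)
  moreover have "infsum (\<lambda>g. \<Prod>x\<in>A. f x (g x)) (PiE A B) = (\<Prod>x\<in>A. infsum (f x) (B x))"
    by (rule infsum_prod_PiE) (use assms(1) sm calculation in auto)
  moreover have "(\<Prod>x\<in>A. infsum (f x) (B x)) = (\<Prod>x\<in>A. s x)"
    using assms(3) by (intro prod.cong) (auto dest: infsumI)
  ultimately show ?thesis by (metis has_sum_infsum)
qed

section \<open>The action of a link on alternants\<close>

context qlattice begin

abbreviation "cfg N \<equiv> configs q zm zp N"

lemma cfgD:
  assumes "X \<in> cfg N" shows "X \<subseteq> L" "finite X" "card X = N"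
  using assms by (auto simp: configs_def)

lemma lat_interval_strict:
  assumes "y \<in> ivl a b" "y' \<in> ivl b' c" "b \<le> b'" "b \<in> L" "b' \<in> L" "a < b" "b' < c"
  shows "y < y'"
proof -
  have "y \<le> b" "b' \<le> y'" "y < b \<or> 0 \<le> b" "b' < y' \<or> b' \<le> 0"
    using assms by (auto simp: lat_interval_def split: if_splits)
  thus ?thesis using assms(3) L_nonzero[OF assms(4)] L_nonzero[OF assms(5)] by linarith
qed

text \<open>The endpoints of the intervals are excluded in such a way that consecutive intervals are disjoint.
  Independent choices of one point from each interval therefore give an increasing enumeration.\<close>

lemma bij_betw_interlacing:
  assumes "X \<in> cfg (Suc N)"
  shows "bij_betw (\<lambda>y. y ` {..<N})
    (PiE {..<N} (\<lambda>i. ivl (elt X i) (elt X (Suc i)))) {Y. interlaces q zm zp N Y X}"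
    (is "bij_betw ?f ?P ?I")
    and "y \<in> PiE {..<N} (\<lambda>i. ivl (elt X i) (elt X (Suc i))) \<Longrightarrow> j < N \<Longrightarrow> elt (y ` {..<N}) j = y j"
proof -
  note X = cfgD[OF assms] note e = elt_props[OF X(2,3)]
  have eL: "elt X i \<in> L" if "i < Suc N" for i using e(4)[OF that] X(1) by blast
  have mono: "y i < y j" if y: "y \<in> ?P" and ij: "i < j" "j < N" for y i j
  proof (rule lat_interval_strict)
    show "y i \<in> ivl (elt X i) (elt X (Suc i))" "y j \<in> ivl (elt X j) (elt X (Suc j))"
      using PiE_mem[OF y, of i] PiE_mem[OF y, of j] ij by simp_all
    show "elt X (Suc i) \<le> elt X j" using e(2)[of "Suc i" j] ij by (cases "Suc i = j") auto
  qed (use ij e(2) eL in auto)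
  show elt: "elt (?f y) j = y j" if "y \<in> ?P" "j < N" for y j
    by (rule elt_of_image) (use that mono in auto)
  show "bij_betw ?f ?P ?I"
  proof (rule bij_betw_byWitness[where f' = "\<lambda>Y. \<lambda>i\<in>{..<N}. elt Y i"])
    show "\<forall>y\<in>?P. (\<lambda>i\<in>{..<N}. elt (?f y) i) = y"
      by (auto simp: elt fun_eq_iff restrict_def PiE_def extensional_def)
    show "\<forall>Y\<in>?I. ?f (\<lambda>i\<in>{..<N}. elt Y i) = Y"
    proof
      fix Y assume "Y \<in> ?I"
      hence "elt Y ` {..<N} = Y" by (intro elt_image) (auto simp: interlaces_def dest: cfgD)
      thus "?f (\<lambda>i\<in>{..<N}. elt Y i) = Y" by simp
    qed
    show "?f ` ?P \<subseteq> ?I"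
    proof (intro image_subsetI CollectI)
      fix y assume y: "y \<in> ?P"
      have "inj_on y {..<N}"
      proof (rule inj_onI)
        fix i j assume "i \<in> {..<N}" "j \<in> {..<N}" "y i = y j"
        thus "i = j" using mono[OF y, of i j] mono[OF y, of j i] by (cases i j rule: linorder_cases) auto
      qed
      hence "?f y \<in> cfg N" using y by (auto simp: configs_def card_image PiE_def Pi_def lat_interval_def)
      thus "interlaces q zm zp N (?f y) X"
        using assms y elt[OF y] by (auto simp: interlaces_def)
    qed
    show "(\<lambda>Y. \<lambda>i\<in>{..<N}. elt Y i) ` ?I \<subseteq> ?P"
      by (intro image_subsetI restrict_PiE_iff[THEN iffD2]) (auto simp: interlaces_def)
  qed
qed

lemma vdm_link: "(\<Prod>j<N. \<Prod>i<j. elt Y j - elt Y i) = (-1) ^ (N * (N - 1) div 2) * vdm N (elt Y)"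
proof (induction N)
  case (Suc N)
  have "(\<Prod>i<N. elt Y N - elt Y i) = (\<Prod>i<N. - (elt Y i - elt Y N))" by simp
  also have "\<dots> = (-1) ^ N * (\<Prod>i<N. elt Y i - elt Y N)" by (subst prod_uminus) simp
  finally have "(\<Prod>j<Suc N. \<Prod>i<j. elt Y j - elt Y i) =
      (-1) ^ (N * (N - 1) div 2 + N) * vdm (Suc N) (elt Y)"
    using Suc.IH by (simp add: vdm_def power_add)
  moreover have "Suc N * (Suc N - 1) div 2 = N * (N - 1) div 2 + N"
    by (cases N) (simp_all add: field_simps)
  ultimately show ?case by simp
qed (simp add: vdm_def)

lemma link_eq:
  assumes "interlaces q zm zp N Y X"
  shows "lk N X Y =
    (-1) ^ N * (\<Prod>i=1..N. 1 - q ^ i) * (\<Prod>i<N. \<bar>elt Y i\<bar>) * (vdm N (elt Y) / vdm (Suc N) (elt X))"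
proof -
  have e: "Suc N * (Suc N - 1) div 2 = N * (N - 1) div 2 + N"
    by (cases N) (simp_all add: field_simps)
  have "(-1) ^ k * a / ((-1) ^ (k + N) * b) = (-1) ^ N * (a / b)" for a b :: real and k
    by (cases "even k"; cases "even N") auto
  thus ?thesis using assms unfolding link_def vdm_link e by (simp add: mult_ac)
qed

text \<open>The Vandermonde factor of the link cancels the denominator, and the sum over the product of
  intervals of a determinant is the determinant of the sums over the intervals. Those are
  differences of values of q-integrals at consecutive points, so that one more row of ones restores a
  determinant of full size.\<close>

theorem has_sum_link_alternant:
  assumes X: "X \<in> cfg (Suc N)" and f: "\<And>i. i < N \<Longrightarrow> loc_bdd (f i)"
  shows "((\<lambda>Y. lk N X Y * (fdet N (\<lambda>i j. f i (elt Y j)) / vdm N (elt Y))) has_sum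
    ((\<Prod>i=1..N. 1 - q ^ i) * fdet (Suc N) (\<lambda>i j. if i < N then qint (f i) (elt X j) else 1) / vdm (Suc N) (elt X)))
    (cfg N)"
proof -
  note Xp = cfgD[OF X] note e = elt_props[OF Xp(2,3)]
  let ?J = "\<lambda>i. ivl (elt X i) (elt X (Suc i))"
  let ?P = "PiE {..<N} ?J"
  let ?c = "(-1) ^ N * (\<Prod>i=1..N. 1 - q ^ i) / vdm (Suc N) (elt X)"
  let ?S = "\<lambda>i j. qint (f i) (elt X (Suc j)) - qint (f i) (elt X j)"
  have "((\<lambda>y. signof p * (\<Prod>j<N. \<bar>y j\<bar> * f (p j) (y j))) has_sum (signof p * (\<Prod>j<N. ?S (p j) j))) ?P"
    if p: "p permutes {..<N}" for p
  proof (intro has_sum_cmult_right has_sum_prod_PiE)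
    fix j assume j: "j \<in> {..<N}"
    show "countable (?J j)" using countable_L by (auto simp: lat_interval_def)
    have "p j < N" using permutes_in_image[OF p, of j] j by simp
    thus "((\<lambda>y. \<bar>y\<bar> * f (p j) y) has_sum ?S (p j) j) (?J j)"
      using j e Xp(1) by (intro has_sum_lat_interval f) auto
  qed simp
  hence "((\<lambda>y. \<Sum>p | p permutes {..<N}. signof p * (\<Prod>j<N. \<bar>y j\<bar> * f (p j) (y j))) has_sum
      (\<Sum>p | p permutes {..<N}. signof p * (\<Prod>j<N. ?S (p j) j))) ?P"
    by (intro has_sum_finite_sum finite_permutations) simp_all
  hence "((\<lambda>y. ?c * fdet N (\<lambda>i j. \<bar>y j\<bar> * f i (y j))) has_sum (?c * fdet N ?S)) ?P"
    unfolding fdet_col by (intro has_sum_cmult_right) (simp add: prod.distrib)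
  also have "(\<lambda>y. ?c * fdet N (\<lambda>i j. \<bar>y j\<bar> * f i (y j))) = (\<lambda>y. ?c * ((\<Prod>j<N. \<bar>y j\<bar>) * fdet N (\<lambda>i j. f i (y j))))"
    by (simp only: fdet_scale_cols)
  finally have 1: "((\<lambda>y. ?c * ((\<Prod>j<N. \<bar>y j\<bar>) * fdet N (\<lambda>i j. f i (y j)))) has_sum (?c * fdet N ?S)) ?P" .
  let ?g = "\<lambda>Y. lk N X Y * (fdet N (\<lambda>i j. f i (elt Y j)) / vdm N (elt Y))"
  have "((\<lambda>y. ?g (y ` {..<N})) has_sum (?c * fdet N ?S)) ?P"
  proof (rule has_sum_cong[THEN iffD1, OF _ 1])
    fix y assume y: "y \<in> ?P"
    have int: "interlaces q zm zp N (y ` {..<N}) X"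
      using bij_betw_interlacing(1)[OF X] y by (auto simp: bij_betw_def)
    hence inj: "inj_on (elt (y ` {..<N})) {..<N}"
      by (auto simp: interlaces_def intro!: elt_inj dest: cfgD)
    have eq: "elt (y ` {..<N}) j = y j" if "j < N" for j
      using bij_betw_interlacing(2)[OF X y that] .
    have "fdet N (\<lambda>i j. f i (elt (y ` {..<N}) j)) = fdet N (\<lambda>i j. f i (y j))"
      by (rule fdet_cong) (simp add: eq)
    moreover have "(\<Prod>i<N. \<bar>elt (y ` {..<N}) i\<bar>) = (\<Prod>i<N. \<bar>y i\<bar>)"
      by (rule prod.cong) (auto simp: eq)
    ultimately show "?c * ((\<Prod>j<N. \<bar>y j\<bar>) * fdet N (\<lambda>i j. f i (y j))) = ?g (y ` {..<N})"
      unfolding link_eq[OF int] using vdm_nonzero[OF inj] by simp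
  qed
  hence "(?g has_sum (?c * fdet N ?S)) {Y. interlaces q zm zp N Y X}"
    by (rule has_sum_reindex_bij_betw[OF bij_betw_interlacing(1)[OF X], THEN iffD1])
  hence "(?g has_sum (?c * fdet N ?S)) (cfg N)"
    by (rule has_sum_cong_neutral[THEN iffD1, rotated -1]) (auto simp: link_def interlaces_def)
  also have "?c * fdet N ?S = (\<Prod>i=1..N. 1 - q ^ i) * ((-1) ^ N * fdet N ?S) / vdm (Suc N) (elt X)"
    by simp
  finally show ?thesis unfolding fdet_column_differences .
qed

end


section \<open>Coherent families of functions\<close>

context qlattice begin

lemma link_nonneg: "0 \<le> lk N X Y"
proof (cases "interlaces q zm zp N Y X")
  case True
  hence X: "finite X" "card X = Suc N" and Y: "finite Y" "card Y = N"
    by (auto simp: interlaces_def dest: cfgD)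
  have "0 \<le> (\<Prod>i=1..N. 1 - q ^ i)"
    using q_pos q_less_1 by (intro prod_nonneg) (auto simp: power_le_one)
  moreover have "0 \<le> (\<Prod>j<N. \<Prod>i<j. elt Y j - elt Y i)"
    using elt_less[OF Y] by (intro prod_nonneg ballI) (auto simp: less_imp_le)
  moreover have "0 \<le> (\<Prod>j<Suc N. \<Prod>i<j. elt X j - elt X i)"
    using elt_less[OF X] by (intro prod_nonneg ballI) (auto simp: less_imp_le)
  ultimately show ?thesis by (auto simp: link_def intro!: mult_nonneg_nonneg divide_nonneg_nonneg prod_nonneg)
qed (simp add: link_def)

lemma link_support:
  assumes "lk N X Y \<noteq> 0" "X \<subseteq> {a..b}"
  shows "Y \<in> cfg N" "Y \<subseteq> {a..b}"
proof -
  have i: "interlaces q zm zp N Y X" using assms(1) by (auto simp: link_def split: if_splits)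
  hence X: "finite X" "card X = Suc N" and Y: "finite Y" "card Y = N"
    by (auto simp: interlaces_def dest: cfgD)
  show "Y \<in> cfg N" using i by (simp add: interlaces_def)
  have "elt Y j \<in> {a..b}" if "j < N" for j
  proof -
    have "elt X j \<in> {a..b}" "elt X (Suc j) \<in> {a..b}"
      using elt_mem[OF X, of j] elt_mem[OF X, of "Suc j"] that assms(2) by (auto simp only: subset_iff)
    moreover have "elt Y j \<in> ivl (elt X j) (elt X (Suc j))"
      using i that by (simp add: interlaces_def)
    ultimately show ?thesis by (auto simp: lat_interval_def split: if_splits)
  qed
  hence "elt Y ` {..<N} \<subseteq> {a..b}" by blast
  thus "Y \<subseteq> {a..b}" unfolding elt_image[OF Y] .
qed

lemma qpow_prod_rev: "(\<Prod>i=1..N. 1 - q ^ i) = (\<Prod>i<N. 1 - q ^ (N - i))"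
  by (rule prod.reindex_bij_witness[of _ "\<lambda>i. N - i" "\<lambda>i. N - i"]) auto

lemma one_minus_qpow_pos: "0 < n \<Longrightarrow> 0 < 1 - q ^ n"
  using q_pos q_less_1 by (simp add: power_less_one_iff)

lemma fdet_scale_first_rows:
  "fdet (Suc N) (\<lambda>i j. if i < N then c i * F i j else 1) =
    (\<Prod>i<N. c i) * fdet (Suc N) (\<lambda>i j. if i < N then F i j else 1)"
proof -
  have "fdet (Suc N) (\<lambda>i j. if i < N then c i * F i j else 1) =
      fdet (Suc N) (\<lambda>i j. (if i < N then c i else 1) * (if i < N then F i j else 1))"
    by (rule fdet_cong) auto
  thus ?thesis unfolding fdet_scale_rows by simp
qed

lemma schur_poly_norm_zero:
  assumes "finite X" "card X = N" shows "schur_poly_norm q (\<lambda>_. 0) N X = 1"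
proof -
  have "schur_poly (\<lambda>_. 0) N u = 1" if "inj_on u {..<N}" for u :: "nat \<Rightarrow> real"
    using vdm_nonzero[OF that] by (simp add: schur_poly_fdet vandermonde_det)
  moreover have "inj_on (\<lambda>i::nat. q ^ i) {..<N}"
    using q_pos q_less_1 by (auto intro!: inj_onI dest: power_inject_exp'[THEN iffD1, rotated -1])
  ultimately show ?thesis using elt_inj[OF assms] by (simp add: schur_poly_norm_def)
qed

text \<open>The q-integral raises all exponents by one, so a link maps a Schur polynomial in \<open>N\<close>
  variables to a multiple of the Schur polynomial with the same index in \<open>N + 1\<close> variables; the
  normalization by the principal specialization absorbs the factor.\<close>

lemma has_sum_link_schur:
  assumes "\<nu> \<in> partitions_le K" "K \<le> N" "X \<in> cfg (Suc N)"
  shows "((\<lambda>Y. lk N X Y * schur_poly_norm q \<nu> N Y) has_sum schur_poly_norm q \<nu> (Suc N) X) (cfg N)"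
proof -
  let ?f = "\<lambda>i x. x ^ (\<nu> i + (N - Suc i)) :: real" let ?u = "elt X"
  let ?b = "\<lambda>i. 1 - q ^ (\<nu> i + (N - i))" and ?a = "\<lambda>i. 1 - q ^ (N - i)"
  have nu: "\<nu> N = 0" using assms by (auto simp: partitions_le_def)
  let ?s = "schur_poly \<nu> N (\<lambda>i. q ^ i)"
  have s: "?s \<noteq> 0" using schur_qpow_pos[OF q_pos q_less_1 assms(1), of N] by simp
  have "?a i \<noteq> 0" "?b i \<noteq> 0" if "i < N" for i
    using one_minus_qpow_pos[of "N - i"] one_minus_qpow_pos[of "\<nu> i + (N - i)"] that by auto
  hence ab: "(\<Prod>i<N. ?a i) \<noteq> 0" "(\<Prod>i<N. ?b i) \<noteq> 0" by (simp_all only: prod_zero_iff finite_lessThan) auto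
  have "fdet (Suc N) (\<lambda>i j. if i < N then qint (?f i) (?u j) else 1) =
      fdet (Suc N) (\<lambda>i j. if i < N then inverse (?b i) * ?u j ^ (\<nu> i + (N - i)) else 1)"
    by (rule fdet_cong) (auto simp: qint_power divide_inverse mult.commute Suc_diff_Suc simp flip: add_Suc_right power_Suc)
  also have "\<dots> = inverse (\<Prod>i<N. ?b i) * fdet (Suc N) (\<lambda>i j. if i < N then ?u j ^ (\<nu> i + (N - i)) else 1)"
    unfolding fdet_scale_first_rows by (simp add: prod_inversef[unfolded o_def])
  also have "fdet (Suc N) (\<lambda>i j. if i < N then ?u j ^ (\<nu> i + (N - i)) else 1) =
      fdet (Suc N) (\<lambda>i j. ?u j ^ (\<nu> i + (Suc N - Suc i)))"
    by (rule fdet_cong) (auto simp: nu less_Suc_eq)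
  finally have val: "(\<Prod>i=1..N. 1 - q ^ i) * fdet (Suc N) (\<lambda>i j. if i < N then qint (?f i) (?u j) else 1) / vdm (Suc N) ?u =
     (\<Prod>i<N. ?a i) / (\<Prod>i<N. ?b i) * schur_poly \<nu> (Suc N) ?u"
    unfolding qpow_prod_rev schur_poly_fdet by (simp add: divide_inverse mult_ac)
  have "loc_bdd (?f i)" for i by (rule loc_bdd_power)
  from has_sum_link_alternant[OF assms(3), of ?f, OF this, unfolded val]
  have "((\<lambda>Y. lk N X Y * schur_poly \<nu> N (elt Y)) has_sum
     ((\<Prod>i<N. ?a i) / (\<Prod>i<N. ?b i) * schur_poly \<nu> (Suc N) ?u)) (cfg N)"
    unfolding schur_poly_fdet .
  hence "((\<lambda>Y. lk N X Y * schur_poly \<nu> N (elt Y) * inverse ?s) has_sum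
     ((\<Prod>i<N. ?a i) / (\<Prod>i<N. ?b i) * schur_poly \<nu> (Suc N) ?u * inverse ?s)) (cfg N)"
    by (rule has_sum_cmult_left)
  also have "(\<Prod>i<N. ?a i) / (\<Prod>i<N. ?b i) * schur_poly \<nu> (Suc N) ?u * inverse ?s = schur_poly_norm q \<nu> (Suc N) X"
    unfolding schur_poly_norm_def schur_qpow_step[where \<nu> = \<nu>, OF q_pos q_less_1 nu] prod_dividef
    using s ab by (simp add: field_simps)
  finally show ?thesis by (simp add: schur_poly_norm_def divide_inverse mult.assoc)
qed

lemma has_sum_link_one:
  assumes "X \<in> cfg (Suc N)" shows "(lk N X has_sum 1) (cfg N)"
proof -
  have "(\<lambda>_. 0) \<in> partitions_le 0" by (simp add: partitions_le_def)
  from has_sum_link_schur[OF this _ assms]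
  have "((\<lambda>Y. lk N X Y * schur_poly_norm q (\<lambda>_. 0) N Y) has_sum 1) (cfg N)"
    using cfgD(2,3)[OF assms] by (simp add: schur_poly_norm_zero)
  moreover have "lk N X Y * schur_poly_norm q (\<lambda>_. 0) N Y = lk N X Y" if "Y \<in> cfg N" for Y
    using schur_poly_norm_zero[OF cfgD(2,3)[OF that]] by simp
  ultimately show ?thesis by (rule has_sum_cong[THEN iffD1, rotated])
qed

text \<open>By Cramer's rule an interpolation coefficient is an alternant with one free row. The q-integrals
  of the monomial rows contribute all factors \<open>1 - q\<^sup>k\<close> of the link except the one of row \<open>i\<close>.\<close>

lemma has_sum_link_interp_coeff:
  assumes X: "X \<in> cfg (Suc N)" and "i < N" "loc_bdd g"
  shows "((\<lambda>Y. lk N X Y * interp_coeff Y g i) has_sum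
    interp_coeff X (\<lambda>x. (1 - q ^ (N - i)) * qint g x) i) (cfg N)"
proof -
  let ?f = "\<lambda>k x. if k = i then g x else x ^ (N - Suc k)" let ?u = "elt X"
  let ?a = "\<lambda>k. 1 - q ^ (N - k)" let ?G = "\<lambda>x. ?a i * qint g x"
  note Xp = cfgD[OF X]
  have inj: "inj_on ?u {..<Suc N}" and im: "?u ` {..<Suc N} = X" using elt_inj elt_image Xp by blast+
  have a: "?a k \<noteq> 0" if "k < N" for k using one_minus_qpow_pos[of "N - k"] that by simp
  hence a': "(\<Prod>k<N. ?a k) \<noteq> 0" by (auto simp: prod_zero_iff)
  have "fdet (Suc N) (\<lambda>k j. if k < N then qint (?f k) (?u j) else 1) =
      fdet (Suc N) (\<lambda>k j. if k < N then inverse (?a k) * (if k = i then ?G (?u j) else ?u j ^ (N - k)) else 1)"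
  proof (rule fdet_cong)
    fix k j assume "k < Suc N" "j < Suc N"
    thus "(if k < N then qint (?f k) (?u j) else 1) =
      (if k < N then inverse (?a k) * (if k = i then ?G (?u j) else ?u j ^ (N - k)) else 1)"
      using a[of k] by (auto simp: qint_power divide_inverse mult.commute Suc_diff_Suc simp flip: power_Suc)
  qed
  also have "\<dots> = inverse (\<Prod>k<N. ?a k) * fdet (Suc N) (\<lambda>k j. if k < N then if k = i then ?G (?u j) else ?u j ^ (N - k) else 1)"
    unfolding fdet_scale_first_rows by (simp add: prod_inversef[unfolded o_def])
  also have "fdet (Suc N) (\<lambda>k j. if k < N then if k = i then ?G (?u j) else ?u j ^ (N - k) else 1) =
      fdet (Suc N) (\<lambda>k j. if k = i then ?G (?u j) else ?u j ^ (Suc N - Suc k))"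
    by (rule fdet_cong) (use \<open>i < N\<close> in \<open>auto simp: less_Suc_eq\<close>)
  also have "\<dots> = interp_coeff X ?G i * vdm (Suc N) ?u"
    using fdet_vandermonde_replace_row[OF inj, of i ?G] assms(2) by (simp only: im)
  finally have "(\<Prod>i=1..N. 1 - q ^ i) * fdet (Suc N) (\<lambda>k j. if k < N then qint (?f k) (?u j) else 1) / vdm (Suc N) ?u =
     interp_coeff X ?G i"
    unfolding qpow_prod_rev using a' vdm_nonzero[OF inj] by simp
  moreover have "loc_bdd (?f k)" for k using assms(3) loc_bdd_power by (cases "k = i") auto
  ultimately have h: "((\<lambda>Y. lk N X Y * (fdet N (\<lambda>k j. ?f k (elt Y j)) / vdm N (elt Y))) has_sum
      interp_coeff X ?G i) (cfg N)"
    using has_sum_link_alternant[OF X, of ?f] by simp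
  show ?thesis
  proof (rule has_sum_cong[THEN iffD1, OF _ h])
    fix Y assume "Y \<in> cfg N"
    note Yp = cfgD(2,3)[OF this]
    show "lk N X Y * (fdet N (\<lambda>k j. ?f k (elt Y j)) / vdm N (elt Y)) =
       lk N X Y * interp_coeff Y g i"
      using fdet_vandermonde_replace_row[OF elt_inj[OF Yp] assms(2), of g] vdm_nonzero[OF elt_inj[OF Yp]]
      unfolding elt_image[OF Yp] by simp
  qed
qed

section \<open>Products of links\<close>

abbreviation "lp \<equiv> link_prod q zm zp"

lemma lp_nonneg: "0 \<le> lp K d X Z"
  by (induction d arbitrary: X) (auto intro!: infsum_nonneg mult_nonneg_nonneg link_nonneg)

lemma lp_support:
  assumes "lp K d X Z \<noteq> 0" "X \<subseteq> {a..b}"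
  shows "Z \<subseteq> {a..b}"
  using assms
proof (induction d arbitrary: X)
  case 0
  thus ?case by (auto split: if_splits)
next
  case (Suc d)
  obtain Y where "lk (K + d) X Y * lp K d Y Z \<noteq> 0"
    using Suc.prems(1) infsum_0[of "cfg (K + d)" "\<lambda>Y. lk (K + d) X Y * lp K d Y Z"] by auto
  thus ?case using Suc.IH[of Y] link_support(2)[of "K + d" X Y a b] Suc.prems(2) by auto
qed

text \<open>The induction interchanges two infinite sums. The total mass of a row is carried along because,
  together with the bound on the lowest member of the family, it gives absolute convergence.\<close>

lemma has_sum_lp_aux:
  assumes \<phi>: "\<And>N X. K \<le> N \<Longrightarrow> X \<in> cfg (Suc N) \<Longrightarrow> ((\<lambda>Y. lk N X Y * \<phi> N Y) has_sum \<phi> (Suc N) X) (cfg N)"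
    and bdd: "\<And>Z. Z \<in> cfg K \<Longrightarrow> Z \<subseteq> {a..b} \<Longrightarrow> \<bar>\<phi> K Z\<bar> \<le> B"
    and X: "X \<in> cfg (K + d)" "X \<subseteq> {a..b}"
  shows "(lp K d X has_sum 1) (cfg K) \<and> ((\<lambda>Z. lp K d X Z * \<phi> K Z) has_sum \<phi> (K + d) X) (cfg K)"
  using X
proof (induction d arbitrary: X)
  case 0
  have "((\<lambda>Z. of_bool (X = Z)) has_sum (1::real)) {X}" "((\<lambda>Z. lp K 0 X Z * \<phi> K Z) has_sum \<phi> (K + 0) X) {X}"
    using has_sum_finite[of "{X}" "\<lambda>Z. of_bool (X = Z) :: real"] has_sum_finite[of "{X}" "\<lambda>Z. lp K 0 X Z * \<phi> K Z"] by simp_all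
  moreover have sing: "(f has_sum s) {X} \<Longrightarrow> (f has_sum s) (cfg K)" if "\<And>Z. Z \<noteq> X \<Longrightarrow> f Z = 0" for f :: "real set \<Rightarrow> real" and s
    by (rule has_sum_cong_neutral[THEN iffD1, rotated -1]) (use 0 that in auto)
  ultimately have "((\<lambda>Z. of_bool (X = Z)) has_sum (1::real)) (cfg K)"
    "((\<lambda>Z. lp K 0 X Z * \<phi> K Z) has_sum \<phi> (K + 0) X) (cfg K)"
    by simp_all
  moreover have "lp K 0 X = (\<lambda>Z. of_bool (X = Z))" by (rule ext) simp
  ultimately show ?case by simp
next
  case (Suc d)
  have X': "X \<in> cfg (Suc (K + d))" using Suc.prems by simp
  let ?l = "lk (K + d) X"
  have IH: "?l Y * p = 0 \<or> (lp K d Y has_sum 1) (cfg K) \<and> ((\<lambda>Z. lp K d Y Z * \<phi> K Z) has_sum \<phi> (K + d) Y) (cfg K)" for Y p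
    using Suc.IH[of Y] link_support[of "K + d" X Y a b] Suc.prems(2) by auto
  have row1: "((\<lambda>Z. ?l Y * lp K d Y Z) has_sum ?l Y) (cfg K)" for Y
    using IH[of Y 1] has_sum_cmult_right[where f = "lp K d Y" and a = 1 and A = "cfg K" and c = "?l Y"] by auto
  have row: "((\<lambda>Z. ?l Y * lp K d Y Z * \<phi> K Z) has_sum (?l Y * \<phi> (K + d) Y)) (cfg K)" for Y
    using IH[of Y 1] has_sum_cmult_right[where f = "\<lambda>Z. lp K d Y Z * \<phi> K Z" and a = "\<phi> (K + d) Y" and A = "cfg K" and c = "?l Y"]
    by (auto simp: mult.assoc)
  let ?S = "cfg (K + d) \<times> cfg K"
  have l1: "(?l has_sum 1) (cfg (K + d))" by (rule has_sum_link_one[OF X'])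
  have s1: "(\<lambda>(Y, Z). ?l Y * lp K d Y Z) summable_on ?S"
  proof (rule summable_on_SigmaI)
    show "((\<lambda>Z. case (Y, Z) of (Y, Z) \<Rightarrow> ?l Y * lp K d Y Z) has_sum ?l Y) (cfg K)" for Y using row1 by simp
    show "?l summable_on cfg (K + d)" using l1 by (auto simp: summable_on_def)
  qed (auto intro: mult_nonneg_nonneg link_nonneg lp_nonneg)
  have s2: "(\<lambda>(Y, Z). ?l Y * lp K d Y Z * \<phi> K Z) summable_on ?S"
  proof -
    have "(\<lambda>p. norm (case p of (Y, Z) \<Rightarrow> ?l Y * lp K d Y Z * \<phi> K Z)) summable_on ?S"
    proof (rule Infinite_Sum.abs_summable_on_comparison_test')
      show "(\<lambda>p. B * (case p of (Y, Z) \<Rightarrow> ?l Y * lp K d Y Z)) summable_on ?S"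
        by (rule summable_on_cmult_right[OF s1])
      fix p assume "p \<in> ?S"
      then obtain Y Z where p: "p = (Y, Z)" "Z \<in> cfg K" by auto
      have "\<bar>\<phi> K Z\<bar> \<le> B \<or> ?l Y * lp K d Y Z = 0"
        using bdd[OF p(2)] lp_support[of K d Y Z a b] link_support(2)[of "K + d" X Y a b] Suc.prems(2) by auto
      moreover have "0 \<le> ?l Y * lp K d Y Z" by (intro mult_nonneg_nonneg link_nonneg lp_nonneg)
      ultimately show "norm (case p of (Y, Z) \<Rightarrow> ?l Y * lp K d Y Z * \<phi> K Z) \<le> B * (case p of (Y, Z) \<Rightarrow> ?l Y * lp K d Y Z)"
        using mult_left_mono[of "\<bar>\<phi> K Z\<bar>" B "?l Y * lp K d Y Z"]
        by (auto simp: p(1) abs_mult lp_nonneg link_nonneg mult.commute)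
    qed
    thus ?thesis by (rule abs_summable_summable)
  qed
  have col: "((\<lambda>Y. ?l Y * lp K d Y Z) has_sum lp K (Suc d) X Z) (cfg (K + d))" if "Z \<in> cfg K" for Z
  proof -
    have "(\<lambda>(Z, Y). ?l Y * lp K d Y Z) summable_on (cfg K \<times> cfg (K + d))"
      using s1 by (subst (asm) summable_on_swap) simp
    hence "(\<lambda>Y. ?l Y * lp K d Y Z) summable_on cfg (K + d)"
      by (rule summable_on_SigmaD1) (rule that)
    thus ?thesis by simp
  qed
  have "((\<lambda>(Y, Z). ?l Y * lp K d Y Z) has_sum 1) ?S"
    by (rule has_sum_SigmaI[OF _ l1 s1]) (simp add: row1)
  hence "((\<lambda>(Z, Y). ?l Y * lp K d Y Z) has_sum 1) (cfg K \<times> cfg (K + d))"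
    by (subst (asm) has_sum_swap) simp
  hence 1: "(lp K (Suc d) X has_sum 1) (cfg K)"
    by (rule has_sum_SigmaD) (use col in simp)
  have "((\<lambda>(Y, Z). ?l Y * lp K d Y Z * \<phi> K Z) has_sum \<phi> (Suc (K + d)) X) ?S"
    by (rule has_sum_SigmaI[OF _ \<phi>[OF _ X'] s2]) (simp_all add: row)
  hence "((\<lambda>(Z, Y). ?l Y * lp K d Y Z * \<phi> K Z) has_sum \<phi> (Suc (K + d)) X) (cfg K \<times> cfg (K + d))"
    by (subst (asm) has_sum_swap) simp
  hence "((\<lambda>Z. lp K (Suc d) X Z * \<phi> K Z) has_sum \<phi> (Suc (K + d)) X) (cfg K)"
    by (rule has_sum_SigmaD) (use has_sum_cmult_left[OF col] in simp)
  from 1 this show ?case unfolding add_Suc_right by (rule conjI)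
qed

lemmas has_sum_lp = has_sum_lp_aux[THEN conjunct2]

lemma has_sum_lp_one:
  assumes "X \<in> cfg (K + d)" shows "(lp K d X has_sum 1) (cfg K)"
proof -
  have X: "finite X" using cfgD(2)[OF assms] .
  have "X \<subseteq> {- (\<Sum>x\<in>X. \<bar>x\<bar>)..\<Sum>x\<in>X. \<bar>x\<bar>}"
    using member_le_sum[of _ X abs] X by (force simp: abs_le_iff)
  thus ?thesis using has_sum_lp_aux[where \<phi> = "\<lambda>_ _. 1" and B = 1, OF _ _ assms] has_sum_link_one by simp
qed

end


section \<open>Lower bounds for products of differences of lattice points\<close>

context qlattice begin

lemma sum_geometric_inj_le:
  assumes "finite B" "inj_on (k :: 'a \<Rightarrow> nat) B"
  shows "(\<Sum>m\<in>B. q ^ k m) \<le> 1 / (1 - q)"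
proof -
  have "(\<Sum>m\<in>B. q ^ k m) = (\<Sum>n\<in>k ` B. q ^ n)" using assms(2) by (simp add: sum.reindex)
  also have "\<dots> \<le> (\<Sum>n. q ^ n)"
    using q_pos q_less_1 assms(1) by (intro sum_le_suminf summable_geometric) auto
  also have "\<dots> = 1 / (1 - q)" using q_pos q_less_1 by (intro suminf_geometric) simp
  finally show ?thesis .
qed

lemma sum_abs_same_sign_le:
  assumes "finite A" "A \<subseteq> L" "m \<in> L" "\<And>x. x \<in> A \<Longrightarrow> 0 < m * x \<and> \<bar>x\<bar> \<le> \<bar>m\<bar>"
  shows "(\<Sum>x\<in>A. \<bar>x\<bar>) \<le> \<bar>m\<bar> / (1 - q)"
proof -
  have "\<forall>x\<in>A. \<exists>k::nat. x = m * q ^ k" using assms L_below[OF assms(3)] by (metis subsetD)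
  then obtain k :: "real \<Rightarrow> nat" where k: "\<And>x. x \<in> A \<Longrightarrow> x = m * q ^ k x" by metis
  hence "inj_on k A" by (metis inj_onI)
  have "(\<Sum>x\<in>A. \<bar>x\<bar>) = (\<Sum>x\<in>A. \<bar>m\<bar> * q ^ k x)"
  proof (rule sum.cong[OF refl])
    fix x assume "x \<in> A"
    hence "\<bar>x\<bar> = \<bar>m * q ^ k x\<bar>" using k by metis
    thus "\<bar>x\<bar> = \<bar>m\<bar> * q ^ k x" using q_pos by (simp add: abs_mult)
  qed
  also have "\<dots> \<le> \<bar>m\<bar> * (1 / (1 - q))"
    unfolding sum_distrib_left[symmetric]
    using sum_geometric_inj_le[OF assms(1) \<open>inj_on k A\<close>] by (intro mult_left_mono) auto
  finally show ?thesis by simp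
qed

lemma sum_abs_le:
  assumes "finite A" "A \<subseteq> L" "A \<subseteq> {-R..R}"
  shows "(\<Sum>x\<in>A. \<bar>x\<bar>) \<le> 2 * \<bar>R\<bar> / (1 - q)"
proof -
  have part: "(\<Sum>x\<in>{x\<in>A. 0 < s * x}. \<bar>x\<bar>) \<le> \<bar>R\<bar> / (1 - q)" (is "sum abs ?B \<le> _") if "s = 1 \<or> s = -1" for s :: real
  proof (cases "?B = {}")
    case False
    have fin: "finite ?B" using assms by simp
    define m where "m = s * Max ((\<lambda>x. s * x) ` ?B)"
    have "Max ((\<lambda>x. s * x) ` ?B) \<in> (\<lambda>x. s * x) ` ?B" using fin False by (intro Max_in) auto
    hence m: "m \<in> ?B" using that by (auto simp: m_def)
    have "s * x \<le> s * m" if "x \<in> ?B" for x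
      using Max_ge[of "(\<lambda>x. s * x) ` ?B" "s * x"] fin that \<open>s = 1 \<or> s = -1\<close> by (auto simp: m_def)
    hence "0 < m * x \<and> \<bar>x\<bar> \<le> \<bar>m\<bar>" if "x \<in> ?B" for x using that m \<open>s = 1 \<or> s = -1\<close>
      by (auto simp: zero_less_mult_iff mult_less_0_iff)
    hence "(\<Sum>x\<in>?B. \<bar>x\<bar>) \<le> \<bar>m\<bar> / (1 - q)"
      using m assms fin by (intro sum_abs_same_sign_le) auto
    also have "\<dots> \<le> \<bar>R\<bar> / (1 - q)"
    proof (rule divide_right_mono)
      have "m \<in> {-R..R}" using m assms(3) by blast
      thus "\<bar>m\<bar> \<le> \<bar>R\<bar>" by auto
    qed (use q_less_1 in simp)
    finally show ?thesis .
  next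
    case True
    show ?thesis unfolding True using q_less_1 by simp
  qed
  have "(\<Sum>x\<in>A. \<bar>x\<bar>) = (\<Sum>x\<in>{x\<in>A. 0 < 1 * x} \<union> {x\<in>A. 0 < -1 * x}. \<bar>x\<bar>)"
  proof (rule sum.cong)
    have "0 < x \<or> x < 0" if "x \<in> A" for x
      using L_nonzero[OF subsetD[OF assms(2) that]] by linarith
    thus "A = {x\<in>A. 0 < 1 * x} \<union> {x\<in>A. 0 < -1 * x}" by auto
  qed simp
  also have "\<dots> = (\<Sum>x\<in>{x\<in>A. 0 < 1 * x}. \<bar>x\<bar>) + (\<Sum>x\<in>{x\<in>A. 0 < -1 * x}. \<bar>x\<bar>)"
    using assms(1) by (intro sum.union_disjoint) auto
  also have "\<dots> \<le> \<bar>R\<bar> / (1 - q) + \<bar>R\<bar> / (1 - q)" by (intro add_mono part) auto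
  finally show ?thesis by simp
qed

definition diff_const :: real where "diff_const = exp (- (2 / (1 - q)) / (1 - q))"

text \<open>Two distinct lattice points of the same sign differ by a factor \<open>q\<^sup>r\<close> with \<open>r \<noteq> 0\<close>, so the
  quotients \<open>\<bar>x - m\<bar> / max \<bar>x\<bar> \<bar>m\<bar>\<close> are at least \<open>1 - q\<^sup>\<bar>\<^sup>r\<^sup>\<bar>\<close>, and the infinite product of these
  numbers converges.\<close>

lemma prod_diff_ge:
  assumes "finite A" "A \<subseteq> L" "x \<in> L" "x \<notin> A"
  shows "diff_const * (\<Prod>m\<in>A. max \<bar>x\<bar> \<bar>m\<bar>) \<le> (\<Prod>m\<in>A. \<bar>x - m\<bar>)"
proof -
  define A1 where "A1 = {m\<in>A. 0 < x * m \<and> \<bar>m\<bar> \<le> \<bar>x\<bar>}"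
  define A2 where "A2 = {m\<in>A. 0 < x * m \<and> \<bar>x\<bar> < \<bar>m\<bar>}"
  define \<rho> where "\<rho> m = (if 0 < x * m then min \<bar>x\<bar> \<bar>m\<bar> / max \<bar>x\<bar> \<bar>m\<bar> else 0)" for m
  have x0: "x \<noteq> 0" and m0: "m \<noteq> 0" if "m \<in> A" for m using assms L_nonzero that by auto
  have "\<forall>m\<in>A1. \<exists>k::nat. m = x * q ^ k" using assms L_below[OF assms(3)] by (auto simp: A1_def) (metis subsetD)
  then obtain k1 :: "real \<Rightarrow> nat" where k1: "\<And>m. m \<in> A1 \<Longrightarrow> m = x * q ^ k1 m" by metis
  have "\<exists>k::nat. x = m * q ^ k" if "m \<in> A2" for m
  proof -
    have "m \<in> L" "0 < m * x" "\<bar>x\<bar> \<le> \<bar>m\<bar>" using that assms(2) by (auto simp: A2_def mult.commute)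
    thus ?thesis using L_below[of m x] assms(3) by metis
  qed
  then obtain k2 :: "real \<Rightarrow> nat" where k2: "\<And>m. m \<in> A2 \<Longrightarrow> x = m * q ^ k2 m" by metis
  have r1: "\<rho> m = q ^ k1 m" if "m \<in> A1" for m
  proof -
    have "\<bar>m\<bar> = \<bar>x * q ^ k1 m\<bar>" using k1[OF that] by metis
    hence "\<bar>m\<bar> = \<bar>x\<bar> * q ^ k1 m" using q_pos by (simp add: abs_mult)
    moreover have "\<rho> m = \<bar>m\<bar> / \<bar>x\<bar>" using that by (auto simp: \<rho>_def A1_def)
    ultimately show ?thesis using that x0 by (auto simp: A1_def)
  qed
  have r2: "\<rho> m = q ^ k2 m" if "m \<in> A2" for m
  proof -
    have "\<bar>x\<bar> = \<bar>m * q ^ k2 m\<bar>" using k2[OF that] by metis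
    hence "\<bar>x\<bar> = \<bar>m\<bar> * q ^ k2 m" using q_pos by (simp add: abs_mult)
    moreover have "\<rho> m = \<bar>x\<bar> / \<bar>m\<bar>" using that by (auto simp: \<rho>_def A2_def)
    ultimately show ?thesis using that m0 by (auto simp: A2_def)
  qed
  have fin: "finite A1" "finite A2" using assms(1) by (auto simp: A1_def A2_def)
  have "(\<Sum>m\<in>A. \<rho> m) = (\<Sum>m\<in>A1 \<union> A2. \<rho> m)"
    using assms(1) by (intro sum.mono_neutral_right) (auto simp: A1_def A2_def \<rho>_def)
  also have "\<dots> = (\<Sum>m\<in>A1. \<rho> m) + (\<Sum>m\<in>A2. \<rho> m)"
    using fin by (intro sum.union_disjoint) (auto simp: A1_def A2_def)
  also have "\<dots> \<le> 1 / (1 - q) + 1 / (1 - q)"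
  proof (rule add_mono)
    have "inj_on k1 A1" using k1 by (metis inj_onI)
    thus "(\<Sum>m\<in>A1. \<rho> m) \<le> 1 / (1 - q)" using sum_geometric_inj_le[OF fin(1)] r1 by simp
    have "inj_on k2 A2"
    proof (rule inj_onI)
      fix m m' assume m: "m \<in> A2" "m' \<in> A2" "k2 m = k2 m'"
      hence "m * q ^ k2 m = m' * q ^ k2 m" using k2 by metis
      thus "m = m'" using q_pos by simp
    qed
    thus "(\<Sum>m\<in>A2. \<rho> m) \<le> 1 / (1 - q)" using sum_geometric_inj_le[OF fin(2)] r2 by simp
  qed
  finally have sum_le: "(\<Sum>m\<in>A. \<rho> m) \<le> 2 / (1 - q)" by simp
  have rho: "0 \<le> \<rho> m \<and> \<rho> m \<le> q" if "m \<in> A" for m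
  proof -
    have "q ^ k \<le> q" if "k \<noteq> 0" for k using that q_pos q_less_1 power_decreasing[of 1 k q] by simp
    moreover have "k1 m \<noteq> 0" if "m \<in> A1" using k1[OF that] \<open>m \<in> A\<close> assms(4) by (metis mult.right_neutral power_0)
    moreover have "k2 m \<noteq> 0" if "m \<in> A2" using k2[OF that] \<open>m \<in> A\<close> assms(4) by (metis mult.right_neutral power_0)
    moreover have "\<rho> m = 0 \<or> m \<in> A1 \<or> m \<in> A2" using \<open>m \<in> A\<close> by (auto simp: \<rho>_def A1_def A2_def)
    ultimately show ?thesis using r1 r2 q_pos by fastforce
  qed
  have factor: "exp (- \<rho> m / (1 - q)) * max \<bar>x\<bar> \<bar>m\<bar> \<le> \<bar>x - m\<bar>" if m: "m \<in> A" for m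
  proof -
    let ?s = "\<rho> m"
    have s: "0 \<le> ?s" "?s \<le> q" "?s < 1" using rho[OF m] q_less_1 by auto
    have "1 / (1 - ?s) = 1 + ?s / (1 - ?s)" using s by (simp add: field_simps)
    also have "\<dots> \<le> 1 + ?s / (1 - q)" using s q_less_1 by (simp add: frac_le)
    also have "\<dots> \<le> exp (?s / (1 - q))" by (rule exp_ge_add_one_self)
    finally have "exp (- ?s / (1 - q)) \<le> 1 - ?s"
      using s by (simp add: exp_minus field_simps)
    hence "exp (- ?s / (1 - q)) * max \<bar>x\<bar> \<bar>m\<bar> \<le> (1 - ?s) * max \<bar>x\<bar> \<bar>m\<bar>"
      by (intro mult_right_mono) (auto simp: max_def)
    also have "\<dots> \<le> \<bar>x - m\<bar>"
    proof (cases "0 < x * m")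
      case True
      have "max \<bar>x\<bar> \<bar>m\<bar> > 0" using x0[OF m] by simp
      hence "(1 - ?s) * max \<bar>x\<bar> \<bar>m\<bar> = max \<bar>x\<bar> \<bar>m\<bar> - min \<bar>x\<bar> \<bar>m\<bar>"
        using True by (simp add: \<rho>_def left_diff_distrib)
      also have "\<dots> \<le> \<bar>x - m\<bar>" by (auto simp: max_def min_def)
      finally show ?thesis .
    next
      case False
      thus ?thesis using x0[OF m] m0[OF m] by (auto simp: \<rho>_def zero_less_mult_iff max_def)
    qed
    finally show ?thesis .
  qed
  have "diff_const \<le> exp (\<Sum>m\<in>A. - \<rho> m / (1 - q))"
    using divide_right_mono[OF sum_le, of "1 - q"] q_less_1
    by (simp add: diff_const_def sum_negf flip: sum_divide_distrib)
  also have "\<dots> = (\<Prod>m\<in>A. exp (- \<rho> m / (1 - q)))" using assms(1) by (rule exp_sum)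
  finally have "diff_const * (\<Prod>m\<in>A. max \<bar>x\<bar> \<bar>m\<bar>) \<le> (\<Prod>m\<in>A. exp (- \<rho> m / (1 - q))) * (\<Prod>m\<in>A. max \<bar>x\<bar> \<bar>m\<bar>)"
    by (intro mult_right_mono prod_nonneg) auto
  also have "\<dots> = (\<Prod>m\<in>A. exp (- \<rho> m / (1 - q)) * max \<bar>x\<bar> \<bar>m\<bar>)" by (simp add: prod.distrib)
  also have "\<dots> \<le> (\<Prod>m\<in>A. \<bar>x - m\<bar>)"
    using factor by (intro prod_mono) (auto intro!: mult_nonneg_nonneg)
  finally show ?thesis .
qed

section \<open>Tightness\<close>

text \<open>In the denominator of Lagrange's formula a point \<open>m\<close> contributes at least a multiple of
  \<open>max \<bar>x\<bar> \<bar>m\<bar>\<close>. For all but \<open>K + 1\<close> points this is bounded below by \<open>\<bar>x\<bar>\<close>, which the power in the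
  numerator compensates; for \<open>K + 1\<close> points of \<open>T0\<close> it is bounded below by a constant. This gains so many
  powers of \<open>\<bar>x\<bar>\<close> that the sum over \<open>x\<close> is at most a constant times the sum of all \<open>\<bar>x\<bar>\<close>, uniformly
  in \<open>A\<close>.\<close>

lemma interp_coeff_bound:
  assumes "finite T0" "T0 \<subseteq> L" "K + 2 \<le> card T0" "1 \<le> R"
  obtains C where "0 \<le> C" and
    "\<And>A g D i. finite A \<Longrightarrow> A \<subseteq> L \<Longrightarrow> A \<subseteq> {-R..R} \<Longrightarrow> T0 \<subseteq> A \<Longrightarrow> i < K \<Longrightarrow> 0 \<le> D \<Longrightarrow>
      (\<And>x. x \<in> A \<Longrightarrow> \<bar>g x\<bar> \<le> D * \<bar>x\<bar> ^ (card A - 2 - i)) \<Longrightarrow> \<bar>interp_coeff A g i\<bar> \<le> C * D"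
proof -
  define p where "p = K + 1"
  define \<tau> where "\<tau> = Min (abs ` T0)"
  have "T0 \<noteq> {}" using assms(3) by auto
  hence "\<tau> \<in> abs ` T0" unfolding \<tau>_def using assms(1) by (intro Min_in) auto
  hence tau: "0 < \<tau>" using assms(2) L_nonzero by auto
  have tau_le: "\<tau> \<le> \<bar>t\<bar>" if "t \<in> T0" for t unfolding \<tau>_def using that assms(1) by simp
  let ?E = "exp (2 * \<bar>R\<bar> / (1 - q))"
  let ?c = "R ^ p / (diff_const * \<tau> ^ p)"
  have c0: "0 < diff_const" by (simp add: diff_const_def)
  have main: "\<bar>interp_coeff A g i\<bar> \<le> (?E * ?c * (2 * \<bar>R\<bar> / (1 - q))) * D"
    if A: "finite A" "A \<subseteq> L" "A \<subseteq> {-R..R}" "T0 \<subseteq> A" and i: "i < K" and D: "0 \<le> D"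
      and g: "\<And>x. x \<in> A \<Longrightarrow> \<bar>g x\<bar> \<le> D * \<bar>x\<bar> ^ (card A - 2 - i)" for A g D i
  proof -
    let ?N = "card A"
    have pN: "p + 1 \<le> ?N" using card_mono[OF A(1,4)] assms(3) by (simp add: p_def)
    have term_le: "\<bar>g x * ecoeff (A - {x}) i / (\<Prod>m\<in>A - {x}. x - m)\<bar> \<le> ?E * ?c * D * \<bar>x\<bar>" if x: "x \<in> A" for x
    proof -
      have "x \<in> L" "x \<in> {-R..R}" using x A by auto
      hence x0: "0 < \<bar>x\<bar>" and xR: "\<bar>x\<bar> \<le> R" using L_nonzero by auto
      have "p \<le> card (T0 - {x})" using assms(1,3) by (cases "x \<in> T0") (auto simp: p_def card_Diff_singleton)
      then obtain T where T: "T \<subseteq> T0 - {x}" "card T = p" by (meson obtain_subset_with_card_n)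
      have finT: "finite T" using T assms(1) by (meson finite_Diff finite_subset)
      have TA: "T \<subseteq> A - {x}" using T A(4) by auto
      have "\<tau> ^ p * \<bar>x\<bar> ^ (?N - 1 - p) = (\<Prod>m\<in>T. \<tau>) * (\<Prod>m\<in>A - {x} - T. \<bar>x\<bar>)"
        using T TA finT A(1) x by (simp add: card_Diff_subset card_Diff_singleton)
      also have "\<dots> \<le> (\<Prod>m\<in>T. max \<bar>x\<bar> \<bar>m\<bar>) * (\<Prod>m\<in>A - {x} - T. max \<bar>x\<bar> \<bar>m\<bar>)"
      proof (intro mult_mono prod_mono conjI)
        fix m assume "m \<in> T"
        thus "\<tau> \<le> max \<bar>x\<bar> \<bar>m\<bar>" using tau_le[of m] T by auto
      qed (use tau in \<open>auto intro!: prod_nonneg\<close>)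
      also have "\<dots> = (\<Prod>m\<in>A - {x}. max \<bar>x\<bar> \<bar>m\<bar>)"
        using prod.subset_diff[of T "A - {x}" "\<lambda>m. max \<bar>x\<bar> \<bar>m\<bar>"] A(1) TA by (simp add: mult.commute)
      finally have "diff_const * (\<tau> ^ p * \<bar>x\<bar> ^ (?N - 1 - p)) \<le> diff_const * (\<Prod>m\<in>A - {x}. max \<bar>x\<bar> \<bar>m\<bar>)"
        using c0 by simp
      also have "\<dots> \<le> (\<Prod>m\<in>A - {x}. \<bar>x - m\<bar>)" using A x by (intro prod_diff_ge) auto
      also have "\<dots> = \<bar>\<Prod>m\<in>A - {x}. x - m\<bar>" by (simp add: abs_prod)
      finally have den: "diff_const * (\<tau> ^ p * \<bar>x\<bar> ^ (?N - 1 - p)) \<le> \<bar>\<Prod>m\<in>A - {x}. x - m\<bar>" .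
      have "(\<Sum>m\<in>A - {x}. \<bar>m\<bar>) \<le> 2 * \<bar>R\<bar> / (1 - q)"
        using A by (intro sum_abs_le) auto
      hence num: "\<bar>ecoeff (A - {x}) i\<bar> \<le> ?E"
        using abs_ecoeff_le[of "A - {x}" i] A(1) by (meson exp_le_cancel_iff finite_Diff order_trans)
      have "\<bar>g x * ecoeff (A - {x}) i / (\<Prod>m\<in>A - {x}. x - m)\<bar> =
          \<bar>g x\<bar> * \<bar>ecoeff (A - {x}) i\<bar> / \<bar>\<Prod>m\<in>A - {x}. x - m\<bar>" by (simp add: abs_mult)
      also have "\<dots> \<le> (D * \<bar>x\<bar> ^ (?N - 2 - i)) * ?E / (diff_const * (\<tau> ^ p * \<bar>x\<bar> ^ (?N - 1 - p)))"
      proof (rule frac_le)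
        show "\<bar>g x\<bar> * \<bar>ecoeff (A - {x}) i\<bar> \<le> D * \<bar>x\<bar> ^ (?N - 2 - i) * ?E"
          by (rule mult_mono[OF g[OF x] num]) (use D in simp_all)
        show "0 < diff_const * (\<tau> ^ p * \<bar>x\<bar> ^ (?N - 1 - p))" using c0 tau x0 by simp
      qed (use D den in simp_all)
      also have "\<bar>x\<bar> ^ (?N - 2 - i) = \<bar>x\<bar> ^ (?N - 1 - p) * (\<bar>x\<bar> * \<bar>x\<bar> ^ (p - 2 - i))"
      proof -
        have "?N - 2 - i = (?N - 1 - p) + Suc (p - 2 - i)" using i pN by (simp add: p_def)
        thus ?thesis by (simp only: power_add power_Suc)
      qed
      also have "(D * (\<bar>x\<bar> ^ (?N - 1 - p) * (\<bar>x\<bar> * \<bar>x\<bar> ^ (p - 2 - i)))) * ?E / (diff_const * (\<tau> ^ p * \<bar>x\<bar> ^ (?N - 1 - p))) =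
          (D * \<bar>x\<bar> * ?E / (diff_const * \<tau> ^ p)) * \<bar>x\<bar> ^ (p - 2 - i)"
        using x0 by simp
      also have "\<dots> \<le> (D * \<bar>x\<bar> * ?E / (diff_const * \<tau> ^ p)) * R ^ p"
      proof (rule mult_left_mono)
        have "\<bar>x\<bar> ^ (p - 2 - i) \<le> R ^ (p - 2 - i)" using xR by (intro power_mono) auto
        also have "\<dots> \<le> R ^ p" using assms(4) by (intro power_increasing) auto
        finally show "\<bar>x\<bar> ^ (p - 2 - i) \<le> R ^ p" .
      qed (use D c0 tau in simp)
      finally show ?thesis by (simp add: mult_ac)
    qed
    have "\<bar>interp_coeff A g i\<bar> \<le> (\<Sum>x\<in>A. ?E * ?c * D * \<bar>x\<bar>)"
      unfolding interp_coeff_def by (rule order_trans[OF sum_abs sum_mono]) (rule term_le)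
    also have "\<dots> = ?E * ?c * D * (\<Sum>x\<in>A. \<bar>x\<bar>)" by (rule sum_distrib_left[symmetric])
    also have "\<dots> \<le> ?E * ?c * D * (2 * \<bar>R\<bar> / (1 - q))"
      using D c0 tau assms(4) by (intro mult_left_mono sum_abs_le A) auto
    finally show ?thesis by (simp add: mult_ac)
  qed
  show ?thesis
    by (rule that[OF _ main]) (use c0 tau q_less_1 assms(4) in auto)
qed

text \<open>Only the part of the orbit of \<open>x\<close> inside \<open>{-\<delta><..<\<delta>}\<close> contributes, and that part is a geometric series
  with leading term less than \<open>\<delta>\<close>.\<close>

lemma qint_small_bound:
  assumes "0 < \<delta>"
  shows "\<bar>qint (\<lambda>y. of_bool (\<bar>y\<bar> < \<delta>) * y ^ n) x\<bar> \<le> \<delta> / (1 - q) * \<bar>x\<bar> ^ n"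
proof -
  let ?h = "\<lambda>x k. of_bool (\<bar>x\<bar> * q ^ k < \<delta>) * (\<bar>x\<bar> * q ^ k)"
  have fin: "(\<Sum>k<n. ?h x k) \<le> min \<bar>x\<bar> \<delta> / (1 - q)" for n x
  proof (induction n arbitrary: x)
    case (Suc n)
    have "(\<Sum>k<Suc n. ?h x k) = of_bool (\<bar>x\<bar> < \<delta>) * \<bar>x\<bar> + (\<Sum>k<n. ?h (x * q) k)"
      unfolding sum.lessThan_Suc_shift using q_pos by (simp add: abs_mult mult_ac)
    also have "\<dots> \<le> of_bool (\<bar>x\<bar> < \<delta>) * \<bar>x\<bar> + min (\<bar>x\<bar> * q) \<delta> / (1 - q)"
      using Suc.IH[of "x * q"] q_pos by (simp add: abs_mult)
    also have "\<dots> \<le> min \<bar>x\<bar> \<delta> / (1 - q)"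
    proof (cases "\<bar>x\<bar> < \<delta>")
      case True
      have "\<bar>x\<bar> + min (\<bar>x\<bar> * q) \<delta> / (1 - q) \<le> \<bar>x\<bar> + \<bar>x\<bar> * q / (1 - q)"
        using q_less_1 by (intro add_left_mono divide_right_mono) auto
      also have "\<dots> = \<bar>x\<bar> / (1 - q)" using q_less_1 by (simp add: field_simps)
      finally show ?thesis using True by simp
    next
      case False
      thus ?thesis using q_less_1 by (auto intro!: divide_right_mono)
    qed
    finally show ?case .
  qed (use q_less_1 assms in auto)
  have lb: "loc_bdd (\<lambda>y. of_bool (\<bar>y\<bar> < \<delta>) * y ^ n)" by (intro loc_bdd_of_bool_mult loc_bdd_power)
  let ?t = "\<lambda>k. x * q ^ k * (of_bool (\<bar>x * q ^ k\<bar> < \<delta>) * (x * q ^ k) ^ n)"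
  have "norm (?t k) \<le> ?h x k * \<bar>x\<bar> ^ n" for k
  proof -
    have "\<bar>x * q ^ k\<bar> ^ n \<le> \<bar>x\<bar> ^ n" by (intro power_mono abs_orbit_le) auto
    hence "?h x k * \<bar>x * q ^ k\<bar> ^ n \<le> ?h x k * \<bar>x\<bar> ^ n"
      using q_pos by (intro mult_left_mono) auto
    thus ?thesis using q_pos by (simp add: abs_mult power_abs mult_ac)
  qed
  hence "(\<Sum>k<m. norm (?t k)) \<le> (\<Sum>k<m. ?h x k * \<bar>x\<bar> ^ n)" for m by (rule sum_mono)
  also have "(\<Sum>k<m. ?h x k * \<bar>x\<bar> ^ n) \<le> \<delta> / (1 - q) * \<bar>x\<bar> ^ n" for m
  proof -
    have "(\<Sum>k<m. ?h x k) \<le> \<delta> / (1 - q)"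
      by (rule order_trans[OF fin]) (use q_less_1 in \<open>auto intro!: divide_right_mono\<close>)
    thus ?thesis unfolding sum_distrib_right[symmetric] by (rule mult_right_mono) simp
  qed
  finally have "(\<Sum>k. norm (?t k)) \<le> \<delta> / (1 - q) * \<bar>x\<bar> ^ n"
    by (intro suminf_le_const qint_summable[OF lb])
  moreover have "\<bar>qint (\<lambda>y. of_bool (\<bar>y\<bar> < \<delta>) * y ^ n) x\<bar> \<le> (\<Sum>k. norm (?t k))"
    unfolding qint_def using summable_norm[OF qint_summable[OF lb, of x]] by simp
  ultimately show ?thesis by linarith
qed

text \<open>The functions that occur in row \<open>i\<close> when the number of points in \<open>{-\<delta><..<\<delta>}\<close> is written as
  a trace at level \<open>K\<close> and is lifted by \<open>d\<close> levels.\<close>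

fun count_row :: "real \<Rightarrow> nat \<Rightarrow> nat \<Rightarrow> nat \<Rightarrow> real \<Rightarrow> real" where
  "count_row \<delta> K i 0 = (\<lambda>x. of_bool (\<bar>x\<bar> < \<delta>) * x ^ (K - Suc i))"
| "count_row \<delta> K i (Suc d) = (\<lambda>x. (1 - q ^ (K + d - i)) * qint (count_row \<delta> K i d) x)"

lemma loc_bdd_count_row: "loc_bdd (count_row \<delta> K i d)"
  by (induction d) (auto intro!: loc_bdd_of_bool_mult loc_bdd_power loc_bdd_cmult loc_bdd_qint)

text \<open>After the first q-integral the factors \<open>1 - q\<^sup>k\<close> telescope; the factor in the bound is
  the one that the next step cancels.\<close>

lemma count_row_bound:
  assumes "0 < \<delta>" "i < K"
  shows "\<bar>count_row \<delta> K i (Suc d) x\<bar> \<le> \<delta> / (1 - q) * (1 - q ^ (K + d - i)) * \<bar>x\<bar> ^ (K + d - Suc i)"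
proof (induction d arbitrary: x)
  case 0
  have "0 < 1 - q ^ (K - i)" using assms by (intro one_minus_qpow_pos) auto
  thus ?case using mult_left_mono[OF qint_small_bound[OF assms(1), of "K - Suc i" x], of "1 - q ^ (K - i)"]
    by (simp add: abs_mult mult_ac)
next
  case (Suc d)
  let ?a = "1 - q ^ (K + d - i)" and ?b = "1 - q ^ (K + Suc d - i)"
  have ab: "0 < ?a" "0 < ?b" using assms by (intro one_minus_qpow_pos; simp)+
  have e: "Suc (K + d - Suc i) = K + d - i" "K + Suc d - Suc i = K + d - i" using assms by auto
  have "\<bar>qint (count_row \<delta> K i (Suc d)) x\<bar> \<le> \<delta> / (1 - q) * ?a * \<bar>x\<bar> ^ Suc (K + d - Suc i) / (1 - q ^ Suc (K + d - Suc i))"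
    by (rule qint_terms_bound(2)) (rule Suc.IH)
  also have "\<dots> = \<delta> / (1 - q) * \<bar>x\<bar> ^ (K + d - i)" unfolding e using ab by simp
  finally have "?b * \<bar>qint (count_row \<delta> K i (Suc d)) x\<bar> \<le> ?b * (\<delta> / (1 - q) * \<bar>x\<bar> ^ (K + d - i))"
    using ab by (intro mult_left_mono) auto
  moreover have "\<bar>count_row \<delta> K i (Suc (Suc d)) x\<bar> = ?b * \<bar>qint (count_row \<delta> K i (Suc d)) x\<bar>"
    using ab by (subst count_row.simps(2)) (simp only: abs_mult abs_of_pos)
  ultimately show ?case unfolding e by (simp only: mult_ac)
qed

text \<open>By Markov's inequality it suffices to bound the expected number of points in \<open>{-\<delta><..<\<delta>}\<close>. That
  number is a trace, a sum of \<open>K\<close> interpolation coefficients, and so belongs to a coherent family whose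
  member at the level of \<open>X\<close> is controlled by \<open>count_row_bound\<close> and \<open>interp_coeff_bound\<close>.\<close>

theorem lp_tight:
  assumes "finite T0" "T0 \<subseteq> L" "K + 2 \<le> card T0" "1 \<le> R"
  obtains C where "0 \<le> C" and
    "\<And>\<delta> d X F. 0 < \<delta> \<Longrightarrow> X \<in> cfg (K + Suc d) \<Longrightarrow> X \<subseteq> {-R..R} \<Longrightarrow> T0 \<subseteq> X \<Longrightarrow>
      finite F \<Longrightarrow> F \<subseteq> {Z \<in> cfg K. \<exists>z\<in>Z. \<bar>z\<bar> < \<delta>} \<Longrightarrow> (\<Sum>Z\<in>F. lp K (Suc d) X Z) \<le> C * \<delta>"
proof -
  obtain C where C0: "0 \<le> C" and C: "\<And>A g D i. finite A \<Longrightarrow> A \<subseteq> L \<Longrightarrow> A \<subseteq> {-R..R} \<Longrightarrow> T0 \<subseteq> A \<Longrightarrow> i < K \<Longrightarrow> 0 \<le> D \<Longrightarrow>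
      (\<And>x. x \<in> A \<Longrightarrow> \<bar>g x\<bar> \<le> D * \<bar>x\<bar> ^ (card A - 2 - i)) \<Longrightarrow> \<bar>interp_coeff A g i\<bar> \<le> C * D"
    using interp_coeff_bound[OF assms] by metis
  have main: "(\<Sum>Z\<in>F. lp K (Suc d) X Z) \<le> (real K * C / (1 - q)) * \<delta>"
    if \<delta>: "0 < \<delta>" and X: "X \<in> cfg (K + Suc d)" "X \<subseteq> {-R..R}" "T0 \<subseteq> X"
      and F: "finite F" "F \<subseteq> {Z \<in> cfg K. \<exists>z\<in>Z. \<bar>z\<bar> < \<delta>}" for \<delta> d X F
  proof -
    note Xp = cfgD[OF X(1)]
    define \<phi> where "\<phi> N X = (\<Sum>i<K. interp_coeff X (count_row \<delta> K i (N - K)) i)" for N X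
    have coh: "((\<lambda>Y. lk N X Y * \<phi> N Y) has_sum \<phi> (Suc N) X) (cfg N)"
      if "K \<le> N" "X \<in> cfg (Suc N)" for N X
    proof -
      have "((\<lambda>Y. lk N X Y * interp_coeff Y (count_row \<delta> K i (N - K)) i) has_sum
          interp_coeff X (count_row \<delta> K i (Suc N - K)) i) (cfg N)" if "i < K" for i
        using has_sum_link_interp_coeff[OF \<open>X \<in> cfg (Suc N)\<close>, of i "count_row \<delta> K i (N - K)"] that \<open>K \<le> N\<close>
        by (simp add: Suc_diff_le loc_bdd_count_row)
      thus ?thesis unfolding \<phi>_def sum_distrib_left by (intro has_sum_finite_sum) auto
    qed
    have base: "\<phi> K Z = real (card {z\<in>Z. \<bar>z\<bar> < \<delta>})" if "Z \<in> cfg K" for Z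
      using sum_interp_coeff_diagonal[of Z "\<lambda>x. of_bool (\<bar>x\<bar> < \<delta>)"] cfgD[OF that]
      by (simp add: \<phi>_def Int_def)
    have "\<bar>\<phi> K Z\<bar> \<le> real K" if "Z \<in> cfg K" for Z
      using base[OF that] cfgD[OF that] card_mono[of Z "{z\<in>Z. \<bar>z\<bar> < \<delta>}"] by simp
    hence h: "((\<lambda>Z. lp K (Suc d) X Z * \<phi> K Z) has_sum \<phi> (K + Suc d) X) (cfg K)"
      by (intro has_sum_lp[where \<phi> = \<phi>, OF coh _ X(1,2)])
    have "(\<Sum>Z\<in>F. lp K (Suc d) X Z) \<le> (\<Sum>Z\<in>F. lp K (Suc d) X Z * \<phi> K Z)"
    proof (rule sum_mono)
      fix Z assume "Z \<in> F"
      hence Z: "Z \<in> cfg K" "\<exists>z\<in>Z. \<bar>z\<bar> < \<delta>" using F by auto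
      hence "card {z\<in>Z. \<bar>z\<bar> < \<delta>} \<noteq> 0" using cfgD(2)[OF Z(1)] by auto
      hence "1 \<le> \<phi> K Z" unfolding base[OF Z(1)] by simp
      thus "lp K (Suc d) X Z \<le> lp K (Suc d) X Z * \<phi> K Z"
        using mult_left_mono[of 1 "\<phi> K Z" "lp K (Suc d) X Z"] lp_nonneg[of K "Suc d" X Z] by simp
    qed
    also have "\<dots> \<le> \<phi> (K + Suc d) X"
      using F base lp_nonneg by (intro finite_sum_le_has_sum[OF h]) (auto intro!: mult_nonneg_nonneg simp del: link_prod.simps)
    also have "\<dots> \<le> (\<Sum>i<K. C * (\<delta> / (1 - q)))"
      unfolding \<phi>_def
    proof (rule sum_mono)
      fix i assume i: "i \<in> {..<K}"
      have "\<bar>interp_coeff X (count_row \<delta> K i (Suc d)) i\<bar> \<le> C * (\<delta> / (1 - q))"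
      proof (rule C)
        fix x assume "x \<in> X"
        have "\<delta> / (1 - q) * (1 - q ^ (K + d - i)) \<le> \<delta> / (1 - q) * 1"
          using \<delta> q_pos q_less_1 by (intro mult_left_mono) auto
        hence "\<delta> / (1 - q) * (1 - q ^ (K + d - i)) * \<bar>x\<bar> ^ (K + d - Suc i) \<le> \<delta> / (1 - q) * \<bar>x\<bar> ^ (K + d - Suc i)"
          by (intro mult_right_mono) auto
        moreover have "card X - 2 - i = K + d - Suc i" using Xp by simp
        ultimately show "\<bar>count_row \<delta> K i (Suc d) x\<bar> \<le> \<delta> / (1 - q) * \<bar>x\<bar> ^ (card X - 2 - i)"
          using count_row_bound[OF \<delta>, of i K d x] i by (simp del: count_row.simps)
      qed (use Xp X i \<delta> q_less_1 in auto)
      thus "interp_coeff X (count_row \<delta> K i (K + Suc d - K)) i \<le> C * (\<delta> / (1 - q))"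
        by (simp del: count_row.simps)
    qed
    finally show ?thesis by (simp add: mult_ac)
  qed
  show ?thesis by (rule that[OF _ main]) (use C0 q_less_1 in auto)
qed

end


section \<open>Approximation by Schur polynomials\<close>

lemma decreasing_rearrangement:
  fixes b :: "nat \<Rightarrow> nat"
  assumes "inj_on b {..<K}"
  obtains p where "p permutes {..<K}" "\<And>i j. i < j \<Longrightarrow> j < K \<Longrightarrow> b (p j) < b (p i)"
proof -
  let ?B = "b ` {..<K}" let ?l = "rev (sorted_list_of_set ?B)"
  have card: "card ?B = K" using assms by (simp add: card_image)
  have l: "set ?l = ?B" "length ?l = K" "distinct ?l" using card by auto
  define p where "p i = (if i < K then inv_into {..<K} b (?l ! i) else i)" for i
  have mem: "?l ! i \<in> ?B" if "i < K" for i using l that by (metis nth_mem)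
  have bp: "b (p i) = ?l ! i" and pK: "p i < K" if "i < K" for i
    using mem[OF that] that inv_into_into[OF mem[OF that]] by (auto simp: p_def f_inv_into_f)
  have "inj_on p {..<K}"
  proof (rule inj_onI)
    fix i j assume ij: "i \<in> {..<K}" "j \<in> {..<K}" "p i = p j"
    hence "?l ! i = ?l ! j" using bp[of i] bp[of j] by simp
    thus "i = j" using l ij by (simp add: nth_eq_iff_index_eq)
  qed
  moreover have "p ` {..<K} \<subseteq> {..<K}" using pK by auto
  ultimately have "bij_betw p {..<K} {..<K}" by (simp add: endo_inj_surj bij_betw_def)
  hence "p permutes {..<K}" by (rule bij_imp_permutes) (simp add: p_def)
  moreover have "b (p j) < b (p i)" if "i < j" "j < K" for i j
  proof -
    have "sorted_wrt (>) ?l" by (simp add: sorted_wrt_rev)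
    hence "?l ! j < ?l ! i" using that l(2) by (auto simp: sorted_wrt_iff_nth_less)
    thus ?thesis using bp that by simp
  qed
  ultimately show ?thesis by (rule that)
qed

text \<open>If two exponents coincide then so do two rows. Otherwise the exponents can be sorted, at the cost
  of a sign, and subtracting \<open>K - 1, \<dots>, 1, 0\<close> leaves a partition.\<close>

lemma alternant_eq_schur:
  obtains \<nu> s where "\<nu> \<in> partitions_le K"
    "\<And>u. fdet K (\<lambda>i j. u j ^ b i) / vdm K u = s * schur_poly \<nu> K u"
proof (cases "inj_on b {..<K}")
  case False
  then obtain i k where ik: "i < K" "k < K" "i \<noteq> k" "b i = b k" by (auto simp: inj_on_def)
  have "fdet K (\<lambda>i j. u j ^ b i) = 0" for u
    by (rule fdet_identical_rows[OF ik(1-3)]) (simp add: ik(4))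
  thus ?thesis by (intro that[of "\<lambda>_. 0" 0]) (auto simp: partitions_le_def intro: antimonoI)
next
  case True
  then obtain p where p: "p permutes {..<K}" and dec: "\<And>i j. i < j \<Longrightarrow> j < K \<Longrightarrow> b (p j) < b (p i)"
    using decreasing_rearrangement by blast
  have gap: "b (p (i + d)) + d \<le> b (p i)" if "i + d < K" for i d
    using that
  proof (induction d)
    case (Suc d)
    thus ?case using dec[of "i + d" "i + Suc d"] by simp
  qed simp
  have gap': "b (p j) + (j - i) \<le> b (p i)" if "i \<le> j" "j < K" for i j
    using gap[of i "j - i"] that by simp
  have low: "K - Suc i \<le> b (p i)" if "i < K" for i
  proof -
    have "i \<le> K - 1" "K - 1 < K" using that by auto
    from gap'[OF this] show ?thesis by arith
  qed
  define \<nu> where "\<nu> i = (if i < K then b (p i) - (K - Suc i) else 0)" for i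
  have "\<nu> \<in> partitions_le K"
  proof -
    have "antimono \<nu>"
    proof (rule antimonoI)
      fix i j :: nat assume "i \<le> j"
      show "\<nu> j \<le> \<nu> i"
      proof (cases "j < K")
        case True
        thus ?thesis using gap'[OF \<open>i \<le> j\<close> True] \<open>i \<le> j\<close> by (simp add: \<nu>_def)
      qed (simp add: \<nu>_def)
    qed
    thus ?thesis by (simp add: partitions_le_def \<nu>_def)
  qed
  moreover have "fdet K (\<lambda>i j. u j ^ b i) / vdm K u = real_of_int (sign p) * schur_poly \<nu> K u" for u
  proof -
    have "fdet K (\<lambda>i j. u j ^ (\<nu> i + (K - Suc i))) = fdet K (\<lambda>i j. u j ^ b (p i))"
    proof (rule fdet_cong)
      fix i j assume "i < K"
      hence "\<nu> i + (K - Suc i) = b (p i)" using low[of i] by (simp add: \<nu>_def del: diff_diff_left)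
      thus "u j ^ (\<nu> i + (K - Suc i)) = u j ^ b (p i)" by simp
    qed
    also have "\<dots> = signof p * fdet K (\<lambda>i j. u j ^ b i)" by (rule fdet_permute_rows[OF p])
    finally show ?thesis by (simp add: schur_poly_fdet flip: mult.assoc of_int_mult)
  qed
  ultimately show ?thesis by (rule that)
qed

context qlattice begin

lemma monomial_alternant_eq_schur_norm:
  obtains \<nu> s where "\<nu> \<in> partitions_le K"
    "\<And>Y. fdet K (\<lambda>i j. elt Y j ^ b i) / vdm K (elt Y) = s * schur_poly_norm q \<nu> K Y"
proof -
  obtain \<nu> s where *: "\<nu> \<in> partitions_le K" "\<And>u. fdet K (\<lambda>i j. u j ^ b i) / vdm K u = s * schur_poly \<nu> K u"
    by (rule alternant_eq_schur[where K = K and b = b]) (rule that)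
  have "schur_poly \<nu> K (\<lambda>i. q ^ i) \<noteq> 0" using schur_qpow_pos[OF q_pos q_less_1 *(1), of K] by simp
  thus ?thesis
    by (intro that[OF *(1), of "s * schur_poly \<nu> K (\<lambda>i. q ^ i)"]) (simp add: *(2) schur_poly_norm_def)
qed

text \<open>Multiplying column \<open>j\<close> of the Vandermonde matrix by the value of the polynomial at \<open>y\<^sub>j\<close> gives the product
  times the Vandermonde determinant; by multilinearity in the rows it is a combination of alternants.\<close>

lemma prod_eq_schur_combination:
  fixes a :: "nat \<Rightarrow> real"
  obtains I :: "(nat \<Rightarrow> nat) set" and c \<nu> where "finite I" "\<And>\<alpha>. \<alpha> \<in> I \<Longrightarrow> \<nu> \<alpha> \<in> partitions_le K"
    "\<And>Y. Y \<in> cfg K \<Longrightarrow> (\<Prod>y\<in>Y. \<Sum>k\<le>n. a k * y ^ k) = (\<Sum>\<alpha>\<in>I. c \<alpha> * schur_poly_norm q (\<nu> \<alpha>) K Y)"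
proof -
  let ?p = "\<lambda>y. \<Sum>k\<le>n. a k * y ^ k"
  let ?I = "PiE {..<K} (\<lambda>_. {..n})"
  have "\<forall>\<alpha>. \<exists>\<nu> s. \<nu> \<in> partitions_le K \<and> (\<forall>Y. fdet K (\<lambda>i j. elt Y j ^ (\<alpha> i + (K - Suc i))) / vdm K (elt Y) =
      s * schur_poly_norm q \<nu> K Y)"
    using monomial_alternant_eq_schur_norm by (metis (full_types))
  then obtain \<nu> s where \<nu>: "\<And>\<alpha>. \<nu> \<alpha> \<in> partitions_le K"
    and s: "\<And>\<alpha> Y. fdet K (\<lambda>i j. elt Y j ^ (\<alpha> i + (K - Suc i))) / vdm K (elt Y) = s \<alpha> * schur_poly_norm q (\<nu> \<alpha>) K Y"
    by metis
  have "(\<Prod>y\<in>Y. ?p y) = (\<Sum>\<alpha>\<in>?I. ((\<Prod>i<K. a (\<alpha> i)) * s \<alpha>) * schur_poly_norm q (\<nu> \<alpha>) K Y)" if Y: "Y \<in> cfg K" for Y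
  proof -
    note e = elt_props[OF cfgD(2,3)[OF Y]]
    have "(\<Prod>y\<in>Y. ?p y) = (\<Prod>y\<in>elt Y ` {..<K}. ?p y)" by (simp only: e(1))
    also have "\<dots> = (\<Prod>j<K. ?p (elt Y j))" by (simp add: prod.reindex[OF e(3)])
    finally have "(\<Prod>y\<in>Y. ?p y) * vdm K (elt Y) = fdet K (\<lambda>i j. ?p (elt Y j) * elt Y j ^ (K - Suc i))"
      unfolding vandermonde_det[symmetric] fdet_scale_cols by simp
    also have "\<dots> = fdet K (\<lambda>i j. \<Sum>k\<in>{..n}. a k * elt Y j ^ (k + (K - Suc i)))"
      by (rule fdet_cong) (simp only: sum_distrib_right power_add mult.assoc)
    also have "\<dots> = (\<Sum>\<alpha>\<in>?I. fdet K (\<lambda>i j. a (\<alpha> i) * elt Y j ^ (\<alpha> i + (K - Suc i))))"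
      by (rule fdet_sum_rows) simp
    finally have eq: "(\<Prod>y\<in>Y. ?p y) * vdm K (elt Y) = (\<Sum>\<alpha>\<in>?I. (\<Prod>i<K. a (\<alpha> i)) * fdet K (\<lambda>i j. elt Y j ^ (\<alpha> i + (K - Suc i))))"
      unfolding fdet_scale_rows .
    have "(\<Prod>y\<in>Y. ?p y) = (\<Prod>y\<in>Y. ?p y) * vdm K (elt Y) / vdm K (elt Y)"
      using vdm_nonzero[OF e(3)] by simp
    also have "\<dots> = (\<Sum>\<alpha>\<in>?I. (\<Prod>i<K. a (\<alpha> i)) * (fdet K (\<lambda>i j. elt Y j ^ (\<alpha> i + (K - Suc i))) / vdm K (elt Y)))"
      unfolding eq sum_divide_distrib by simp
    finally show ?thesis unfolding s by (simp add: mult.assoc)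
  qed
  moreover have "finite ?I" by (intro finite_PiE) auto
  ultimately show ?thesis using \<nu> by (intro that[of ?I]) auto
qed

lemma separated:
  assumes "x \<in> L" "m \<in> L" "x \<noteq> m" shows "diff_const * \<bar>m\<bar> \<le> \<bar>x - m\<bar>"
proof -
  have "diff_const * \<bar>m\<bar> \<le> diff_const * max \<bar>x\<bar> \<bar>m\<bar>"
    by (intro mult_left_mono) (auto simp: diff_const_def)
  also have "\<dots> \<le> \<bar>x - m\<bar>" using prod_diff_ge[of "{m}" x] assms by simp
  finally show ?thesis .
qed

text \<open>On the points of the lattice in a bounded segment, the indicator function of a finite set is
  the restriction of a continuous function, because the points of the set are isolated.\<close>

lemma indicator_polynomial:
  assumes "finite Y0" "Y0 \<noteq> {}" "Y0 \<subseteq> L" "0 < \<eta>"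
  obtains a :: "nat \<Rightarrow> real" and n where
    "\<And>y. y \<in> L \<Longrightarrow> y \<in> {-R..R} \<Longrightarrow> \<bar>(\<Sum>k\<le>n. a k * y ^ k)\<bar> \<le> 1"
    "\<And>y. y \<in> L \<Longrightarrow> y \<in> {-R..R} \<Longrightarrow> \<bar>(\<Sum>k\<le>n. a k * y ^ k) - of_bool (y \<in> Y0)\<bar> \<le> 2 * \<eta>"
proof -
  define r where "r = diff_const * Min (abs ` Y0)"
  have "Min (abs ` Y0) \<in> abs ` Y0" using assms by (intro Min_in) auto
  hence "0 < Min (abs ` Y0)" using assms(3) L_nonzero by auto
  hence r: "0 < r" by (simp add: r_def diff_const_def)
  define \<phi> where "\<phi> y = max 0 (1 - infdist y Y0 / r)" for y
  have "continuous_on {-R..R} \<phi>" unfolding \<phi>_def using r by (intro continuous_intros) auto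
  then obtain g where g: "real_polynomial_function g" "\<And>x. x \<in> {-R..R} \<Longrightarrow> \<bar>\<phi> x - g x\<bar> < \<eta>"
    using Stone_Weierstrass_real_polynomial_function[of "{-R..R}" \<phi> \<eta>] assms(4) by blast
  then obtain a n where gn: "g = (\<lambda>x. \<Sum>i\<le>n. a i * x ^ i)" using real_polynomial_function_iff_sum by blast
  have \<phi>: "\<phi> y = of_bool (y \<in> Y0)" if "y \<in> L" for y
  proof (cases "y \<in> Y0")
    case False
    have "r \<le> infdist y Y0" unfolding infdist_notempty[OF assms(2)]
    proof (rule cINF_greatest[OF assms(2)])
      fix m assume m: "m \<in> Y0"
      have "r \<le> diff_const * \<bar>m\<bar>" unfolding r_def
        using m assms(1) by (intro mult_left_mono) (auto simp: diff_const_def)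
      also have "\<dots> \<le> dist y m"
        unfolding dist_real_def by (rule separated) (use m False that assms(3) in auto)
      finally show "r \<le> dist y m" .
    qed
    thus ?thesis using False r by (simp add: \<phi>_def)
  qed (simp add: \<phi>_def)
  \<comment> \<open>The division makes the values at most \<open>1\<close>, so that products of them can be compared.\<close>
  let ?a = "\<lambda>k. a k / (1 + \<eta>)"
  have ga: "(\<Sum>k\<le>n. ?a k * y ^ k) = g y / (1 + \<eta>)" for y
    unfolding gn by (simp add: sum_divide_distrib)
  have close: "\<bar>of_bool (y \<in> Y0) - g y\<bar> < \<eta>" if "y \<in> L" "y \<in> {-R..R}" for y
    using g(2)[OF that(2)] \<phi>[OF that(1)] by simp
  show ?thesis
  proof (rule that[of ?a n])
    fix y assume y: "y \<in> L" "y \<in> {-R..R}"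
    have le: "\<bar>g y\<bar> \<le> 1 + \<eta>" using close[OF y] by (cases "y \<in> Y0") auto
    show "\<bar>\<Sum>k\<le>n. ?a k * y ^ k\<bar> \<le> 1" unfolding ga using le assms(4) by (simp add: abs_divide)
    have "g y / (1 + \<eta>) - g y = - (\<eta> * (g y / (1 + \<eta>)))" using assms(4) by (simp add: field_simps)
    hence "\<bar>g y / (1 + \<eta>) - g y\<bar> = \<eta> * \<bar>g y / (1 + \<eta>)\<bar>" using assms(4) by (simp add: abs_mult)
    also have "\<dots> \<le> \<eta> * 1" using le assms(4) by (intro mult_left_mono) auto
    finally show "\<bar>(\<Sum>k\<le>n. ?a k * y ^ k) - of_bool (y \<in> Y0)\<bar> \<le> 2 * \<eta>"
      unfolding ga using close[OF y] by linarith
  qed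
qed

text \<open>The product over \<open>Y\<close> of the indicator function of \<open>Y0\<close> tests whether \<open>Y\<close> equals
  \<open>Y0\<close>. It is replaced by the product of an approximating polynomial.\<close>

lemma indicator_schur_approx:
  assumes "Y0 \<in> cfg K" "1 \<le> K" "0 < \<epsilon>"
  obtains I :: "(nat \<Rightarrow> nat) set" and c \<nu> where "finite I" "\<And>\<alpha>. \<alpha> \<in> I \<Longrightarrow> \<nu> \<alpha> \<in> partitions_le K"
    "\<And>Y. Y \<in> cfg K \<Longrightarrow> Y \<subseteq> {-R..R} \<Longrightarrow>
      \<bar>of_bool (Y = Y0) - (\<Sum>\<alpha>\<in>I. c \<alpha> * schur_poly_norm q (\<nu> \<alpha>) K Y)\<bar> \<le> \<epsilon>"
proof -
  note Y0 = cfgD[OF assms(1)]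
  define \<eta> where "\<eta> = \<epsilon> / (2 * real K)"
  have \<eta>: "0 < \<eta>" "real K * (2 * \<eta>) = \<epsilon>" using assms by (auto simp: \<eta>_def)
  have ne: "Y0 \<noteq> {}" using Y0 assms(2) by auto
  obtain a :: "nat \<Rightarrow> real" and n where
    a: "\<And>y. y \<in> L \<Longrightarrow> y \<in> {-R..R} \<Longrightarrow> \<bar>(\<Sum>k\<le>n. a k * y ^ k)\<bar> \<le> 1"
    "\<And>y. y \<in> L \<Longrightarrow> y \<in> {-R..R} \<Longrightarrow> \<bar>(\<Sum>k\<le>n. a k * y ^ k) - of_bool (y \<in> Y0)\<bar> \<le> 2 * \<eta>"
    by (rule indicator_polynomial[OF Y0(2) ne Y0(1) \<eta>(1), where R = R]) (rule that)
  obtain I :: "(nat \<Rightarrow> nat) set" and c \<nu> where I: "finite I" "\<And>\<alpha>. \<alpha> \<in> I \<Longrightarrow> \<nu> \<alpha> \<in> partitions_le K"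
    and eq: "\<And>Y. Y \<in> cfg K \<Longrightarrow> (\<Prod>y\<in>Y. \<Sum>k\<le>n. a k * y ^ k) = (\<Sum>\<alpha>\<in>I. c \<alpha> * schur_poly_norm q (\<nu> \<alpha>) K Y)"
    by (rule prod_eq_schur_combination[where K = K and n = n and a = a]) (rule that)
  show ?thesis
  proof (rule that[OF I])
    fix Y assume Y: "Y \<in> cfg K" "Y \<subseteq> {-R..R}"
    note Yp = cfgD[OF Y(1)]
    have "(\<Prod>y\<in>Y. of_bool (y \<in> Y0)) = (of_bool (Y \<subseteq> Y0) :: real)"
      using Yp(2) by (induction Y) auto
    \<comment> \<open>Both configurations have \<open>K\<close> points.\<close>
    also have "Y \<subseteq> Y0 \<longleftrightarrow> Y = Y0" using card_subset_eq[OF Y0(2), of Y] Yp Y0 by auto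
    finally have ind: "of_bool (Y = Y0) = (\<Prod>y\<in>Y. of_bool (y \<in> Y0) :: real)" by simp
    have "norm ((\<Prod>y\<in>Y. \<Sum>k\<le>n. a k * y ^ k) - (\<Prod>y\<in>Y. of_bool (y \<in> Y0))) \<le>
        (\<Sum>y\<in>Y. norm ((\<Sum>k\<le>n. a k * y ^ k) - of_bool (y \<in> Y0)))"
    proof (rule norm_prod_diff)
      fix y assume "y \<in> Y"
      thus "norm (\<Sum>k\<le>n. a k * y ^ k) \<le> 1"
        unfolding real_norm_def by (intro a(1)) (use Y(2) Yp(1) in blast)+
    qed simp
    also have "\<dots> \<le> (\<Sum>y\<in>Y. 2 * \<eta>)"
    proof (rule sum_mono)
      fix y assume "y \<in> Y"
      thus "norm ((\<Sum>k\<le>n. a k * y ^ k) - of_bool (y \<in> Y0)) \<le> 2 * \<eta>"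
        unfolding real_norm_def by (intro a(2)) (use Y(2) Yp(1) in blast)+
    qed
    also have "\<dots> = \<epsilon>" using Yp \<eta>(2) by simp
    finally show "\<bar>of_bool (Y = Y0) - (\<Sum>\<alpha>\<in>I. c \<alpha> * schur_poly_norm q (\<nu> \<alpha>) K Y)\<bar> \<le> \<epsilon>"
      unfolding ind eq[OF Y(1)] by (simp add: abs_minus_commute)
  qed
qed

section \<open>The moment problem\<close>

text \<open>The moments \<open>m\<close> are a separate argument, so that the laws along a sequence can be compared through
  them.\<close>

definition schur_law :: "nat \<Rightarrow> real \<Rightarrow> (real set \<Rightarrow> real) \<Rightarrow> ((nat \<Rightarrow> nat) \<Rightarrow> real) \<Rightarrow> bool" where
  "schur_law K R w m \<longleftrightarrow> (\<forall>Z. 0 \<le> w Z) \<and> (w has_sum 1) (cfg K) \<and> (\<forall>Z\<in>cfg K. w Z \<noteq> 0 \<longrightarrow> Z \<subseteq> {-R..R}) \<and>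
     (\<forall>\<nu>\<in>partitions_le K. ((\<lambda>Z. w Z * schur_poly_norm q \<nu> K Z) has_sum m \<nu>) (cfg K))"

text \<open>The coefficients depend on \<open>Y0\<close>, \<open>R\<close> and \<open>\<epsilon>\<close>, but not on the law. Two laws with close moments therefore
  have close weights.\<close>

lemma schur_law_approx:
  assumes "Y0 \<in> cfg K" "1 \<le> K" "0 < \<epsilon>"
  obtains I :: "(nat \<Rightarrow> nat) set" and c \<nu> where "finite I" "\<And>\<alpha>. \<alpha> \<in> I \<Longrightarrow> \<nu> \<alpha> \<in> partitions_le K"
    "\<And>w m. schur_law K R w m \<Longrightarrow> \<bar>w Y0 - (\<Sum>\<alpha>\<in>I. c \<alpha> * m (\<nu> \<alpha>))\<bar> \<le> \<epsilon>"
proof -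
  obtain I :: "(nat \<Rightarrow> nat) set" and c \<nu> where I: "finite I" "\<And>\<alpha>. \<alpha> \<in> I \<Longrightarrow> \<nu> \<alpha> \<in> partitions_le K"
    and approx: "\<And>Y. Y \<in> cfg K \<Longrightarrow> Y \<subseteq> {-R..R} \<Longrightarrow>
      \<bar>of_bool (Y = Y0) - (\<Sum>\<alpha>\<in>I. c \<alpha> * schur_poly_norm q (\<nu> \<alpha>) K Y)\<bar> \<le> \<epsilon>"
    by (rule indicator_schur_approx[OF assms, where R = R]) (rule that)
  show ?thesis
  proof (rule that[OF I])
    fix w m assume law: "schur_law K R w m"
    have w0: "0 \<le> w Z" for Z using law by (simp add: schur_law_def)
    let ?d = "\<lambda>Y. w Y * (of_bool (Y = Y0) - (\<Sum>\<alpha>\<in>I. c \<alpha> * schur_poly_norm q (\<nu> \<alpha>) K Y))"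
    have 1: "((\<lambda>Y. w Y * of_bool (Y = Y0)) has_sum w Y0) (cfg K)"
    proof -
      have "((\<lambda>Y. w Y * of_bool (Y = Y0)) has_sum w Y0) {Y0}"
        using has_sum_finite[of "{Y0}" "\<lambda>Y. w Y * of_bool (Y = Y0)"] by simp
      thus ?thesis by (rule has_sum_cong_neutral[THEN iffD1, rotated -1]) (use assms(1) in auto)
    qed
    have 2: "((\<lambda>Y. \<Sum>\<alpha>\<in>I. c \<alpha> * (w Y * schur_poly_norm q (\<nu> \<alpha>) K Y)) has_sum (\<Sum>\<alpha>\<in>I. c \<alpha> * m (\<nu> \<alpha>))) (cfg K)"
      using law I by (intro has_sum_finite_sum has_sum_cmult_right) (auto simp: schur_law_def)
    have "((\<lambda>Y. w Y * of_bool (Y = Y0) + - (\<Sum>\<alpha>\<in>I. c \<alpha> * (w Y * schur_poly_norm q (\<nu> \<alpha>) K Y)))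
        has_sum (w Y0 + - (\<Sum>\<alpha>\<in>I. c \<alpha> * m (\<nu> \<alpha>)))) (cfg K)"
      by (intro has_sum_add 1 has_sum_uminusI 2)
    hence d: "(?d has_sum (w Y0 - (\<Sum>\<alpha>\<in>I. c \<alpha> * m (\<nu> \<alpha>)))) (cfg K)"
      by (simp add: algebra_simps sum_distrib_left sum_negf)
    have s: "((\<lambda>Y. w Y * \<epsilon>) has_sum (1 * \<epsilon>)) (cfg K)"
      using law by (intro has_sum_cmult_left) (simp add: schur_law_def)
    have le: "\<bar>?d Y\<bar> \<le> w Y * \<epsilon>" if "Y \<in> cfg K" for Y
    proof (cases "w Y = 0")
      case False
      hence "Y \<subseteq> {-R..R}" using law that by (simp add: schur_law_def)
      thus ?thesis unfolding abs_mult using approx[OF that] w0[of Y] by (intro mult_mono) auto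
    qed simp
    have "w Y0 - (\<Sum>\<alpha>\<in>I. c \<alpha> * m (\<nu> \<alpha>)) \<le> 1 * \<epsilon>"
      by (rule has_sum_mono[OF d s]) (use le in \<open>auto simp: abs_le_iff\<close>)
    moreover have "- (w Y0 - (\<Sum>\<alpha>\<in>I. c \<alpha> * m (\<nu> \<alpha>))) \<le> 1 * \<epsilon>"
      by (rule has_sum_mono[OF has_sum_uminusI[OF d] s]) (use le in \<open>auto simp: abs_le_iff\<close>)
    ultimately show "\<bar>w Y0 - (\<Sum>\<alpha>\<in>I. c \<alpha> * m (\<nu> \<alpha>))\<bar> \<le> \<epsilon>" by (simp add: abs_le_iff)
  qed
qed

lemma schur_law_unique:
  assumes "schur_law K R w m" "schur_law K R w' m" "Y \<in> cfg K" "1 \<le> K"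
  shows "w Y = w' Y"
proof (rule ccontr)
  assume "w Y \<noteq> w' Y"
  moreover define e where "e = \<bar>w Y - w' Y\<bar> / 3"
  ultimately have e: "0 < e" by simp
  obtain I :: "(nat \<Rightarrow> nat) set" and c \<nu> where "finite I" "\<And>\<alpha>. \<alpha> \<in> I \<Longrightarrow> \<nu> \<alpha> \<in> partitions_le K" and
    *: "\<And>w m. schur_law K R w m \<Longrightarrow> \<bar>w Y - (\<Sum>\<alpha>\<in>I. c \<alpha> * m (\<nu> \<alpha>))\<bar> \<le> e"
    by (rule schur_law_approx[OF assms(3,4) e, where R = R]) (rule that)
  define S where "S = (\<Sum>\<alpha>\<in>I. c \<alpha> * m (\<nu> \<alpha>))"
  have "\<bar>w Y - S\<bar> \<le> e" "\<bar>w' Y - S\<bar> \<le> e" unfolding S_def by (intro * assms)+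
  moreover have "3 * e = \<bar>w Y - w' Y\<bar>" by (simp add: e_def)
  ultimately show False using e by linarith
qed

lemma schur_law_pointwise_convergent:
  assumes "\<And>n. schur_law K R (w n) (m n)" "\<And>\<nu>. \<nu> \<in> partitions_le K \<Longrightarrow> convergent (\<lambda>n. m n \<nu>)"
    and "Y \<in> cfg K" "1 \<le> K"
  shows "convergent (\<lambda>n. w n Y)"
proof -
  have "Cauchy (\<lambda>n. w n Y)"
  proof (rule metric_CauchyI)
    fix e :: real assume "0 < e"
    hence e: "0 < e / 4" by simp
    obtain I :: "(nat \<Rightarrow> nat) set" and c \<nu> where "finite I" and I: "\<And>\<alpha>. \<alpha> \<in> I \<Longrightarrow> \<nu> \<alpha> \<in> partitions_le K" and
      *: "\<And>w m. schur_law K R w m \<Longrightarrow> \<bar>w Y - (\<Sum>\<alpha>\<in>I. c \<alpha> * m (\<nu> \<alpha>))\<bar> \<le> e / 4"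
      by (rule schur_law_approx[OF assms(3,4) e, where R = R]) (rule that)
    let ?S = "\<lambda>n. \<Sum>\<alpha>\<in>I. c \<alpha> * m n (\<nu> \<alpha>)"
    have "\<forall>\<alpha>\<in>I. \<exists>l. (\<lambda>n. m n (\<nu> \<alpha>)) \<longlonglongrightarrow> l" using assms(2) I by (auto simp: convergent_def)
    then obtain l where l: "\<And>\<alpha>. \<alpha> \<in> I \<Longrightarrow> (\<lambda>n. m n (\<nu> \<alpha>)) \<longlonglongrightarrow> l \<alpha>" by metis
    hence "?S \<longlonglongrightarrow> (\<Sum>\<alpha>\<in>I. c \<alpha> * l \<alpha>)" by (intro tendsto_intros) auto
    hence "Cauchy ?S" by (intro convergent_Cauchy) (auto simp: convergent_def)
    then obtain M where M: "\<And>i j. i \<ge> M \<Longrightarrow> j \<ge> M \<Longrightarrow> dist (?S i) (?S j) < e / 4"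
      using metric_CauchyD e by blast
    show "\<exists>M. \<forall>i\<ge>M. \<forall>j\<ge>M. dist (w i Y) (w j Y) < e"
    proof (intro exI[of _ M] allI impI)
      fix i j assume "M \<le> i" "M \<le> j"
      thus "dist (w i Y) (w j Y) < e"
        using M[of i j] *[OF assms(1), of i] *[OF assms(1), of j] e unfolding dist_real_def by linarith
    qed
  qed
  thus ?thesis by (rule Cauchy_convergent)
qed

end


section \<open>The variational series\<close>

lemma precedes_irrefl: "\<not> precedes x x"
  and precedes_trans: "precedes x y \<Longrightarrow> precedes y z \<Longrightarrow> precedes x z"
  and precedes_total: "x \<noteq> y \<Longrightarrow> precedes x y \<or> precedes y x"
  by (auto simp: precedes_def)

lemma precedes_abs: "precedes x y \<Longrightarrow> \<bar>y\<bar> \<le> \<bar>x\<bar>"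
  by (auto simp: precedes_def)

abbreviation away :: "real \<Rightarrow> real set \<Rightarrow> real set" where
  "away \<delta> X \<equiv> {x \<in> X. \<delta> \<le> \<bar>x\<bar>}"

text \<open>The position in the variational series, counted from \<open>0\<close>.\<close>

definition rank :: "real set \<Rightarrow> real \<Rightarrow> nat" where
  "rank X x = card {x' \<in> X. precedes x' x}"

context qlattice begin

text \<open>The absolute values of the points in a bounded segment have a bounded sum.\<close>

lemma finite_away_from_0:
  assumes "X \<subseteq> L" "X \<subseteq> {-R..R}" "0 < \<delta>"
  shows "finite (away \<delta> X)"
proof (rule finite_if_finite_subsets_card_bdd[THEN conjunct1])
  fix G assume G: "G \<subseteq> away \<delta> X" "finite G"
  have "real (card G) * \<delta> = (\<Sum>x\<in>G. \<delta>)" by simp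
  also have "\<dots> \<le> (\<Sum>x\<in>G. \<bar>x\<bar>)" by (rule sum_mono) (use G in auto)
  also have "\<dots> \<le> 2 * \<bar>R\<bar> / (1 - q)" using G assms by (intro sum_abs_le) auto
  finally have "real (card G) \<le> 2 * \<bar>R\<bar> / (1 - q) / \<delta>"
    unfolding pos_le_divide_eq[OF assms(3)] .
  thus "card G \<le> nat \<lceil>2 * \<bar>R\<bar> / (1 - q) / \<delta>\<rceil>" by linarith
qed

lemma finite_predecessors:
  assumes "X \<subseteq> L" "X \<subseteq> {-R..R}" "x \<in> L"
  shows "finite {x' \<in> X. precedes x' x}"
proof (rule finite_subset)
  show "{x' \<in> X. precedes x' x} \<subseteq> {x' \<in> X. \<bar>x\<bar> \<le> \<bar>x'\<bar>}" by (auto dest: precedes_abs)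
  show "finite {x' \<in> X. \<bar>x\<bar> \<le> \<bar>x'\<bar>}"
    using L_nonzero[OF assms(3)] by (intro finite_away_from_0[OF assms(1,2)]) auto
qed

lemma rank_less:
  assumes "X \<subseteq> L" "X \<subseteq> {-R..R}" "x \<in> X" "y \<in> X" "precedes y x"
  shows "rank X y < rank X x"
  unfolding rank_def
proof (rule psubset_card_mono)
  show "finite {x' \<in> X. precedes x' x}" using finite_predecessors assms by blast
  show "{x' \<in> X. precedes x' y} \<subset> {x' \<in> X. precedes x' x}"
    using assms precedes_trans precedes_irrefl by blast
qed

lemma rank_inj:
  assumes "X \<subseteq> L" "X \<subseteq> {-R..R}"
  shows "inj_on (rank X) X"
proof (rule inj_onI)
  fix x y assume xy: "x \<in> X" "y \<in> X" "rank X x = rank X y"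
  show "x = y"
    using precedes_total[of x y] rank_less[OF assms xy(1,2)] rank_less[OF assms xy(2,1)] xy(3) by auto
qed

text \<open>The predecessors of \<open>x\<close> have distinct ranks below that of \<open>x\<close>, and there are as many of them as such
  ranks.\<close>

lemma rank_downward:
  assumes "X \<subseteq> L" "X \<subseteq> {-R..R}" "x \<in> X" "k < rank X x"
  obtains y where "y \<in> X" "rank X y = k"
proof -
  let ?P = "{x' \<in> X. precedes x' x}"
  have "rank X ` ?P \<subseteq> {..<rank X x}" using rank_less[OF assms(1-3)] by auto
  moreover have "card (rank X ` ?P) = card {..<rank X x}"
    using card_image[OF inj_on_subset[OF rank_inj[OF assms(1,2)]], of ?P] by (auto simp: rank_def)
  ultimately have "rank X ` ?P = {..<rank X x}" by (intro card_subset_eq) auto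
  thus ?thesis using assms(4) that by (metis (no_types, lifting) imageE lessThan_iff mem_Collect_eq)
qed

lemma rank_attained:
  assumes "X \<subseteq> L" "X \<subseteq> {-R..R}" "finite X \<Longrightarrow> k < card X"
  obtains x where "x \<in> X" "rank X x = k"
proof -
  have "\<exists>x\<in>X. k \<le> rank X x"
  proof (rule ccontr)
    assume "\<not> (\<exists>x\<in>X. k \<le> rank X x)"
    hence sub: "rank X ` X \<subseteq> {..<k}" by auto
    have fin: "finite X" using rank_inj[OF assms(1,2)] sub by (meson finite_imageD finite_lessThan finite_subset)
    have "card X \<le> k" using card_mono[OF _ sub] card_image[OF rank_inj[OF assms(1,2)]] by simp
    thus False using assms(3)[OF fin] by simp
  qed
  then obtain x where "x \<in> X" "k \<le> rank X x" by blast
  thus ?thesis using rank_downward[OF assms(1,2), of x k] that by (cases "k = rank X x") auto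
qed

lemma var_series_rank:
  assumes "X \<subseteq> L" "X \<subseteq> {-R..R}" "x \<in> X"
  shows "var_series X (rank X x) = x"
proof -
  have "(THE y. y \<in> X \<and> card {x' \<in> X. precedes x' y} = rank X x) = x"
    using assms(3) inj_onD[OF rank_inj[OF assms(1,2)]]
    by (intro the_equality) (auto simp: rank_def)
  thus ?thesis using assms(3) unfolding var_series_def by (auto simp: rank_def)
qed

lemma var_series_mem:
  assumes "X \<subseteq> L" "X \<subseteq> {-R..R}" "finite X \<Longrightarrow> k < card X"
  shows "var_series X k \<in> X" "rank X (var_series X k) = k"
proof -
  obtain x where "x \<in> X" "rank X x = k" using rank_attained[OF assms] by blast
  thus "var_series X k \<in> X" "rank X (var_series X k) = k"
    using var_series_rank[OF assms(1,2), of x] by auto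
qed

lemma var_series_inj:
  assumes "X \<subseteq> L" "X \<subseteq> {-R..R}" "infinite X"
  shows "inj (var_series X)"
  using var_series_mem[OF assms(1,2)] assms(3) by (metis injI)

lemma abs_rank_mono:
  assumes "X \<subseteq> L" "X \<subseteq> {-R..R}" "x \<in> X" "y \<in> X" "rank X x \<le> rank X y"
  shows "\<bar>y\<bar> \<le> \<bar>x\<bar>"
  using precedes_total[of x y] rank_less[OF assms(1-4)] assms(5) precedes_abs by fastforce

text \<open>A form of stabilization that does not refer to an enumeration: outside any neighbourhood of \<open>0\<close> the
  configuration is eventually constant.\<close>

definition tail_conv :: "(nat \<Rightarrow> real set) \<Rightarrow> real set \<Rightarrow> bool" where
  "tail_conv A X \<longleftrightarrow> (\<forall>\<delta>>0. \<forall>\<^sub>F N in sequentially. away \<delta> (A N) = away \<delta> X)"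

lemma away_from_0_initial:
  assumes "X \<subseteq> L" "X \<subseteq> {-R..R}" "infinite X" "0 < \<delta>"
  obtains n where "away \<delta> X = var_series X ` {..<n}" "\<bar>var_series X n\<bar> < \<delta>"
proof -
  note vs = var_series_mem[OF assms(1,2)] and vr = var_series_rank[OF assms(1,2)]
  let ?F = "away \<delta> X"
  have fin: "finite ?F" by (rule finite_away_from_0[OF assms(1,2,4)])
  have "\<exists>k. \<bar>var_series X k\<bar> < \<delta>"
  proof (rule ccontr)
    assume "\<nexists>k. \<bar>var_series X k\<bar> < \<delta>"
    hence "range (var_series X) \<subseteq> ?F" using vs(1) assms(3) by (auto simp: not_less)
    thus False using fin var_series_inj[OF assms(1-3)] by (meson finite_imageD finite_subset infinite_UNIV_nat)
  qed
  define n where "n = (LEAST k. \<bar>var_series X k\<bar> < \<delta>)"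
  have n: "\<bar>var_series X n\<bar> < \<delta>" unfolding n_def by (rule LeastI_ex) fact
  have "?F = var_series X ` {..<n}"
  proof (intro equalityI subsetI)
    fix x assume x: "x \<in> ?F"
    have "rank X x < n"
    proof (rule ccontr)
      assume "\<not> rank X x < n"
      hence "\<bar>x\<bar> \<le> \<bar>var_series X n\<bar>"
        using abs_rank_mono[OF assms(1,2), of "var_series X n" x] vs[of n] assms(3) x by auto
      thus False using x n by simp
    qed
    thus "x \<in> var_series X ` {..<n}" using vr[of x] x by force
  next
    fix x assume "x \<in> var_series X ` {..<n}"
    then obtain k where k: "k < n" "x = var_series X k" by auto
    have "\<not> \<bar>var_series X k\<bar> < \<delta>" using k(1) unfolding n_def by (rule not_less_Least)
    thus "x \<in> ?F" using k vs(1)[of k] assms(3) by simp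
  qed
  thus ?thesis using n by (rule that)
qed

lemma finite_subset_window:
  assumes "finite A" obtains R where "A \<subseteq> {-R..R::real}"
proof (rule that[of "\<Sum>x\<in>A. \<bar>x\<bar>"], rule subsetI)
  fix x assume "x \<in> A"
  hence "\<bar>x\<bar> \<le> (\<Sum>x\<in>A. \<bar>x\<bar>)" using assms by (intro member_le_sum) auto
  thus "x \<in> {-(\<Sum>x\<in>A. \<bar>x\<bar>)..\<Sum>x\<in>A. \<bar>x\<bar>}" by (auto simp: abs_le_iff)
qed

lemma stabilizes_tail_conv:
  assumes X: "X \<subseteq> L" "X \<subseteq> {-R..R}" "infinite X" and st: "stabilizes q zm zp A X"
  shows "tail_conv A X"
  unfolding tail_conv_def
proof (intro allI impI)
  fix \<delta> :: real assume \<delta>: "0 < \<delta>"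
  obtain n where n: "away \<delta> X = var_series X ` {..<n}" "\<bar>var_series X n\<bar> < \<delta>"
    using away_from_0_initial[OF X \<delta>] by blast
  have "\<forall>\<^sub>F N in sequentially. \<forall>k\<in>{..n}. var_series (A N) k = var_series X k"
    using st by (intro eventually_ball_finite) (auto simp: stabilizes_def)
  thus "\<forall>\<^sub>F N in sequentially. away \<delta> (A N) = away \<delta> X"
    using eventually_gt_at_top[of n]
  proof eventually_elim
    case (elim N)
    have AN: "A N \<in> cfg N" using st elim(2) by (auto simp: stabilizes_def)
    note A = cfgD[OF AN]
    obtain R' where R': "A N \<subseteq> {-R'..R'}" using finite_subset_window[OF A(2)] by blast
    note vs = var_series_mem[OF A(1) R'] and vr = var_series_rank[OF A(1) R']
    have eq: "var_series (A N) k = var_series X k" if "k \<le> n" for k using elim(1) that by simp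
    have "away \<delta> (A N) = var_series X ` {..<n}"
    proof (intro equalityI subsetI)
      fix x assume x: "x \<in> away \<delta> (A N)"
      have "rank (A N) x < n"
      proof (rule ccontr)
        assume "\<not> rank (A N) x < n"
        hence "\<bar>x\<bar> \<le> \<bar>var_series (A N) n\<bar>"
          using abs_rank_mono[OF A(1) R', of "var_series (A N) n" x] vs[of n] elim(2) A(3) x by auto
        thus False using x n(2) eq[of n] by simp
      qed
      thus "x \<in> var_series X ` {..<n}" using vr[of x] x eq[of "rank (A N) x"] by force
    next
      fix x assume x: "x \<in> var_series X ` {..<n}"
      then obtain k where k: "k < n" "x = var_series X k" by auto
      have "x \<in> A N" using vs(1)[of k] k eq[of k] elim(2) A(3) by simp
      moreover have "\<delta> \<le> \<bar>x\<bar>" using x unfolding n(1)[symmetric] by simp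
      ultimately show "x \<in> away \<delta> (A N)" by simp
    qed
    thus ?case unfolding n(1) .
  qed
qed

lemma truncations_tail_conv:
  assumes X: "X \<subseteq> L" "X \<subseteq> {-R..R}" "infinite X"
  shows "tail_conv (\<lambda>N. var_series X ` {..<N}) X"
  unfolding tail_conv_def
proof (intro allI impI)
  fix \<delta> :: real assume \<delta>: "0 < \<delta>"
  obtain n where n: "away \<delta> X = var_series X ` {..<n}" "\<bar>var_series X n\<bar> < \<delta>"
    using away_from_0_initial[OF X \<delta>] by blast
  show "\<forall>\<^sub>F N in sequentially. away \<delta> (var_series X ` {..<N}) = away \<delta> X"
    using eventually_ge_at_top[of n]
  proof eventually_elim
    case (elim N)
    have "var_series X ` {..<N} \<subseteq> X" using var_series_mem(1)[OF X(1,2)] X(3) by blast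
    hence "away \<delta> (var_series X ` {..<N}) \<subseteq> away \<delta> X" by blast
    moreover have "away \<delta> X \<subseteq> var_series X ` {..<N}" unfolding n(1) using elim by auto
    ultimately show ?case by blast
  qed
qed

text \<open>Stabilizing sequences exist. Without them the condition that defines the limit measure would
  hold for every measure.\<close>

lemma truncations_stabilize:
  assumes X: "X \<subseteq> L" "X \<subseteq> {-R..R}" "infinite X"
  shows "stabilizes q zm zp (\<lambda>N. var_series X ` {..<N}) X"
  unfolding stabilizes_def
proof (intro conjI allI impI)
  note vs = var_series_mem[OF X(1,2)] and inj = var_series_inj[OF X]
  let ?A = "\<lambda>N. var_series X ` {..<N}"
  have sub: "?A N \<subseteq> X" for N using vs(1) X(3) by blast
  show "?A N \<in> cfg N" for N
    using sub[of N] X(1) inj by (auto simp: configs_def card_image inj_on_subset[OF inj])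
  fix k
  show "\<forall>\<^sub>F N in sequentially. var_series (?A N) k = var_series X k"
    using eventually_gt_at_top[of k]
  proof eventually_elim
    case (elim N)
    let ?x = "var_series X k"
    have "{x' \<in> ?A N. precedes x' ?x} = {x' \<in> X. precedes x' ?x}"
    proof (intro equalityI subsetI)
      fix x' assume x': "x' \<in> {x' \<in> X. precedes x' ?x}"
      hence "rank X x' < rank X ?x" using vs(1)[of k] X(3) by (intro rank_less[OF X(1,2)]) auto
      hence "rank X x' < N" using vs(2)[of k] X(3) elim by simp
      thus "x' \<in> {x' \<in> ?A N. precedes x' ?x}" using x' var_series_rank[OF X(1,2), of x'] by force
    qed (use sub in blast)
    hence "rank (?A N) ?x = k" using vs(2)[of k] X(3) by (simp add: rank_def)
    moreover have "?A N \<subseteq> L" "?A N \<subseteq> {-R..R}" using sub[of N] X by auto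
    moreover have "?x \<in> ?A N" using elim by simp
    ultimately show ?case using var_series_rank[of "?A N" R ?x] by simp
  qed
qed

section \<open>Convergence of the normalized Schur polynomials\<close>

lemma tail_conv_window:
  assumes "tail_conv A X" "X \<subseteq> {-R..R}"
  shows "\<forall>\<^sub>F N in sequentially. A N \<subseteq> {-(\<bar>R\<bar> + 1)..\<bar>R\<bar> + 1}"
proof -
  have "\<forall>\<^sub>F N in sequentially. {x \<in> A N. \<bar>R\<bar> + 1 \<le> \<bar>x\<bar>} = {x \<in> X. \<bar>R\<bar> + 1 \<le> \<bar>x\<bar>}"
    using assms(1) unfolding tail_conv_def by (auto simp: add_nonneg_pos)
  thus ?thesis
  proof eventually_elim
    case (elim N)
    have "{x \<in> X. \<bar>R\<bar> + 1 \<le> \<bar>x\<bar>} = {}" using assms(2) by force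
    hence no: "\<not> \<bar>R\<bar> + 1 \<le> \<bar>x\<bar>" if "x \<in> A N" for x using elim that by blast
    show ?case
    proof
      fix x assume "x \<in> A N"
      from no[OF this] show "x \<in> {-(\<bar>R\<bar> + 1)..\<bar>R\<bar> + 1}" by auto
    qed
  qed
qed

lemma ecoeff_truncation:
  assumes "finite A" "A \<subseteq> L" "A \<subseteq> {-R..R}" "0 < \<delta>"
  shows "\<bar>ecoeff A j - ecoeff (away \<delta> A) j\<bar> \<le> exp (2 * \<bar>R\<bar> / (1 - q)) * (2 / (1 - q)) * \<delta>"
proof -
  let ?B = "away \<delta> A"
  have "\<bar>ecoeff A j - ecoeff ?B j\<bar> \<le> exp (\<Sum>x\<in>A. \<bar>x\<bar>) * (\<Sum>x\<in>A - ?B. \<bar>x\<bar>)"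
    using assms(1) by (intro abs_ecoeff_diff_le) auto
  also have "\<dots> \<le> exp (2 * \<bar>R\<bar> / (1 - q)) * (2 * \<bar>\<delta>\<bar> / (1 - q))"
  proof (rule mult_mono)
    show "exp (\<Sum>x\<in>A. \<bar>x\<bar>) \<le> exp (2 * \<bar>R\<bar> / (1 - q))" using sum_abs_le[OF assms(1-3)] by simp
    show "(\<Sum>x\<in>A - ?B. \<bar>x\<bar>) \<le> 2 * \<bar>\<delta>\<bar> / (1 - q)" using assms by (intro sum_abs_le) auto
  qed (auto intro: sum_nonneg)
  finally show ?thesis using assms(4) by simp
qed

text \<open>The number \<open>c\<close> is the value at the finite set of points of \<open>X\<close> outside a neighbourhood of \<open>0\<close>.\<close>

lemma ecoeff_tail_conv_diff:
  assumes X: "X \<subseteq> {-R..R}" and A: "tail_conv A X" "\<forall>\<^sub>F N in sequentially. finite (A N) \<and> A N \<subseteq> L" and e: "0 < e"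
  obtains c where "\<forall>\<^sub>F N in sequentially. \<bar>ecoeff (A N) j - c\<bar> < e"
    "\<And>B. tail_conv B X \<Longrightarrow> \<forall>\<^sub>F N in sequentially. finite (B N) \<and> B N \<subseteq> L \<Longrightarrow>
      \<forall>\<^sub>F N in sequentially. \<bar>ecoeff (B N) j - c\<bar> < e"
proof -
  let ?R = "\<bar>R\<bar> + 1"
  let ?C = "exp (2 * \<bar>?R\<bar> / (1 - q)) * (2 / (1 - q))"
  have C: "0 < ?C" using q_less_1 by simp
  define C where "C = ?C"
  define \<delta> where "\<delta> = e / 2 / C"
  have "0 < \<delta>" "C * \<delta> < e" using C[folded C_def] e by (auto simp: \<delta>_def)
  hence \<delta>: "0 < \<delta>" "?C * \<delta> < e" by (simp_all only: C_def)
  have "\<forall>\<^sub>F N in sequentially. \<bar>ecoeff (B N) j - ecoeff (away \<delta> X) j\<bar> < e"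
    if B: "tail_conv B X" "\<forall>\<^sub>F N in sequentially. finite (B N) \<and> B N \<subseteq> L" for B
  proof -
    have "\<forall>\<^sub>F N in sequentially. away \<delta> (B N) = away \<delta> X"
      using B(1) \<delta>(1) by (simp add: tail_conv_def)
    with tail_conv_window[OF B(1) X] B(2) show ?thesis
    proof eventually_elim
      case (elim N)
      show ?case using ecoeff_truncation[of "B N" ?R \<delta> j] elim \<delta> by simp
    qed
  qed
  thus ?thesis using that A by blast
qed

text \<open>Sequences with the same limit configuration agree outside any neighbourhood of \<open>0\<close>, and points
  near \<open>0\<close> contribute little. So the limit exists and is common to all of them.\<close>

lemma ecoeff_tail_conv:
  assumes X: "X \<subseteq> {-R..R}" and A: "tail_conv A X" "\<forall>\<^sub>F N in sequentially. finite (A N) \<and> A N \<subseteq> L"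
  obtains e where "\<And>j. (\<lambda>N. ecoeff (A N) j) \<longlonglongrightarrow> e j"
    "\<And>B j. tail_conv B X \<Longrightarrow> \<forall>\<^sub>F N in sequentially. finite (B N) \<and> B N \<subseteq> L \<Longrightarrow>
      (\<lambda>N. ecoeff (B N) j) \<longlonglongrightarrow> e j"
proof -
  have "Cauchy (\<lambda>N. ecoeff (A N) j)" for j
  proof (rule metric_CauchyI)
    fix \<epsilon> :: real assume "0 < \<epsilon>"
    hence "0 < \<epsilon> / 2" by simp
    then obtain c where "\<forall>\<^sub>F N in sequentially. \<bar>ecoeff (A N) j - c\<bar> < \<epsilon> / 2"
      using ecoeff_tail_conv_diff[OF assms, of "\<epsilon> / 2" j] by blast
    then obtain M where M: "\<And>N. M \<le> N \<Longrightarrow> \<bar>ecoeff (A N) j - c\<bar> < \<epsilon> / 2" by (auto simp: eventually_at_top_linorder)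
    show "\<exists>M. \<forall>m\<ge>M. \<forall>n\<ge>M. dist (ecoeff (A m) j) (ecoeff (A n) j) < \<epsilon>"
    proof (intro exI[of _ M] allI impI)
      fix m n assume "M \<le> m" "M \<le> n"
      from M[OF this(1)] M[OF this(2)] show "dist (ecoeff (A m) j) (ecoeff (A n) j) < \<epsilon>"
        unfolding dist_real_def by linarith
    qed
  qed
  hence "\<forall>j. \<exists>l. (\<lambda>N. ecoeff (A N) j) \<longlonglongrightarrow> l" using Cauchy_convergent convergent_def by blast
  then obtain e where e: "\<And>j. (\<lambda>N. ecoeff (A N) j) \<longlonglongrightarrow> e j" by metis
  moreover have "(\<lambda>N. ecoeff (B N) j) \<longlonglongrightarrow> e j"
    if B: "tail_conv B X" "\<forall>\<^sub>F N in sequentially. finite (B N) \<and> B N \<subseteq> L" for B j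
  proof (rule tendstoI)
    fix \<epsilon> :: real assume "0 < \<epsilon>"
    hence p: "0 < \<epsilon> / 3" by simp
    obtain c where c1: "\<forall>\<^sub>F N in sequentially. \<bar>ecoeff (A N) j - c\<bar> < \<epsilon> / 3" and
      c2: "\<And>B. tail_conv B X \<Longrightarrow> \<forall>\<^sub>F N in sequentially. finite (B N) \<and> B N \<subseteq> L \<Longrightarrow>
        \<forall>\<^sub>F N in sequentially. \<bar>ecoeff (B N) j - c\<bar> < \<epsilon> / 3"
      by (rule ecoeff_tail_conv_diff[OF assms p, where j = j]) (rule that)
    note c1 c2[OF B]
    moreover have "\<forall>\<^sub>F N in sequentially. dist (ecoeff (A N) j) (e j) < \<epsilon> / 3" by (rule tendstoD[OF e p])
    ultimately show "\<forall>\<^sub>F N in sequentially. dist (ecoeff (B N) j) (e j) < \<epsilon>"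
      by eventually_elim (unfold dist_real_def, linarith)
  qed
  ultimately show ?thesis by (rule that)
qed

lemma schur_qpow_convergent:
  assumes "\<nu> \<in> partitions_le K"
  shows "(\<lambda>N. schur_poly \<nu> N (\<lambda>i. q ^ i)) \<longlonglongrightarrow> schur_fun \<nu> (\<lambda>i. q ^ i)" "0 < schur_fun \<nu> (\<lambda>i. q ^ i)"
proof -
  \<comment> \<open>The powers of \<open>q\<close> belong to the lattice with \<open>\<zeta>\<^sub>+ = 1\<close>.\<close>
  interpret Q: qlattice q "-1" 1 by unfold_locales (use q_pos q_less_1 in auto)
  let ?A = "\<lambda>N. (\<lambda>i::nat. q ^ i) ` {..<N}" let ?X = "range (\<lambda>i::nat. q ^ i)"
  have sub: "?X \<subseteq> {-1..1}"
  proof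
    fix x assume "x \<in> ?X"
    then obtain i :: nat where "x = q ^ i" by auto
    thus "x \<in> {-1..1}" using q_pos q_less_1 by (auto simp: power_le_one intro: order_trans[of _ 0])
  qed
  have subL: "?A N \<subseteq> qlat q (-1) 1" for N
  proof
    fix x assume "x \<in> ?A N"
    then obtain i :: nat where "x = 1 * q powi (int i)" by auto
    thus "x \<in> qlat q (-1) 1" unfolding qlat_def by blast
  qed
  have inj: "inj (\<lambda>i::nat. q ^ i)"
    using q_pos q_less_1 by (auto intro!: injI dest: power_inject_exp'[THEN iffD1, rotated -1])
  have tc: "Q.tail_conv ?A ?X"
    unfolding Q.tail_conv_def
  proof (intro allI impI)
    fix \<delta> :: real assume "0 < \<delta>"
    have "(\<lambda>i. q ^ i) \<longlonglongrightarrow> 0" using q_pos q_less_1 by (intro LIMSEQ_power_zero) auto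
    hence "\<forall>\<^sub>F i in sequentially. q ^ i < \<delta>" using \<open>0 < \<delta>\<close> by (rule order_tendstoD)
    then obtain n where n: "\<And>i. n \<le> i \<Longrightarrow> q ^ i < \<delta>" by (auto simp: eventually_at_top_linorder)
    show "\<forall>\<^sub>F N in sequentially. {x \<in> ?A N. \<delta> \<le> \<bar>x\<bar>} = {x \<in> ?X. \<delta> \<le> \<bar>x\<bar>}"
      using eventually_ge_at_top[of n]
    proof eventually_elim
      case (elim N)
      have "x \<in> ?A N" if x: "x \<in> ?X" "\<delta> \<le> \<bar>x\<bar>" for x
      proof -
        obtain i :: nat where i: "x = q ^ i" using x(1) by blast
        have "\<delta> \<le> q ^ i" using x(2) q_pos by (simp add: i)
        hence "\<not> n \<le> i" using n[of i] by linarith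
        thus ?thesis using elim by (simp add: i)
      qed
      thus ?case by blast
    qed
  qed
  have "\<forall>\<^sub>F N in sequentially. finite (?A N) \<and> ?A N \<subseteq> qlat q (-1) 1" using subL by simp
  then obtain e where e: "\<And>j. (\<lambda>N. ecoeff (?A N) j) \<longlonglongrightarrow> e j"
    by (rule Q.ecoeff_tail_conv[OF sub tc]) (rule that)
  have "(\<lambda>N. schur_poly \<nu> N (\<lambda>i. q ^ i)) \<longlonglongrightarrow> fdet K (schur_entry e \<nu>)"
    by (rule schur_poly_convergent[OF assms _ e]) (rule inj_on_subset[OF inj], simp)
  thus lim: "(\<lambda>N. schur_poly \<nu> N (\<lambda>i. q ^ i)) \<longlonglongrightarrow> schur_fun \<nu> (\<lambda>i. q ^ i)"
    by (simp add: schur_fun_def limI)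
  have "schur_poly \<nu> K (\<lambda>i. q ^ i) \<le> schur_fun \<nu> (\<lambda>i. q ^ i)"
    by (rule tendsto_lowerbound[OF lim])
       (auto intro!: eventually_mono[OF eventually_ge_at_top[of K]] schur_qpow_mono[OF q_pos q_less_1 assms])
  thus "0 < schur_fun \<nu> (\<lambda>i. q ^ i)"
    using schur_qpow_pos[OF q_pos q_less_1 assms, of K] by linarith
qed

theorem schur_norm_stabilizes:
  assumes X: "X \<subseteq> L" "X \<subseteq> {-R..R}" "infinite X" and st: "stabilizes q zm zp A X" and \<nu>: "\<nu> \<in> partitions_le K"
  shows "(\<lambda>N. schur_poly_norm q \<nu> N (A N)) \<longlonglongrightarrow> schur_fun_norm q \<nu> X"
proof -
  let ?T = "\<lambda>N. var_series X ` {..<N}"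
  have Acfg: "A N \<in> cfg N" if "1 \<le> N" for N using st that by (simp add: stabilizes_def)
  have A: "tail_conv A X" "\<forall>\<^sub>F N in sequentially. finite (A N) \<and> A N \<subseteq> L"
  proof -
    show "\<forall>\<^sub>F N in sequentially. finite (A N) \<and> A N \<subseteq> L"
      using eventually_ge_at_top[of 1] by eventually_elim (simp add: cfgD[OF Acfg])
  qed (rule stabilizes_tail_conv[OF X st])
  have "finite (?T N) \<and> ?T N \<subseteq> L" for N using var_series_mem(1)[OF X(1,2)] X(1,3) by auto
  hence T: "tail_conv ?T X" "\<forall>\<^sub>F N in sequentially. finite (?T N) \<and> ?T N \<subseteq> L"
    using truncations_tail_conv[OF X] by auto
  obtain e where e1: "\<And>j. (\<lambda>N. ecoeff (A N) j) \<longlonglongrightarrow> e j" and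
    e2: "\<And>B j. tail_conv B X \<Longrightarrow> \<forall>\<^sub>F N in sequentially. finite (B N) \<and> B N \<subseteq> L \<Longrightarrow>
      (\<lambda>N. ecoeff (B N) j) \<longlonglongrightarrow> e j"
    by (rule ecoeff_tail_conv[OF X(2) A]) (rule that)
  note e = e1 e2[OF T]
  have inj: "inj_on (elt (A N)) {..<N}" for N
    using elt_inj[OF cfgD(2,3)[OF Acfg]] by (cases "N = 0") auto
  have "(\<lambda>N. ecoeff (elt (A N) ` {..<N}) j) \<longlonglongrightarrow> e j" for j
  proof (rule Lim_transform_eventually[OF e(1)])
    show "\<forall>\<^sub>F N in sequentially. ecoeff (A N) j = ecoeff (elt (A N) ` {..<N}) j"
      using eventually_ge_at_top[of 1]
      by eventually_elim (simp only: elt_image[OF cfgD(2,3)[OF Acfg]])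
  qed
  hence 1: "(\<lambda>N. schur_poly \<nu> N (elt (A N))) \<longlonglongrightarrow> fdet K (schur_entry e \<nu>)"
    by (rule schur_poly_convergent[OF \<nu> inj])
  have "(\<lambda>N. schur_poly \<nu> N (var_series X)) \<longlonglongrightarrow> fdet K (schur_entry e \<nu>)"
    by (rule schur_poly_convergent[OF \<nu> _ e(2)]) (rule inj_on_subset[OF var_series_inj[OF X]], simp)
  hence "fdet K (schur_entry e \<nu>) = schur_fun \<nu> (var_series X)" by (simp add: schur_fun_def limI)
  with 1 have "(\<lambda>N. schur_poly \<nu> N (elt (A N))) \<longlonglongrightarrow> schur_fun \<nu> (var_series X)" by simp
  thus ?thesis unfolding schur_poly_norm_def schur_fun_norm_def
    using schur_qpow_convergent[OF \<nu>] by (intro tendsto_divide) auto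
qed

end


section \<open>Weak limits from pointwise limits\<close>

lemma pmf_has_sum:
  assumes "set_pmf M \<subseteq> S"
  shows "(pmf M has_sum 1) S"
proof -
  have abs: "Infinite_Set_Sum.abs_summable_on (pmf M) S" by (rule pmf_abs_summable)
  hence "pmf M summable_on S" by (simp only: abs_summable_real_iff)
  moreover have "infsum (pmf M) S = 1"
    using infsetsum_infsum[OF abs] infsetsum_pmf_eq_1[OF assms] by simp
  ultimately show ?thesis by (metis has_sum_infsum)
qed

lemma weighted_summable:
  fixes w f :: "'a \<Rightarrow> real"
  assumes "\<And>y. 0 \<le> w y" "w summable_on S" "\<And>y. y \<in> S \<Longrightarrow> \<bar>f y\<bar> \<le> B"
  shows "(\<lambda>y. w y * f y) summable_on S"
proof -
  have "(\<lambda>y. norm (w y * f y)) summable_on S"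
  proof (rule Infinite_Sum.abs_summable_on_comparison_test')
    show "(\<lambda>y. B * w y) summable_on S" by (rule summable_on_cmult_right[OF assms(2)])
    show "norm (w y * f y) \<le> B * w y" if "y \<in> S" for y
      using mult_left_mono[OF assms(3)[OF that] assms(1)[of y]] assms(1)[of y] by (simp add: abs_mult mult.commute)
  qed
  thus ?thesis by (rule abs_summable_summable)
qed

lemma expectation_has_sum:
  assumes "set_pmf M \<subseteq> S" "\<And>y. \<bar>f y\<bar> \<le> B"
  shows "((\<lambda>y. pmf M y * f y) has_sum measure_pmf.expectation M f) S"
proof -
  have "(pmf M has_sum 1) UNIV" by (rule pmf_has_sum) simp
  hence sm: "(\<lambda>y. pmf M y * f y) summable_on UNIV"
    by (intro weighted_summable[where B = B]) (use assms(2) in \<open>auto simp: summable_on_def\<close>)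
  hence "Infinite_Set_Sum.abs_summable_on (\<lambda>y. pmf M y * f y) UNIV"
    by (simp only: abs_summable_real_iff)
  hence "measure_pmf.expectation M f = infsum (\<lambda>y. pmf M y * f y) UNIV"
    unfolding pmf_expectation_eq_infsetsum by (rule infsetsum_infsum)
  hence "((\<lambda>y. pmf M y * f y) has_sum measure_pmf.expectation M f) UNIV"
    using sm by (metis has_sum_infsum)
  thus ?thesis
    by (rule has_sum_cong_neutral[THEN iffD1, rotated -1]) (use assms(1) in \<open>auto simp: set_pmf_eq\<close>)
qed

lemma weighted_sum_truncation:
  fixes w f :: "'a \<Rightarrow> real"
  assumes w: "\<And>y. 0 \<le> w y" "(w has_sum 1) S" and F: "finite F" "F \<subseteq> S" "1 - \<epsilon> \<le> (\<Sum>y\<in>F. w y)"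
    and f: "\<And>y. \<bar>f y\<bar> \<le> B"
  shows "\<bar>(\<Sum>\<^sub>\<infinity>y\<in>S. w y * f y) - (\<Sum>y\<in>F. w y * f y)\<bar> \<le> B * \<epsilon>"
proof -
  have B: "0 \<le> B" using f[of undefined] by simp
  have sm: "(\<lambda>y. w y * f y) summable_on S"
    by (rule weighted_summable[where B = B]) (use w f in \<open>auto simp: summable_on_def\<close>)
  have D: "((\<lambda>y. w y * f y) has_sum ((\<Sum>\<^sub>\<infinity>y\<in>S. w y * f y) - (\<Sum>y\<in>F. w y * f y))) (S - F)" (is "(_ has_sum ?D) _")
    by (rule has_sum_Diff[OF has_sum_infsum[OF sm] has_sum_finite[OF F(1)] F(2)])
  have tail: "((\<lambda>y. B * w y) has_sum (B * (1 - (\<Sum>y\<in>F. w y)))) (S - F)"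
    by (rule has_sum_cmult_right[OF has_sum_Diff[OF w(2) has_sum_finite[OF F(1)] F(2)]])
  have le: "\<bar>w y * f y\<bar> \<le> B * w y" for y
    using mult_left_mono[OF f[of y] w(1)[of y]] w(1)[of y] by (simp add: abs_mult mult.commute)
  have "?D \<le> B * (1 - (\<Sum>y\<in>F. w y))"
    by (rule has_sum_mono[OF D tail]) (use le in \<open>simp add: abs_le_iff\<close>)
  moreover have "- ?D \<le> B * (1 - (\<Sum>y\<in>F. w y))"
    by (rule has_sum_mono[OF has_sum_uminusI[OF D] tail]) (use le in \<open>simp add: abs_le_iff\<close>)
  moreover have "B * (1 - (\<Sum>y\<in>F. w y)) \<le> B * \<epsilon>" using F(3) B by (intro mult_left_mono) auto
  ultimately show ?thesis by linarith
qed

text \<open>Up to \<open>\<epsilon>\<close>, a single finite set carries the mass of all the weights and hence of their pointwise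
  limit; on a finite set pointwise convergence is enough.\<close>

lemma tight_imp_weak_limit:
  fixes w :: "nat \<Rightarrow> 'a \<Rightarrow> real"
  assumes nonneg: "\<And>n y. 0 \<le> w n y" and one: "\<And>n. (w n has_sum 1) S"
    and conv: "\<And>y. y \<in> S \<Longrightarrow> convergent (\<lambda>n. w n y)"
    and tight: "\<And>\<epsilon>. 0 < \<epsilon> \<Longrightarrow> \<exists>F. finite F \<and> F \<subseteq> S \<and> (\<forall>n. 1 - \<epsilon> \<le> (\<Sum>y\<in>F. w n y))"
  shows "\<exists>M. weak_limit S w M"
proof -
  define W where "W y = (if y \<in> S then lim (\<lambda>n. w n y) else 0)" for y
  have lim: "(\<lambda>n. w n y) \<longlonglongrightarrow> W y" if "y \<in> S" for y
    using conv[OF that] that by (simp add: W_def convergent_LIMSEQ_iff)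
  have W0: "0 \<le> W y" for y
    by (cases "y \<in> S") (auto intro: LIMSEQ_le_const[OF lim] nonneg, simp add: W_def)
  have lim_sum: "(\<lambda>n. \<Sum>y\<in>F. w n y * f y) \<longlonglongrightarrow> (\<Sum>y\<in>F. W y * f y)" if "F \<subseteq> S" for F and f :: "'a \<Rightarrow> real"
    using lim that by (intro tendsto_intros) auto
  have le1: "(\<Sum>y\<in>F. W y) \<le> 1" if "finite F" "F \<subseteq> S" for F
    using lim_sum[OF that(2), of "\<lambda>_. 1"] finite_sum_le_has_sum[OF one that nonneg]
    by (intro LIMSEQ_le_const2) auto
  have ge: "1 - \<epsilon> \<le> (\<Sum>y\<in>F. W y)" if "F \<subseteq> S" "\<forall>n. 1 - \<epsilon> \<le> (\<Sum>y\<in>F. w n y)" for F \<epsilon>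
    using lim_sum[OF that(1), of "\<lambda>_. 1"] that(2) by (intro LIMSEQ_le_const) auto
  have W1: "(W has_sum 1) S"
  proof -
    have sm: "W summable_on S"
      by (rule nonneg_bdd_above_summable_on) (use W0 le1 in \<open>auto intro!: bdd_aboveI[where M = 1]\<close>)
    have "infsum W S \<le> 1" by (rule infsum_le_finite_sums[OF sm]) (rule le1)
    moreover have "1 - \<epsilon> \<le> infsum W S" if "0 < \<epsilon>" for \<epsilon>
    proof -
      obtain F where F: "finite F" "F \<subseteq> S" "\<forall>n. 1 - \<epsilon> \<le> (\<Sum>y\<in>F. w n y)" using tight[OF \<open>0 < \<epsilon>\<close>] by blast
      have "1 - \<epsilon> \<le> (\<Sum>y\<in>F. W y)" using ge F by blast
      also have "\<dots> \<le> infsum W S" by (rule finite_sum_le_infsum[OF sm F(1,2)]) (rule W0)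
      finally show ?thesis .
    qed
    hence "1 \<le> infsum W S" using field_le_epsilon[of 1 "infsum W S"] by (simp add: algebra_simps)
    ultimately show ?thesis using sm by (metis has_sum_infsum order_antisym)
  qed
  have W1': "(W has_sum 1) UNIV"
    using W1 by (rule has_sum_cong_neutral[THEN iffD1, rotated -1]) (auto simp: W_def)
  define M where "M = embed_pmf W"
  have "Infinite_Set_Sum.abs_summable_on W UNIV"
    using W1' by (auto simp: abs_summable_real_iff summable_on_def)
  hence "(\<integral>\<^sup>+y. ennreal (W y) \<partial>count_space UNIV) = 1"
    using nn_integral_conv_infsetsum[of W UNIV] infsetsum_infsum[of W UNIV] W0 infsumI[OF W1'] by simp
  hence M: "pmf M y = W y" for y unfolding M_def by (rule pmf_embed_pmf[OF W0])
  have sub: "set_pmf M \<subseteq> S" by (auto simp: set_pmf_eq M W_def split: if_splits)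
  have "(\<lambda>n. \<Sum>\<^sub>\<infinity>y\<in>S. w n y * f y) \<longlonglongrightarrow> measure_pmf.expectation M f" if bf: "bounded (range f)" for f :: "'a \<Rightarrow> real"
  proof (rule LIMSEQ_I)
    fix r :: real assume r: "0 < r"
    obtain B where B: "\<And>y. \<bar>f y\<bar> \<le> B" using bf by (auto simp: bounded_iff)
    have B0: "0 \<le> B" using B[of undefined] by simp
    define \<epsilon> where "\<epsilon> = r / (3 * (B + 1))"
    have \<epsilon>: "0 < \<epsilon>" "B * \<epsilon> < r / 3"
      using r B0 by (auto simp: \<epsilon>_def field_simps)
    obtain F where F: "finite F" "F \<subseteq> S" "\<And>n. 1 - \<epsilon> \<le> (\<Sum>y\<in>F. w n y)" using tight[OF \<epsilon>(1)] by blast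
    have E: "measure_pmf.expectation M f = (\<Sum>\<^sub>\<infinity>y\<in>S. W y * f y)"
      using infsumI[OF expectation_has_sum[OF sub, of f B]] B by (simp add: M)
    have tW: "\<bar>(\<Sum>\<^sub>\<infinity>y\<in>S. W y * f y) - (\<Sum>y\<in>F. W y * f y)\<bar> \<le> B * \<epsilon>"
      by (rule weighted_sum_truncation[OF W0 W1 F(1,2) _ B]) (rule ge, use F in auto)
    have tw: "\<bar>(\<Sum>\<^sub>\<infinity>y\<in>S. w n y * f y) - (\<Sum>y\<in>F. w n y * f y)\<bar> \<le> B * \<epsilon>" for n
      by (rule weighted_sum_truncation[OF nonneg one F(1,2,3) B])
    obtain n0 where n0: "\<And>n. n0 \<le> n \<Longrightarrow> \<bar>(\<Sum>y\<in>F. w n y * f y) - (\<Sum>y\<in>F. W y * f y)\<bar> < r / 3"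
      using LIMSEQ_D[OF lim_sum[OF F(2), of f], of "r / 3"] r by auto
    show "\<exists>n0. \<forall>n\<ge>n0. norm ((\<Sum>\<^sub>\<infinity>y\<in>S. w n y * f y) - measure_pmf.expectation M f) < r"
    proof (intro exI[of _ n0] allI impI)
      fix n assume "n0 \<le> n"
      thus "norm ((\<Sum>\<^sub>\<infinity>y\<in>S. w n y * f y) - measure_pmf.expectation M f) < r"
        unfolding E real_norm_def using n0[of n] tW tw[of n] \<epsilon>(2) by linarith
    qed
  qed
  with sub show ?thesis unfolding weak_limit_def by blast
qed

lemma weak_limit_offset:
  assumes "weak_limit S (\<lambda>n. w (n + k)) M" shows "weak_limit S w M"
  unfolding weak_limit_def
proof (intro conjI allI impI)
  show "set_pmf M \<subseteq> S" using assms by (simp add: weak_limit_def)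
  fix f :: "'a \<Rightarrow> real" assume "bounded (range f)"
  hence "(\<lambda>N. \<Sum>\<^sub>\<infinity>y\<in>S. w (N + k) y * f y) \<longlonglongrightarrow> measure_pmf.expectation M f"
    using assms unfolding weak_limit_def by blast
  thus "(\<lambda>N. \<Sum>\<^sub>\<infinity>y\<in>S. w N y * f y) \<longlonglongrightarrow> measure_pmf.expectation M f"
    by (rule LIMSEQ_offset)
qed

section \<open>Boundedness of Schur polynomials\<close>

definition bdd_on :: "'a set \<Rightarrow> ('a \<Rightarrow> real) \<Rightarrow> bool" where
  "bdd_on S f \<longleftrightarrow> (\<exists>B. \<forall>x\<in>S. \<bar>f x\<bar> \<le> B)"

lemma bdd_on_const: "bdd_on S (\<lambda>_. c)" by (auto simp: bdd_on_def)

lemma bdd_on_add: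
  assumes "bdd_on S f" "bdd_on S g" shows "bdd_on S (\<lambda>x. f x + g x)"
proof -
  obtain B C where "\<And>x. x \<in> S \<Longrightarrow> \<bar>f x\<bar> \<le> B" "\<And>x. x \<in> S \<Longrightarrow> \<bar>g x\<bar> \<le> C" using assms by (auto simp: bdd_on_def)
  thus ?thesis unfolding bdd_on_def by (intro exI[of _ "B + C"]) (fastforce intro: order_trans[OF abs_triangle_ineq])
qed

lemma bdd_on_mult:
  assumes "bdd_on S f" "bdd_on S g" shows "bdd_on S (\<lambda>x. f x * g x)"
proof -
  obtain B C where BC: "\<And>x. x \<in> S \<Longrightarrow> \<bar>f x\<bar> \<le> B" "\<And>x. x \<in> S \<Longrightarrow> \<bar>g x\<bar> \<le> C" using assms by (auto simp: bdd_on_def)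
  have "\<bar>f x * g x\<bar> \<le> B * C" if "x \<in> S" for x
    unfolding abs_mult using BC[OF that] by (intro mult_mono) auto
  thus ?thesis unfolding bdd_on_def by blast
qed

lemma bdd_on_sum: "(\<And>i. i \<in> I \<Longrightarrow> bdd_on S (f i)) \<Longrightarrow> bdd_on S (\<lambda>x. \<Sum>i\<in>I. f i x)"
  by (induction I rule: infinite_finite_induct) (auto intro: bdd_on_const bdd_on_add)

lemma bdd_on_prod: "(\<And>i. i \<in> I \<Longrightarrow> bdd_on S (f i)) \<Longrightarrow> bdd_on S (\<lambda>x. \<Prod>i\<in>I. f i x)"
  by (induction I rule: infinite_finite_induct) (auto intro: bdd_on_const bdd_on_mult)

context qlattice begin

text \<open>The formula for a Schur polynomial as a quotient does not show that it stays bounded when points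
  collide at \<open>0\<close>; the formula in terms of elementary symmetric functions does.\<close>

lemma schur_norm_bounded:
  assumes "\<nu> \<in> partitions_le K"
  obtains B where "\<And>Z. Z \<in> cfg K \<Longrightarrow> Z \<subseteq> {-R..R} \<Longrightarrow> \<bar>schur_poly_norm q \<nu> K Z\<bar> \<le> B"
proof -
  let ?S = "{Z \<in> cfg K. Z \<subseteq> {-R..R}}"
  have e: "bdd_on ?S (\<lambda>Z. ecoeff Z j)" for j
    unfolding bdd_on_def
  proof (intro exI ballI)
    fix Z assume Z: "Z \<in> ?S"
    have "(\<Sum>x\<in>Z. \<bar>x\<bar>) \<le> 2 * \<bar>R\<bar> / (1 - q)" using Z cfgD by (intro sum_abs_le) auto
    thus "\<bar>ecoeff Z j\<bar> \<le> exp (2 * \<bar>R\<bar> / (1 - q))"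
      using abs_ecoeff_le[of Z j] Z cfgD(2)[of Z K] by (auto intro: order_trans)
  qed
  have rem: "bdd_on ?S (\<lambda>Z. power_rem (ecoeff Z) m j)" for m j
  proof (induction m arbitrary: j)
    case 0
    show ?case using bdd_on_mult[OF bdd_on_const[of _ "-1"] e[of "Suc j"]] by simp
  next
    case (Suc m)
    show ?case
      using bdd_on_add[OF Suc.IH[of "Suc j"] bdd_on_mult[OF Suc.IH[of 0] bdd_on_mult[OF bdd_on_const[of _ "-1"] e[of "Suc j"]]]]
      by simp
  qed
  have entry: "bdd_on ?S (\<lambda>Z. schur_entry (ecoeff Z) \<nu> i j)" for i j
    unfolding schur_entry_def by (cases "i < \<nu> i") (auto intro: rem bdd_on_const)
  have "bdd_on ?S (\<lambda>Z. inverse (schur_poly \<nu> K (\<lambda>i. q ^ i)) * fdet K (schur_entry (ecoeff Z) \<nu>))"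
    unfolding fdet_row by (intro bdd_on_mult bdd_on_sum bdd_on_prod bdd_on_const entry)
  then obtain B where B: "\<And>Z. Z \<in> ?S \<Longrightarrow> \<bar>inverse (schur_poly \<nu> K (\<lambda>i. q ^ i)) * fdet K (schur_entry (ecoeff Z) \<nu>)\<bar> \<le> B"
    by (auto simp: bdd_on_def)
  show ?thesis
  proof (rule that)
    fix Z assume Z: "Z \<in> cfg K" "Z \<subseteq> {-R..R}"
    note Zp = cfgD(2,3)[OF Z(1)]
    have "schur_poly_norm q \<nu> K Z = inverse (schur_poly \<nu> K (\<lambda>i. q ^ i)) * fdet K (schur_entry (ecoeff Z) \<nu>)"
      using schur_poly_eq_entries[OF assms order_refl elt_inj[OF Zp]] unfolding elt_image[OF Zp]
      by (simp add: schur_poly_norm_def divide_inverse mult.commute)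
    thus "\<bar>schur_poly_norm q \<nu> K Z\<bar> \<le> B" using B[of Z] Z by simp
  qed
qed

section \<open>The limit measure\<close>

abbreviation "lnk \<equiv> Link q zm zp"

lemma Link_schur_law:
  assumes "K \<le> N" "A \<in> cfg N" "A \<subseteq> {-R..R}"
  shows "schur_law K R (lnk N K A) (\<lambda>\<nu>. schur_poly_norm q \<nu> N A)"
  unfolding schur_law_def Link_def
proof (intro conjI allI ballI impI)
  have A: "A \<in> cfg (K + (N - K))" using assms by simp
  show "0 \<le> lp K (N - K) A Z" for Z by (rule lp_nonneg)
  show "(lp K (N - K) A has_sum 1) (cfg K)" by (rule has_sum_lp_one[OF A])
  show "Z \<subseteq> {-R..R}" if "lp K (N - K) A Z \<noteq> 0" for Z by (rule lp_support[OF that assms(3)])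
  fix \<nu> assume \<nu>: "\<nu> \<in> partitions_le K"
  obtain B where B: "\<And>Z. Z \<in> cfg K \<Longrightarrow> Z \<subseteq> {-R..R} \<Longrightarrow> \<bar>schur_poly_norm q \<nu> K Z\<bar> \<le> B"
    by (rule schur_norm_bounded[OF \<nu>, where R = R]) (rule that)
  have "((\<lambda>Z. lp K (N - K) A Z * schur_poly_norm q \<nu> K Z) has_sum schur_poly_norm q \<nu> (K + (N - K)) A) (cfg K)"
    using has_sum_lp[where \<phi> = "schur_poly_norm q \<nu>", OF has_sum_link_schur[OF \<nu>] B A assms(3)] .
  thus "((\<lambda>Z. lp K (N - K) A Z * schur_poly_norm q \<nu> K Z) has_sum schur_poly_norm q \<nu> N A) (cfg K)"
    using assms(1) by simp
qed

lemma stabilizing_eventually: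
  assumes X: "X \<subseteq> L" "X \<subseteq> {-R..R}" "infinite X" and st: "stabilizes q zm zp A X"
    and T0: "finite T0" "T0 \<subseteq> X"
  shows "\<forall>\<^sub>F N in sequentially. A N \<in> cfg N \<and> A N \<subseteq> {-(\<bar>R\<bar> + 1)..\<bar>R\<bar> + 1} \<and> T0 \<subseteq> A N"
proof -
  have tc: "tail_conv A X" by (rule stabilizes_tail_conv[OF X st])
  define \<delta> where "\<delta> = Min (insert 1 (abs ` T0))"
  have "\<delta> \<in> insert 1 (abs ` T0)" unfolding \<delta>_def using T0(1) by (intro Min_in) auto
  hence "0 < \<delta>" using T0(2) X(1) L_nonzero by auto
  hence "\<forall>\<^sub>F N in sequentially. away \<delta> (A N) = away \<delta> X"
    using tc by (simp add: tail_conv_def)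
  moreover have "T0 \<subseteq> away \<delta> X" using T0 by (auto simp: \<delta>_def)
  ultimately have "\<forall>\<^sub>F N in sequentially. T0 \<subseteq> A N" by (auto elim!: eventually_mono)
  moreover have "\<forall>\<^sub>F N in sequentially. A N \<in> cfg N"
    using eventually_ge_at_top[of 1] by eventually_elim (use st in \<open>simp add: stabilizes_def\<close>)
  ultimately show ?thesis using tail_conv_window[OF tc X(2)] by eventually_elim blast
qed

text \<open>The moments converge, so the weights converge pointwise; the expected number of points in
  \<open>{-\<delta><..<\<delta>}\<close> is at most \<open>C \<cdot> \<delta>\<close>, and only finitely many configurations in a bounded segment have no such point.\<close>

lemma Link_weak_limit_exists:
  assumes X: "X \<subseteq> L" "X \<subseteq> {-R..R}" "infinite X" and st: "stabilizes q zm zp A X" and K: "1 \<le> K"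
  shows "\<exists>M. weak_limit (cfg K) (\<lambda>N. lnk N K (A N)) M"
proof -
  let ?R = "\<bar>R\<bar> + 1"
  obtain T0 where T0: "finite T0" "T0 \<subseteq> X" "card T0 = K + 2"
    using infinite_arbitrarily_large[OF X(3)] by blast
  obtain N1 where N1: "\<And>N. N1 \<le> N \<Longrightarrow> A N \<in> cfg N \<and> A N \<subseteq> {-?R..?R} \<and> T0 \<subseteq> A N"
    using stabilizing_eventually[OF X st T0(1,2)] unfolding eventually_at_top_linorder by blast
  \<comment> \<open>At least one link is applied, since the bound on points near \<open>0\<close> comes from the first q-integral.\<close>
  define k where "k = N1 + Suc K"
  define w where "w n = lnk (n + k) K (A (n + k))" for n
  have Ak: "A (n + k) \<in> cfg (n + k)" "A (n + k) \<subseteq> {-?R..?R}" "T0 \<subseteq> A (n + k)" and Kk: "K \<le> n + k" for n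
    using N1[of "n + k"] by (auto simp: k_def)
  have law: "schur_law K ?R (w n) (\<lambda>\<nu>. schur_poly_norm q \<nu> (n + k) (A (n + k)))" for n
    unfolding w_def by (rule Link_schur_law[OF Kk Ak(1,2)])
  have "\<exists>M. weak_limit (cfg K) w M"
  proof (rule tight_imp_weak_limit)
    show "0 \<le> w n Z" "(w n has_sum 1) (cfg K)" for n Z using law[of n] by (auto simp: schur_law_def)
    show "convergent (\<lambda>n. w n Z)" if "Z \<in> cfg K" for Z
    proof (rule schur_law_pointwise_convergent[OF law _ that K])
      show "convergent (\<lambda>n. schur_poly_norm q \<nu> (n + k) (A (n + k)))" if "\<nu> \<in> partitions_le K" for \<nu>
        using LIMSEQ_ignore_initial_segment[OF schur_norm_stabilizes[OF X st that], of k]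
        by (auto simp: convergent_def)
    qed
    fix \<epsilon> :: real assume \<epsilon>: "0 < \<epsilon>"
    have T0': "T0 \<subseteq> L" "K + 2 \<le> card T0" "1 \<le> ?R" using T0 X by auto
    obtain C where C0: "0 \<le> C" and C: "\<And>\<delta> d X F. 0 < \<delta> \<Longrightarrow> X \<in> cfg (K + Suc d) \<Longrightarrow> X \<subseteq> {-?R..?R} \<Longrightarrow> T0 \<subseteq> X \<Longrightarrow>
        finite F \<Longrightarrow> F \<subseteq> {Z \<in> cfg K. \<exists>z\<in>Z. \<bar>z\<bar> < \<delta>} \<Longrightarrow> (\<Sum>Z\<in>F. lp K (Suc d) X Z) \<le> C * \<delta>"
      by (rule lp_tight[OF T0(1) T0']) (rule that)
    define \<delta> where "\<delta> = \<epsilon> / (C + 1)"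
    have \<delta>: "0 < \<delta>" "C * \<delta> \<le> \<epsilon>" using \<epsilon> C0 by (auto simp: \<delta>_def field_simps)
    let ?B = "{Z \<in> cfg K. \<exists>z\<in>Z. \<bar>z\<bar> < \<delta>}"
    define F where "F = {Z \<in> cfg K. Z \<subseteq> {-?R..?R} \<and> (\<forall>z\<in>Z. \<delta> \<le> \<bar>z\<bar>)}"
    have "F \<subseteq> Pow (away \<delta> (L \<inter> {-?R..?R}))" using cfgD(1) by (fastforce simp: F_def)
    moreover have "finite (away \<delta> (L \<inter> {-?R..?R}))"
      by (rule finite_away_from_0[OF Int_lower1 Int_lower2 \<delta>(1)])
    ultimately have finF: "finite F" by (meson finite_Pow_iff finite_subset)
    have "1 - \<epsilon> \<le> (\<Sum>Z\<in>F. w n Z)" for n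
    proof -
      have w1: "(w n has_sum 1) (cfg K)" and w0: "\<And>Z. 0 \<le> w n Z" using law[of n] by (auto simp: schur_law_def)
      define d where "d = n + N1"
      have d: "n + k = K + Suc d" by (simp add: d_def k_def)
      have B: "w n summable_on ?B"
        by (rule summable_on_subset_banach[of _ "cfg K"]) (use w1 in \<open>auto simp: summable_on_def\<close>)
      have "infsum (w n) ?B \<le> C * \<delta>"
      proof (rule infsum_le_finite_sums[OF B])
        fix G assume G: "finite G" "G \<subseteq> ?B"
        have "w n = lp K (Suc d) (A (K + Suc d))" unfolding w_def Link_def d by simp
        thus "(\<Sum>Z\<in>G. w n Z) \<le> C * \<delta>"
          using C[OF \<delta>(1) _ _ _ G, of "A (K + Suc d)" d] Ak[of n] unfolding d by simp
      qed
      moreover have "(w n has_sum (1 - infsum (w n) ?B)) (cfg K - ?B)"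
        by (rule has_sum_Diff[OF w1 has_sum_infsum[OF B]]) auto
      hence "(w n has_sum (1 - infsum (w n) ?B)) F"
        by (rule has_sum_cong_neutral[THEN iffD1, rotated -1])
           (use law[of n] in \<open>auto simp: F_def schur_law_def not_less\<close>)
      hence "(\<Sum>Z\<in>F. w n Z) = 1 - infsum (w n) ?B" using has_sum_unique[OF has_sum_finite[OF finF]] by blast
      ultimately show ?thesis using \<delta>(2) by linarith
    qed
    thus "\<exists>F. finite F \<and> F \<subseteq> cfg K \<and> (\<forall>n. 1 - \<epsilon> \<le> (\<Sum>Z\<in>F. w n Z))"
      using finF by (intro exI[of _ F]) (auto simp: F_def)
  qed
  thus ?thesis using weak_limit_offset[of "cfg K" "\<lambda>N. lnk N K (A N)" k] unfolding w_def by blast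
qed

text \<open>An infinite bounded configuration accumulates at \<open>0\<close>.\<close>

lemma zero_in_segment:
  assumes X: "X \<subseteq> L" "X \<subseteq> {-R..R}" "infinite X"
  shows "Inf X \<le> 0" "0 \<le> Sup X" and "X \<subseteq> {Inf X..Sup X}" "{Inf X..Sup X} \<subseteq> {-R..R}"
proof -
  have bdd: "bdd_below X" "bdd_above X" "X \<noteq> {}"
    using X(2,3) by (auto intro: bdd_below_mono[OF bdd_below_Icc] bdd_above_mono[OF bdd_above_Icc])
  show sub: "X \<subseteq> {Inf X..Sup X}" using bdd by (auto intro: cInf_lower cSup_upper)
  have near0: "\<exists>x\<in>X. \<bar>x\<bar> < \<delta>" if "0 < \<delta>" for \<delta>
  proof (rule ccontr)
    assume "\<not> (\<exists>x\<in>X. \<bar>x\<bar> < \<delta>)"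
    hence "X = away \<delta> X" by auto
    thus False using finite_away_from_0[OF X(1,2) that] X(3) by simp
  qed
  show "Inf X \<le> 0"
  proof (rule ccontr)
    assume "\<not> Inf X \<le> 0"
    then obtain x where "x \<in> X" "\<bar>x\<bar> < Inf X" using near0[of "Inf X"] by auto
    thus False using sub by force
  qed
  show "0 \<le> Sup X"
  proof (rule ccontr)
    assume "\<not> 0 \<le> Sup X"
    then obtain x where "x \<in> X" "\<bar>x\<bar> < - Sup X" using near0[of "- Sup X"] by auto
    thus False using sub by force
  qed
  have "-R \<le> Inf X" using bdd X(2) by (intro cInf_greatest) auto
  moreover have "Sup X \<le> R" using bdd X(2) by (intro cSup_least) auto
  ultimately show "{Inf X..Sup X} \<subseteq> {-R..R}" by auto
qed

lemma cfg_subset_segment: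
  assumes "Z \<in> cfg K" "1 \<le> K"
  shows "segment_of Z \<subseteq> {a..b} \<longleftrightarrow> Z \<subseteq> {a..b}"
proof -
  have Z: "finite Z" "Z \<noteq> {}" using cfgD[OF assms(1)] assms(2) by auto
  have "Inf Z \<in> Z" "Sup Z \<in> Z" using Z by (simp_all add: cInf_eq_Min cSup_eq_Max)
  moreover have "Z \<subseteq> segment_of Z" using Z by (auto simp: segment_of_def cInf_eq_Min cSup_eq_Max)
  ultimately show ?thesis by (fastforce simp: segment_of_def)
qed

text \<open>Interlacing keeps configurations inside the segment of the starting one. Since \<open>0\<close> lies in the
  segment of \<open>X\<close>, a point outside has a positive distance from \<open>0\<close>, and beyond that distance the starting
  configuration eventually agrees with \<open>X\<close>.\<close>

lemma Link_vanishes_outside: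
  assumes X: "X \<subseteq> L" "X \<subseteq> {-R..R}" "infinite X" and st: "stabilizes q zm zp A X"
    and Z: "Z \<in> cfg K" "1 \<le> K" "\<not> segment_of Z \<subseteq> segment_of X"
  shows "\<forall>\<^sub>F N in sequentially. lnk N K (A N) Z = 0"
proof -
  note seg = zero_in_segment[OF X]
  have "\<not> Z \<subseteq> {Inf X..Sup X}"
    using Z(3) unfolding segment_of_def[of X] cfg_subset_segment[OF Z(1,2)] .
  then obtain z where "z \<in> Z" "z \<notin> {Inf X..Sup X}" by blast
  hence z: "z \<in> Z" "z < Inf X \<or> Sup X < z" by auto
  have "0 < \<bar>z\<bar>" using z(2) seg(1,2) by auto
  hence "\<forall>\<^sub>F N in sequentially. {x \<in> A N. \<bar>z\<bar> \<le> \<bar>x\<bar>} = {x \<in> X. \<bar>z\<bar> \<le> \<bar>x\<bar>}"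
    using stabilizes_tail_conv[OF X st] by (simp add: tail_conv_def)
  thus ?thesis using eventually_ge_at_top[of 1]
  proof eventually_elim
    case (elim N)
    have "A N \<in> cfg N" using st elim(2) by (simp add: stabilizes_def)
    hence A: "finite (A N)" "A N \<noteq> {}" using cfgD[of "A N" N] elim(2) by auto
    show ?case
    proof (rule ccontr)
      assume "lnk N K (A N) Z \<noteq> 0"
      moreover have "A N \<subseteq> {Min (A N)..Max (A N)}" using A by auto
      ultimately have "z \<in> {Min (A N)..Max (A N)}" using lp_support z(1) unfolding Link_def by blast
      moreover have "Min (A N) \<in> A N" "Max (A N) \<in> A N" using A by auto
      ultimately obtain x where x: "x \<in> A N" "z < Inf X \<and> x \<le> z \<or> Sup X < z \<and> z \<le> x"
        using z(2) by auto
      hence "\<bar>z\<bar> \<le> \<bar>x\<bar>" using seg(1,2) by auto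
      hence "x \<in> X" using elim(1) x(1) by blast
      thus False using seg(3) x(2) by fastforce
    qed
  qed
qed

text \<open>The two characteristic properties pass to the limit: the vanishing outside the segment pointwise,
  and the moments because on a bounded segment a Schur polynomial is a bounded test function.\<close>

lemma weak_limit_schur_law:
  assumes X: "X \<subseteq> L" "X \<subseteq> {-R..R}" "infinite X" and st: "stabilizes q zm zp A X" and K: "1 \<le> K"
    and M: "weak_limit (cfg K) (\<lambda>N. lnk N K (A N)) M"
  shows "set_pmf M \<subseteq> cfg K"
    and "\<And>Z. Z \<in> cfg K \<Longrightarrow> \<not> segment_of Z \<subseteq> segment_of X \<Longrightarrow> pmf M Z = 0"
    and "schur_law K R (pmf M) (\<lambda>\<nu>. schur_fun_norm q \<nu> X)"
proof -
  note seg = zero_in_segment[OF X]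
  show sub: "set_pmf M \<subseteq> cfg K" using M by (simp add: weak_limit_def)
  have test: "(\<lambda>N. \<Sum>\<^sub>\<infinity>Z\<in>cfg K. lnk N K (A N) Z * f Z) \<longlonglongrightarrow> measure_pmf.expectation M f"
    if "\<And>Z. \<bar>f Z\<bar> \<le> B" for f B
  proof -
    have "bounded (range f)" using that by (auto simp: bounded_iff)
    thus ?thesis using M by (simp add: weak_limit_def)
  qed
  show out: "pmf M Z = 0" if Z: "Z \<in> cfg K" "\<not> segment_of Z \<subseteq> segment_of X" for Z
  proof -
    let ?f = "\<lambda>Y. of_bool (Y = Z) :: real"
    have single: "(\<Sum>\<^sub>\<infinity>Y\<in>cfg K. g Y * ?f Y) = g Z" for g
    proof -
      have "(\<Sum>\<^sub>\<infinity>Y\<in>cfg K. g Y * ?f Y) = (\<Sum>\<^sub>\<infinity>Y\<in>{Z}. g Y * ?f Y)"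
        by (rule infsum_cong_neutral) (use Z(1) in auto)
      thus ?thesis by simp
    qed
    have b: "\<bar>?f Y\<bar> \<le> 1" for Y by simp
    have "measure_pmf.expectation M ?f = pmf M Z"
      using infsumI[OF expectation_has_sum[OF sub b]] single[of "pmf M"] by simp
    hence "(\<lambda>N. lnk N K (A N) Z) \<longlonglongrightarrow> pmf M Z" using test[of ?f 1, OF b] unfolding single by simp
    moreover have "(\<lambda>N. lnk N K (A N) Z) \<longlonglongrightarrow> 0"
      by (rule tendsto_eventually[OF Link_vanishes_outside[OF X st Z(1) K Z(2)]])
    ultimately show ?thesis by (rule LIMSEQ_unique)
  qed
  let ?R = "\<bar>R\<bar> + 1"
  show "schur_law K R (pmf M) (\<lambda>\<nu>. schur_fun_norm q \<nu> X)"
    unfolding schur_law_def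
  proof (intro conjI allI ballI impI)
    show "0 \<le> pmf M Z" for Z by simp
    show "(pmf M has_sum 1) (cfg K)" by (rule pmf_has_sum[OF sub])
    show inR: "Z \<subseteq> {-R..R}" if "Z \<in> cfg K" "pmf M Z \<noteq> 0" for Z
      using out[OF that(1)] that(2) seg(4) cfg_subset_segment[OF that(1) K, of "Inf X" "Sup X"]
      unfolding segment_of_def[of X] by blast
    fix \<nu> assume \<nu>: "\<nu> \<in> partitions_le K"
    obtain B where B: "\<And>Z. Z \<in> cfg K \<Longrightarrow> Z \<subseteq> {-?R..?R} \<Longrightarrow> \<bar>schur_poly_norm q \<nu> K Z\<bar> \<le> B"
      by (rule schur_norm_bounded[OF \<nu>, where R = ?R]) (rule that)
    define f where "f Z = (if Z \<in> cfg K \<and> Z \<subseteq> {-?R..?R} then schur_poly_norm q \<nu> K Z else 0)" for Z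
    have f: "\<bar>f Z\<bar> \<le> max B 0" for Z using B by (auto simp: f_def intro: max.coboundedI1)
    have "\<forall>\<^sub>F N in sequentially. (\<Sum>\<^sub>\<infinity>Z\<in>cfg K. lnk N K (A N) Z * f Z) = schur_poly_norm q \<nu> N (A N)"
      using stabilizing_eventually[OF X st finite.emptyI empty_subsetI] eventually_ge_at_top[of K]
    proof eventually_elim
      case (elim N)
      have law: "schur_law K ?R (lnk N K (A N)) (\<lambda>\<nu>. schur_poly_norm q \<nu> N (A N))"
        using elim by (intro Link_schur_law) auto
      have "(\<Sum>\<^sub>\<infinity>Z\<in>cfg K. lnk N K (A N) Z * f Z) = (\<Sum>\<^sub>\<infinity>Z\<in>cfg K. lnk N K (A N) Z * schur_poly_norm q \<nu> K Z)"
        by (rule infsum_cong) (use law in \<open>auto simp: f_def schur_law_def\<close>)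
      thus ?case using law \<nu> by (auto simp: schur_law_def dest: infsumI)
    qed
    hence "(\<lambda>N. schur_poly_norm q \<nu> N (A N)) \<longlonglongrightarrow> measure_pmf.expectation M f"
      by (rule Lim_transform_eventually[OF test[OF f]])
    hence E: "measure_pmf.expectation M f = schur_fun_norm q \<nu> X"
      using schur_norm_stabilizes[OF X st \<nu>] by (rule LIMSEQ_unique)
    have "((\<lambda>Z. pmf M Z * f Z) has_sum schur_fun_norm q \<nu> X) (cfg K)"
      using expectation_has_sum[where f = f, OF sub f] unfolding E .
    thus "((\<lambda>Z. pmf M Z * schur_poly_norm q \<nu> K Z) has_sum schur_fun_norm q \<nu> X) (cfg K)"
    proof (rule has_sum_cong[THEN iffD1, rotated])
      fix Z assume Z: "Z \<in> cfg K"
      have "{-R..R} \<subseteq> {-?R..?R}" by auto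
      hence "pmf M Z \<noteq> 0 \<Longrightarrow> Z \<subseteq> {-?R..?R}" using inR[OF Z] by blast
      thus "pmf M Z * f Z = pmf M Z * schur_poly_norm q \<nu> K Z"
        using Z by (cases "pmf M Z = 0") (simp_all add: f_def)
    qed
  qed
qed

lemma pmf_eq_of_schur_law:
  assumes "set_pmf M \<subseteq> cfg K" "set_pmf P \<subseteq> cfg K" "schur_law K R (pmf M) m" "schur_law K R (pmf P) m" "1 \<le> K"
  shows "M = P"
proof (rule pmf_eqI)
  fix Z
  show "pmf M Z = pmf P Z"
  proof (cases "Z \<in> cfg K")
    case True
    show ?thesis by (rule schur_law_unique[OF assms(3,4) True assms(5)])
  next
    case False
    hence "Z \<notin> set_pmf M" "Z \<notin> set_pmf P" using assms(1,2) by auto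
    thus ?thesis by (simp add: set_pmf_iff)
  qed
qed

text \<open>The weak limits along all stabilizing sequences solve the same moment problem.\<close>

lemma Meas_weak_limit:
  assumes X: "X \<subseteq> L" "X \<subseteq> {-R..R}" "infinite X" and K: "1 \<le> K"
  shows "weak_limit (cfg K) (\<lambda>N. lnk N K (var_series X ` {..<N})) (Meas q zm zp X K)"
proof -
  let ?T = "\<lambda>N. var_series X ` {..<N}"
  have T: "stabilizes q zm zp ?T X" by (rule truncations_stabilize[OF X])
  obtain M where M: "weak_limit (cfg K) (\<lambda>N. lnk N K (?T N)) M"
    using Link_weak_limit_exists[OF X T K] by blast
  have eq: "M' = M" if st: "stabilizes q zm zp A X" and M': "weak_limit (cfg K) (\<lambda>N. lnk N K (A N)) M'" for A M'
    using weak_limit_schur_law[OF X st K M'] weak_limit_schur_law[OF X T K M] K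
    by (intro pmf_eq_of_schur_law) auto
  have "Meas q zm zp X K = M"
    unfolding Meas_def
  proof (rule the_equality)
    show "\<forall>A. stabilizes q zm zp A X \<longrightarrow> weak_limit (cfg K) (\<lambda>N. lnk N K (A N)) M"
      using eq Link_weak_limit_exists[OF X _ K] by metis
  qed (use eq T in blast)
  thus ?thesis using M by simp
qed

end

theorem theorem3p10:
  fixes q zm zp :: real and X :: "real set" and K :: nat
  assumes "0 < q" and "q < 1" and "zm < 0" and "0 < zp"
    and "X \<in> configs_inf q zm zp" and "1 \<le> K"
  shows
    "set_pmf (Meas q zm zp X K) \<subseteq> configs q zm zp K \<and>
     (\<forall>Y\<in>configs q zm zp K. \<not> segment_of Y \<subseteq> segment_of X \<longrightarrow> pmf (Meas q zm zp X K) Y = 0) \<and>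
     (\<forall>\<nu>\<in>partitions_le K.
        ((\<lambda>Y. pmf (Meas q zm zp X K) Y * schur_poly_norm q \<nu> K Y) has_sum schur_fun_norm q \<nu> X)
          {Y \<in> configs q zm zp K. segment_of Y \<subseteq> segment_of X}) \<and>
     (\<forall>P :: real set pmf.
        set_pmf P \<subseteq> configs q zm zp K \<and>
        (\<forall>Y\<in>configs q zm zp K. \<not> segment_of Y \<subseteq> segment_of X \<longrightarrow> pmf P Y = 0) \<and>
        (\<forall>\<nu>\<in>partitions_le K.
           ((\<lambda>Y. pmf P Y * schur_poly_norm q \<nu> K Y) has_sum schur_fun_norm q \<nu> X)
             {Y \<in> configs q zm zp K. segment_of Y \<subseteq> segment_of X})
        \<longrightarrow> P = Meas q zm zp X K)"
proof -
  interpret qlattice q zm zp by unfold_locales (use assms in auto)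
  note K = \<open>1 \<le> K\<close>
  obtain R where "\<And>x. x \<in> X \<Longrightarrow> \<bar>x\<bar> \<le> R" using assms(5) by (auto simp: configs_inf_def bounded_iff)
  hence X: "X \<subseteq> L" "X \<subseteq> {-R..R}" "infinite X" using assms(5) by (auto simp: configs_inf_def abs_le_iff) (smt (verit))
  note law = weak_limit_schur_law[OF X truncations_stabilize[OF X] K Meas_weak_limit[OF X K]]
  let ?M = "Meas q zm zp X K" and ?S = "{Y \<in> cfg K. segment_of Y \<subseteq> segment_of X}"
  let ?supp = "\<lambda>M. \<forall>Y\<in>cfg K. \<not> segment_of Y \<subseteq> segment_of X \<longrightarrow> pmf M Y = 0"
  have restrict: "((\<lambda>Y. pmf M Y * g Y) has_sum s) (cfg K) \<longleftrightarrow> ((\<lambda>Y. pmf M Y * g Y) has_sum s) ?S"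
    if "?supp M" for M g and s :: real
    by (rule has_sum_cong_neutral) (use that in auto)
  have moments: "((\<lambda>Y. pmf ?M Y * schur_poly_norm q \<nu> K Y) has_sum schur_fun_norm q \<nu> X) ?S"
    if "\<nu> \<in> partitions_le K" for \<nu>
    using law(2,3) restrict that by (auto simp: schur_law_def)
  have unique: "P = ?M" if P: "set_pmf P \<subseteq> cfg K" "?supp P"
    "\<forall>\<nu>\<in>partitions_le K. ((\<lambda>Y. pmf P Y * schur_poly_norm q \<nu> K Y) has_sum schur_fun_norm q \<nu> X) ?S" for P
  proof (rule pmf_eq_of_schur_law[OF P(1) law(1) _ law(3) K])
    show "schur_law K R (pmf P) (\<lambda>\<nu>. schur_fun_norm q \<nu> X)"
      unfolding schur_law_def
    proof (intro conjI allI ballI impI)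
      show "(pmf P has_sum 1) (cfg K)" by (rule pmf_has_sum[OF P(1)])
      show "Z \<subseteq> {-R..R}" if "Z \<in> cfg K" "pmf P Z \<noteq> 0" for Z
        using P(2) that zero_in_segment(4)[OF X] cfg_subset_segment[OF that(1) K, of "Inf X" "Sup X"]
        unfolding segment_of_def[of X] by blast
    qed (use P restrict[OF P(2)] in simp_all)
  qed
  show ?thesis using law(1,2) moments unique by blast
qed

end
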